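(* Let $H$ be any harmonic function on $\mathbb{R}^3$. For $\epsilon>0$ let $u=u_\epsilon$ be the solution of the two-ball insulated conductivity problem (described in the context) for this $H$. Then there is a constant $C$ independent of $\epsilon$ such that $$|\nabla u(x,0,0)|\le C\,\frac{1}{\epsilon^{\frac{2-\sqrt2}{2}}}\qquad\text{for all } |x|<\frac{\epsilon}{2}$$ and all sufficiently small $\epsilon>0$.
   Context: For $\epsilon>0$, $B_1$ and $B_2$ denote the open unit balls in $\mathbb{R}^3$ centered at $(-1-\frac{\epsilon}{2},0,0)$ and $(1+\frac{\epsilon}{2},0,0)$ respectively, so that $\mathrm{dist}(B_1,B_2)=\epsilon$. Given a harmonic function $H$ on $\mathbb{R}^3$, the solution $u$ of the insulated conductivity problem is the function satisfying $\Delta u=0$ in $\mathbb{R}^3\setminus\overline{B_1\cup B_2}$, $\partial_\nu u=0$ on $\partial(B_1\cup B_2)$ ($\nu$ the unit normal), and $u(\mathbf{x})-H(\mathbf{x})=O(|\mathbf{x}|^{-2})$ as $|\mathbf{x}|\to\infty$. Points are written $\mathbf{x}=(x,y,z)$. "For all sufficiently small $\epsilon$" means for all $0<\epsilon<\epsilon_0$ for some $\epsilon_0>0$; the constant $C$ may depend on $H$. *)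

theory Defs
  imports "HOL-Analysis.Analysis" "HOL-Library.Landau_Symbols"
begin

definition grad :: "(real^'n \<Rightarrow> real) \<Rightarrow> real^'n \<Rightarrow> real^'n" where
  "grad f x = (THE D. GDERIV f x :> D)"

lemma GDERIV_grad:
  fixes f :: "real^'n \<Rightarrow> real"
  assumes "GDERIV f x :> D"
  shows "grad f x = D"
proof -
  have "D' = D" if "GDERIV f x :> D'" for D'
  proof -
    have "(\<lambda>h. h \<bullet> D') = (\<lambda>h. h \<bullet> D)"
      using that assms unfolding gderiv_def by (rule has_derivative_unique)
    then have "\<forall>h. h \<bullet> D' = h \<bullet> D" by metis
    then show ?thesis by (simp add: vector_eq_ldot)
  qed
  with assms show ?thesis unfolding grad_def by blast
qed

definition laplacian :: "(real^'n \<Rightarrow> real) \<Rightarrow> real^'n \<Rightarrow> real" where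
  "laplacian f x = (\<Sum>i\<in>UNIV. grad (\<lambda>y. grad f y $ i) x $ i)"

text \<open>The next two definitions are meant for open \<open>S\<close> only; differentiability is required at every
  point of \<open>S\<close> because \<^const>\<open>grad\<close> is a junk value where the derivative does not exist.\<close>

definition C2_on :: "(real^'n) set \<Rightarrow> (real^'n \<Rightarrow> real) \<Rightarrow> bool" where
  "C2_on S f \<longleftrightarrow>
     (\<forall>x\<in>S. f differentiable (at x)) \<and>
     (\<forall>i. \<forall>x\<in>S. (\<lambda>y. grad f y $ i) differentiable (at x)) \<and>
     (\<forall>i. continuous_on S (grad (\<lambda>y. grad f y $ i)))"

definition harmonic_on :: "(real^'n) set \<Rightarrow> (real^'n \<Rightarrow> real) \<Rightarrow> bool" where
  "harmonic_on S f \<longleftrightarrow> C2_on S f \<and> (\<forall>x\<in>S. laplacian f x = 0)"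

text \<open>\<open>C\<^sup>1\<close> up to the boundary of the open set \<open>S\<close>: at boundary points the derivative is taken within
  the closure of \<open>S\<close>, so values of \<open>f\<close> outside the closure play no role.\<close>

definition C1_up_to_boundary :: "(real^'n) set \<Rightarrow> (real^'n \<Rightarrow> real) \<Rightarrow> bool" where
  "C1_up_to_boundary S f \<longleftrightarrow>
     (\<exists>G. continuous_on (closure S) G \<and>
          (\<forall>x\<in>closure S. (f has_derivative (\<lambda>h. h \<bullet> G x)) (at x within closure S)))"

definition center1 :: "real \<Rightarrow> real^3" where
  "center1 \<epsilon> = vector [- 1 - \<epsilon> / 2, 0, 0]"

definition center2 :: "real \<Rightarrow> real^3" where
  "center2 \<epsilon> = vector [1 + \<epsilon> / 2, 0, 0]"

definition exterior_domain :: "real \<Rightarrow> (real^3) set" where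
  "exterior_domain \<epsilon> = - closure (ball (center1 \<epsilon>) 1 \<union> ball (center2 \<epsilon>) 1)"

text \<open>The unit normal at a point \<open>p\<close> of the unit sphere around \<open>c\<close>, pointing into the exterior
  domain, is \<open>p - c\<close>; the normal derivative is the one-sided derivative in that direction.\<close>

definition zero_normal_derivative :: "(real^3 \<Rightarrow> real) \<Rightarrow> real^3 \<Rightarrow> bool" where
  "zero_normal_derivative u c \<longleftrightarrow>
     (\<forall>p\<in>frontier (ball c 1).
        ((\<lambda>t. u (p + t *\<^sub>R (p - c))) has_real_derivative 0) (at 0 within {0..}))"

text \<open>The values of \<open>u\<close> inside the two open balls are irrelevant.\<close>

definition insulated_solution :: "real \<Rightarrow> (real^3 \<Rightarrow> real) \<Rightarrow> (real^3 \<Rightarrow> real) \<Rightarrow> bool" where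
  "insulated_solution \<epsilon> H u \<longleftrightarrow>
     harmonic_on (exterior_domain \<epsilon>) u \<and>
     C1_up_to_boundary (exterior_domain \<epsilon>) u \<and>
     zero_normal_derivative u (center1 \<epsilon>) \<and>
     zero_normal_derivative u (center2 \<epsilon>) \<and>
     (\<lambda>x. u x - H x) \<in> O[at_infinity](\<lambda>x. 1 / norm x ^ 2)"

end

theory Submission
  imports Defs
begin

text \<open>All estimates are comparison arguments with explicit barriers. The exponent comes from the
  transversal derivatives: after antisymmetrising in $y$, the solution is dominated in the neck by
  $y\,(f(s) + x^2 g(s))$ with $s = y^2 + z^2$, where $f$ is a supersolution of the equation
  $\mathrm{div}((\epsilon + r^2)\nabla(y f)) = 0$ obtained by averaging over the thin direction, and
  $f \sim (\epsilon + s)^{-\gamma}$ with $2\gamma^2 - 4\gamma + 1 = 0$. The axial derivative stays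
  bounded: on the axis it depends only on the rotational mean of $u$, whose Stokes stream function
  vanishes on the axis and on both spheres (the spheres meet the axis) and is therefore bounded by
  $C r^2$. The uniform bound on $u$ that starts both arguments follows from the maximum principle and
  the decay of $u - H$.\<close>

text \<open>Barriers reach the transversal derivatives because the plane \<open>y = 0\<close>
  contains the axis and meets both spheres at right angles: the odd part in \<open>y\<close> keeps
  the Neumann condition and vanishes on the plane, so a bound by a multiple of \<open>y\<close> is a
  derivative bound. The data for the neck barrier live on its rim, which touches the spheres, so
  interior gradient estimates do not reach it. Hence the detour through \<open>y / r\<close>, whose
  own outer data lie at radius 6, where interior estimates do apply. For the axial derivative this
  fails: the gap has width about \<epsilon> in that direction, and a bound on \<open>u\<close> alone
  costs a factor 1/\<epsilon>. The stream function exchanges the Neumann condition for a zero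
  boundary value, and \<open>r^2\<close> is a comparison function that does not see the width of the
  gap. Near the axis the stream function is \<open>r^2 / 2\<close> times the angular integral of the
  axial derivative, so a bound by \<open>r^2\<close> is exactly what is needed.\<close>

subsection \<open>Comparison principle\<close>

text \<open>Second derivatives are required along the coordinate lines only, which is all that the maximum
  principle uses and makes barriers easy to differentiate.\<close>

definition has_lap :: "(real^3 \<Rightarrow> real) \<Rightarrow> real^3 \<Rightarrow> real \<Rightarrow> bool" where
  "has_lap f p L \<longleftrightarrow> (\<exists>f1 f2.
     (\<forall>i. \<forall>\<^sub>F t in nhds 0. ((\<lambda>t. f (p + t *\<^sub>R axis i 1)) has_real_derivative f1 i t) (at t)) \<and>
     (\<forall>i. (f1 i has_real_derivative f2 i) (at 0)) \<and> L = (\<Sum>i\<in>UNIV. f2 i))"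

lemma has_lapE:
  assumes "has_lap f p L"
  obtains f1 f2 where
    "\<And>i. \<forall>\<^sub>F t in nhds 0. ((\<lambda>t. f (p + t *\<^sub>R axis i 1)) has_real_derivative f1 i t) (at t)"
    "\<And>i. (f1 i has_real_derivative f2 i) (at 0)" "L = (\<Sum>i\<in>UNIV. f2 i)"
proof -
  from assms[unfolded has_lap_def] show thesis
    apply (elim exE conjE)
    subgoal for f1 f2 by (rule that[of f1 f2]) auto
    done
qed

lemma has_lap_lincomb:
  assumes "has_lap f p L" "has_lap g p M"
  shows "has_lap (\<lambda>x. a * f x + b * g x) p (a * L + b * M)"
proof -
  obtain f1 f2 where f: "\<And>i. \<forall>\<^sub>F t in nhds 0. ((\<lambda>t. f (p + t *\<^sub>R axis i 1)) has_real_derivative f1 i t) (at t)"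
     "\<And>i. (f1 i has_real_derivative f2 i) (at 0)" "L = (\<Sum>i\<in>UNIV. f2 i)"
    using assms(1) by (rule has_lapE) (rule that; assumption)
  obtain g1 g2 where g: "\<And>i. \<forall>\<^sub>F t in nhds 0. ((\<lambda>t. g (p + t *\<^sub>R axis i 1)) has_real_derivative g1 i t) (at t)"
     "\<And>i. (g1 i has_real_derivative g2 i) (at 0)" "M = (\<Sum>i\<in>UNIV. g2 i)"
    using assms(2) by (rule has_lapE) (rule that; assumption)
  have "\<forall>\<^sub>F t in nhds 0. ((\<lambda>t. a * f (p + t *\<^sub>R axis i 1) + b * g (p + t *\<^sub>R axis i 1))
      has_real_derivative a * f1 i t + b * g1 i t) (at t)" for i
    using eventually_conj[OF f(1)[of i] g(1)[of i]]
    by (rule eventually_mono) (auto intro!: derivative_eq_intros)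
  moreover have "((\<lambda>t. a * f1 i t + b * g1 i t) has_real_derivative a * f2 i + b * g2 i) (at 0)" for i
    using f(2)[of i] g(2)[of i] by (auto intro!: derivative_eq_intros)
  moreover have "a * L + b * M = (\<Sum>i\<in>UNIV. a * f2 i + b * g2 i)"
    by (simp add: f(3) g(3) sum.distrib sum_distrib_left)
  ultimately show ?thesis
    unfolding has_lap_def
    by (intro exI[of _ "\<lambda>i t. a * f1 i t + b * g1 i t"] exI[of _ "\<lambda>i. a * f2 i + b * g2 i"] conjI allI)
qed

lemma has_lap_coordinates:
  assumes "\<forall>\<^sub>F t in nhds 0. ((\<lambda>t. f (p + t *\<^sub>R axis 1 1)) has_real_derivative a t) (at t)"
    and "\<forall>\<^sub>F t in nhds 0. ((\<lambda>t. f (p + t *\<^sub>R axis 2 1)) has_real_derivative b t) (at t)"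
    and "\<forall>\<^sub>F t in nhds 0. ((\<lambda>t. f (p + t *\<^sub>R axis 3 1)) has_real_derivative c t) (at t)"
    and "(a has_real_derivative a') (at 0)" "(b has_real_derivative b') (at 0)"
      "(c has_real_derivative c') (at 0)"
    and "L = a' + b' + c'"
  shows "has_lap f p L"
proof -
  let ?f1 = "\<lambda>i::3. if i = 1 then a else if i = 2 then b else c"
  let ?f2 = "\<lambda>i::3. if i = 1 then a' else if i = 2 then b' else c'"
  have "\<forall>i. \<forall>\<^sub>F t in nhds 0. ((\<lambda>t. f (p + t *\<^sub>R axis i 1)) has_real_derivative ?f1 i t) (at t)"
    unfolding forall_3 using assms(1-3) by simp
  moreover have "\<forall>i. (?f1 i has_real_derivative ?f2 i) (at 0)"
    unfolding forall_3 using assms(4-6) by simp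
  moreover have "L = (\<Sum>i\<in>UNIV. ?f2 i)"
    by (simp add: sum_3 assms(7))
  ultimately show ?thesis unfolding has_lap_def by (intro exI[of _ ?f1] exI[of _ ?f2] conjI)
qed

text \<open>At the minimum \<open>\<phi>'\<close> vanishes, so with \<open>c < 0\<close> it would be
  negative just to the right and \<open>\<phi>\<close> would drop below its minimal value.\<close>

lemma second_derivative_test_min:
  fixes \<phi> :: "real \<Rightarrow> real"
  assumes d1: "\<forall>\<^sub>F t in nhds 0. (\<phi> has_real_derivative \<phi>' t) (at t)"
    and d2: "(\<phi>' has_real_derivative c) (at 0)"
    and min: "\<forall>\<^sub>F t in nhds 0. \<phi> 0 \<le> \<phi> t"
  shows "0 \<le> c"
proof (rule ccontr)
  assume "\<not> 0 \<le> c"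
  then have "c < 0" by simp
  obtain e where e: "0 < e" "\<And>t. \<bar>t\<bar> < e \<Longrightarrow> (\<phi> has_real_derivative \<phi>' t) (at t)"
     "\<And>t. \<bar>t\<bar> < e \<Longrightarrow> \<phi> 0 \<le> \<phi> t"
    using eventually_conj[OF d1 min] unfolding eventually_nhds_metric dist_real_def by auto
  have "\<phi>' 0 = 0"
    by (rule DERIV_local_min[OF e(2)[of 0] e(1)]) (use e in auto)
  obtain d where d: "0 < d" "\<And>h. 0 < h \<Longrightarrow> h < d \<Longrightarrow> \<phi>' h < 0"
    using DERIV_neg_dec_right[OF d2 \<open>c < 0\<close>] \<open>\<phi>' 0 = 0\<close> by auto
  define t where "t = min d e / 2"
  have t: "0 < t" "t < d" "t < e" using d(1) e(1) by (auto simp: t_def)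
  have "\<phi> t < \<phi> 0"
  proof (rule DERIV_neg_imp_decreasing_open[OF t(1)])
    fix x assume "0 < x" "x < t"
    then show "\<exists>y. (\<phi> has_real_derivative y) (at x) \<and> y < 0"
      using e(2)[of x] d(2)[of x] t by auto
  next
    show "continuous_on {0..t} \<phi>"
      by (rule DERIV_continuous_on[of _ _ \<phi>'], rule has_field_derivative_at_within, rule e(2))
         (use t in auto)
  qed
  with e(3)[of t] t show False by auto
qed

lemma has_lap_local_min:
  assumes f: "has_lap f p L" and "open S" "p \<in> S" and min: "\<And>x. x \<in> S \<Longrightarrow> f p \<le> f x"
  shows "0 \<le> L"
proof -
  obtain f1 f2 where f: "\<And>i. \<forall>\<^sub>F t in nhds 0. ((\<lambda>t. f (p + t *\<^sub>R axis i 1)) has_real_derivative f1 i t) (at t)"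
     "\<And>i. (f1 i has_real_derivative f2 i) (at 0)" "L = (\<Sum>i\<in>UNIV. f2 i)"
    using f by (rule has_lapE) (rule that; assumption)
  have "0 \<le> f2 i" for i
  proof (rule second_derivative_test_min[OF f(1)[of i] f(2)[of i]])
    have "((\<lambda>t::real. p + t *\<^sub>R axis i 1) \<longlongrightarrow> p + 0 *\<^sub>R axis i 1) (nhds 0)"
      by (intro tendsto_intros filterlim_ident)
    then have "\<forall>\<^sub>F t::real in nhds 0. p + t *\<^sub>R axis i 1 \<in> S"
      using \<open>open S\<close> \<open>p \<in> S\<close> by (auto dest: topological_tendstoD)
    then show "\<forall>\<^sub>F t in nhds 0. f (p + 0 *\<^sub>R axis i 1) \<le> f (p + t *\<^sub>R axis i 1)"
      by (rule eventually_mono) (use min in auto)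
  qed
  then show ?thesis unfolding f(3) by (simp add: sum_nonneg)
qed

text \<open>One-sided, as in \<open>zero_normal_derivative\<close>: the values of a solution inside
  the balls carry no information.\<close>

definition has_ray_deriv :: "(real^3 \<Rightarrow> real) \<Rightarrow> real^3 \<Rightarrow> real^3 \<Rightarrow> real \<Rightarrow> bool" where
  "has_ray_deriv f p d c \<longleftrightarrow> ((\<lambda>t. f (p + t *\<^sub>R d)) has_real_derivative c) (at 0 within {0..})"

lemma has_ray_deriv_lincomb:
  assumes "has_ray_deriv f p d k" "has_ray_deriv g p d m"
  shows "has_ray_deriv (\<lambda>x. a * f x + b * g x) p d (a * k + b * m)"
  using assms unfolding has_ray_deriv_def by (auto intro!: derivative_eq_intros)

text \<open>\<open>B - v\<close> attains its minimum on the compact set \<open>K\<close>. A negative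
  Laplacian at an interior minimum, or a negative derivative along a ray that enters
  \<open>K\<close>, is impossible, so \<open>v \<le> B\<close> at the minimum point. Since the
  barrier is strict, the Hopf boundary lemma is avoided.\<close>

lemma comparison_principle:
  fixes v B :: "real^3 \<Rightarrow> real"
  assumes K: "compact K" and cv: "continuous_on K v" and cB: "continuous_on K B"
    and cases: "\<And>p. p \<in> K \<Longrightarrow> v p \<le> B p \<or>
      (p \<in> interior K \<and> has_lap v p 0 \<and> (\<exists>L<0. has_lap B p L)) \<or>
      (\<exists>d b. b < 0 \<and> (\<forall>\<^sub>F t in at_right 0. p + t *\<^sub>R d \<in> K) \<and>
         has_ray_deriv v p d 0 \<and> has_ray_deriv B p d b)"
    and "x \<in> K"
  shows "v x \<le> B x"
proof -
  have c: "continuous_on K (\<lambda>x. B x - v x)" using cv cB by (intro continuous_intros)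
  obtain p where p: "p \<in> K" "\<And>y. y \<in> K \<Longrightarrow> B p - v p \<le> B y - v y"
    using continuous_attains_inf[OF K _ c] \<open>x \<in> K\<close> by blast
  have "v p \<le> B p"
    using cases[OF p(1)]
  proof (elim disjE exE conjE)
    fix L assume L: "p \<in> interior K" "has_lap v p 0" "L < 0" "has_lap B p L"
    have "has_lap (\<lambda>x. 1 * B x + (-1) * v x) p (1 * L + (-1) * 0)"
      by (rule has_lap_lincomb[OF L(4) L(2)])
    then have "0 \<le> 1 * L + (-1) * 0"
      by (rule has_lap_local_min[OF _ open_interior[of K] L(1)]) (use p(2) interior_subset in auto)
    with L show ?thesis by simp
  next
    fix d b assume A: "b < 0" "\<forall>\<^sub>F t in at_right 0. p + t *\<^sub>R d \<in> K"
      "has_ray_deriv v p d 0" "has_ray_deriv B p d b"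
    define \<phi> where "\<phi> t = B (p + t *\<^sub>R d) - v (p + t *\<^sub>R d)" for t
    have "has_ray_deriv (\<lambda>x. 1 * B x + (-1) * v x) p d (1 * b + (-1) * 0)"
      by (rule has_ray_deriv_lincomb[OF A(4) A(3)])
    then have "(\<phi> has_real_derivative b) (at 0 within {0..})"
      by (simp add: has_ray_deriv_def \<phi>_def[abs_def])
    then have "((\<lambda>t. (\<phi> t - \<phi> 0) / (t - 0)) \<longlongrightarrow> b) (at_right 0)"
      unfolding has_field_derivative_iff by (rule filterlim_mono) (auto intro: at_le)
    moreover have "\<forall>\<^sub>F t in at_right 0. 0 \<le> (\<phi> t - \<phi> 0) / (t - 0)"
      using eventually_conj[OF A(2) eventually_at_right_less[of 0]]
      by (rule eventually_mono) (use p(2) in \<open>auto simp: \<phi>_def intro!: divide_nonneg_pos\<close>)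
    ultimately have "0 \<le> b"
      by (intro tendsto_lowerbound[of _ b "at_right 0" 0]) auto
    with A show ?thesis by simp
  qed
  with p(2)[OF \<open>x \<in> K\<close>] show ?thesis by linarith
qed

lemma has_derivative_line:
  fixes f :: "real^'n \<Rightarrow> real"
  assumes "(f has_derivative (\<lambda>h. h \<bullet> D)) (at (p + t *\<^sub>R d))"
  shows "((\<lambda>t. f (p + t *\<^sub>R d)) has_real_derivative d \<bullet> D) (at t)"
proof -
  have "((\<lambda>t. p + t *\<^sub>R d) has_derivative (\<lambda>h. h *\<^sub>R d)) (at t)"
    by (auto intro!: derivative_eq_intros)
  from has_derivative_compose[OF this assms]
  show ?thesis by (simp add: has_field_derivative_def mult_commute_abs)
qed

text \<open>\<open>grad\<close> is a definite description, so a vector representing the derivative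
  has to be exhibited: its entries are the values of the derivative on the coordinate axes.\<close>

lemma grad_has_derivative:
  fixes f :: "real^'n \<Rightarrow> real"
  assumes "f differentiable (at x)"
  shows "(f has_derivative (\<lambda>h. h \<bullet> grad f x)) (at x)"
proof -
  obtain f' where f': "(f has_derivative f') (at x)" using assms by (auto simp: differentiable_def)
  then have lin: "linear f'" by (rule has_derivative_linear)
  let ?D = "\<chi> i. f' (axis i 1)"
  have "f' h = h \<bullet> ?D" for h
  proof -
    have "f' h = f' (\<Sum>i\<in>UNIV. h $ i *\<^sub>R axis i 1)"
      by (simp add: basis_expansion[of h, unfolded scalar_mult_eq_scaleR])
    also have "\<dots> = h \<bullet> ?D"
      using lin by (simp add: linear_sum linear_scale inner_vec_def)
    finally show ?thesis .
  qed
  then have "f' = (\<lambda>h. h \<bullet> ?D)" by (rule ext)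
  with f' have "GDERIV f x :> ?D" by (simp add: gderiv_def)
  with GDERIV_grad[OF this] show ?thesis by (simp add: gderiv_def)
qed

lemma harmonic_on_has_lap:
  fixes f :: "real^3 \<Rightarrow> real"
  assumes f: "harmonic_on S f" and "open S" "p \<in> S"
  shows "has_lap f p 0"
proof -
  have d1: "\<And>x. x \<in> S \<Longrightarrow> (f has_derivative (\<lambda>h. h \<bullet> grad f x)) (at x)"
    and d2: "\<And>i x. x \<in> S \<Longrightarrow> ((\<lambda>y. grad f y $ i) has_derivative (\<lambda>h. h \<bullet> grad (\<lambda>y. grad f y $ i) x)) (at x)"
    using f by (auto simp: harmonic_on_def C2_on_def intro!: grad_has_derivative)
  have "\<forall>\<^sub>F t in nhds 0. ((\<lambda>t. f (p + t *\<^sub>R axis i 1)) has_real_derivative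
      grad f (p + t *\<^sub>R axis i 1) $ i) (at t)" for i
  proof -
    have "((\<lambda>t::real. p + t *\<^sub>R axis i 1) \<longlongrightarrow> p + 0 *\<^sub>R axis i 1) (nhds 0)"
      by (intro tendsto_intros filterlim_ident)
    then have "\<forall>\<^sub>F t::real in nhds 0. p + t *\<^sub>R axis i 1 \<in> S"
      using \<open>open S\<close> \<open>p \<in> S\<close> by (auto dest: topological_tendstoD)
    then show ?thesis
    proof (rule eventually_mono)
      fix t :: real assume "p + t *\<^sub>R axis i 1 \<in> S"
      from has_derivative_line[OF d1[OF this]]
      show "((\<lambda>t. f (p + t *\<^sub>R axis i 1)) has_real_derivative grad f (p + t *\<^sub>R axis i 1) $ i) (at t)"
        by (simp add: inner_axis')
    qed
  qed
  moreover have "((\<lambda>t. grad f (p + t *\<^sub>R axis i 1) $ i) has_real_derivative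
      grad (\<lambda>y. grad f y $ i) p $ i) (at 0)" for i
    using has_derivative_line[of "\<lambda>y. grad f y $ i" _ p 0 "axis i 1"] d2[OF \<open>p \<in> S\<close>, of i]
    by (simp add: inner_axis')
  moreover have "0 = (\<Sum>i\<in>UNIV. grad (\<lambda>y. grad f y $ i) p $ i)"
    using f \<open>p \<in> S\<close> by (simp add: harmonic_on_def laplacian_def)
  ultimately show ?thesis unfolding has_lap_def
    by (intro exI[of _ "\<lambda>i t. grad f (p + t *\<^sub>R axis i 1) $ i"]
      exI[of _ "\<lambda>i. grad (\<lambda>y. grad f y $ i) p $ i"] conjI allI)
qed

subsection \<open>The Neumann problem outside two balls\<close>

lemma axis_component_3 [simp]:
  "axis (1::3) (1::real) $ 1 = 1" "axis (1::3) (1::real) $ 2 = 0" "axis (1::3) (1::real) $ 3 = 0"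
  "axis (2::3) (1::real) $ 1 = 0" "axis (2::3) (1::real) $ 2 = 1" "axis (2::3) (1::real) $ 3 = 0"
  "axis (3::3) (1::real) $ 1 = 0" "axis (3::3) (1::real) $ 2 = 0" "axis (3::3) (1::real) $ 3 = 1"
  by (auto simp: axis_def)

lemma norm3_sq: "(norm (p::real^3))^2 = (p$1)^2 + (p$2)^2 + (p$3)^2"
  by (simp add: norm_vec_def L2_set_def sum_3 add_nonneg_nonneg)

lemma center_component [simp]:
  "center1 \<epsilon> $ 1 = - 1 - \<epsilon>/2" "center1 \<epsilon> $ 2 = 0" "center1 \<epsilon> $ 3 = 0"
  "center2 \<epsilon> $ 1 = 1 + \<epsilon>/2" "center2 \<epsilon> $ 2 = 0" "center2 \<epsilon> $ 3 = 0"
  by (simp_all add: center1_def center2_def vector_3)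

lemma center_diff: "norm (center1 \<epsilon> - center2 \<epsilon>) = \<bar>2 + \<epsilon>\<bar>"
proof -
  have "(norm (center1 \<epsilon> - center2 \<epsilon>))^2 = (2 + \<epsilon>)^2"
    unfolding norm3_sq by (simp add: power2_eq_square algebra_simps)
  then show ?thesis by (metis abs_norm_cancel power2_eq_iff abs_minus_cancel)
qed

lemma norm_center: "0 < \<epsilon> \<Longrightarrow> norm (center1 \<epsilon>) = 1 + \<epsilon>/2" "0 < \<epsilon> \<Longrightarrow> norm (center2 \<epsilon>) = 1 + \<epsilon>/2"
proof -
  have "(norm (center1 \<epsilon>))^2 = (1 + \<epsilon>/2)^2" "(norm (center2 \<epsilon>))^2 = (1 + \<epsilon>/2)^2"
    unfolding norm3_sq by (simp_all add: power2_eq_square algebra_simps)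
  then show "0 < \<epsilon> \<Longrightarrow> norm (center1 \<epsilon>) = 1 + \<epsilon>/2" "0 < \<epsilon> \<Longrightarrow> norm (center2 \<epsilon>) = 1 + \<epsilon>/2"
    by (simp_all add: power2_eq_iff_nonneg)
qed

abbreviation "\<Omega> \<equiv> exterior_domain"

lemma exterior_domain_iff: "p \<in> \<Omega> \<epsilon> \<longleftrightarrow> 1 < dist (center1 \<epsilon>) p \<and> 1 < dist (center2 \<epsilon>) p"
  by (auto simp: exterior_domain_def closure_Un)

lemma open_exterior_domain [simp]: "open (\<Omega> \<epsilon>)"
  unfolding exterior_domain_def by (intro open_Compl closed_closure)

lemma normal_ray_exterior:
  assumes c: "(c = center1 \<epsilon> \<and> c' = center2 \<epsilon>) \<or> (c = center2 \<epsilon> \<and> c' = center1 \<epsilon>)"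
    and p: "dist c p = 1" "1 \<le> dist c' p" and "0 < \<epsilon>"
  shows "\<forall>\<^sub>F t in at_right 0. p + t *\<^sub>R (p - c) \<in> \<Omega> \<epsilon>"
proof -
  have "dist c c' = 2 + \<epsilon>" using c \<open>0 < \<epsilon>\<close> center_diff[of \<epsilon>] by (auto simp: dist_norm norm_minus_commute)
  \<comment> \<open>The centres are \<open>2 + \<epsilon>\<close> apart, so \<open>p\<close> keeps
    distance at least \<open>1 + \<epsilon>\<close> from the other centre; short rays cannot reach
    the other ball.\<close>
  with p dist_triangle[of c c' p] have "1 < dist c' p" using \<open>0 < \<epsilon>\<close> by (simp add: dist_commute)
  have "((\<lambda>t. dist c' (p + t *\<^sub>R (p - c))) \<longlongrightarrow> dist c' (p + 0 *\<^sub>R (p - c))) (at_right 0)"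
    by (intro tendsto_intros)
  with \<open>1 < dist c' p\<close> have "\<forall>\<^sub>F t in at_right 0. 1 < dist c' (p + t *\<^sub>R (p - c))"
    by (auto dest: order_tendstoD(1))
  moreover have "\<forall>\<^sub>F t::real in at_right 0. 0 < t" by (rule eventually_at_right_less)
  ultimately show ?thesis
  proof eventually_elim
    case (elim t)
    have "p + t *\<^sub>R (p - c) - c = (1 + t) *\<^sub>R (p - c)" by (simp add: algebra_simps)
    then have "dist (p + t *\<^sub>R (p - c)) c = 1 + t"
      using p(1) elim by (simp add: dist_norm norm_minus_commute)
    with elim c show ?case by (auto simp: exterior_domain_iff dist_commute)
  qed
qed

text \<open>A point of one of the spheres is the limit of its outward normal ray, which starts out
  inside the exterior domain.\<close>

lemma closure_exterior_domain_iff: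
  assumes "0 < \<epsilon>"
  shows "p \<in> closure (\<Omega> \<epsilon>) \<longleftrightarrow> 1 \<le> dist (center1 \<epsilon>) p \<and> 1 \<le> dist (center2 \<epsilon>) p"
proof
  have "closed {p. 1 \<le> dist (center1 \<epsilon>) p \<and> 1 \<le> dist (center2 \<epsilon>) p}"
    by (intro closed_Collect_conj closed_Collect_le continuous_intros)
  then have "closure (\<Omega> \<epsilon>) \<subseteq> {p. 1 \<le> dist (center1 \<epsilon>) p \<and> 1 \<le> dist (center2 \<epsilon>) p}"
    by (intro closure_minimal) (auto simp: exterior_domain_iff)
  then show "p \<in> closure (\<Omega> \<epsilon>) \<Longrightarrow> 1 \<le> dist (center1 \<epsilon>) p \<and> 1 \<le> dist (center2 \<epsilon>) p"
    by auto
next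
  assume p: "1 \<le> dist (center1 \<epsilon>) p \<and> 1 \<le> dist (center2 \<epsilon>) p"
  have *: "p \<in> closure (\<Omega> \<epsilon>)"
    if "\<forall>\<^sub>F t in at_right 0. p + t *\<^sub>R (p - c) \<in> \<Omega> \<epsilon>" for c
  proof (rule Lim_in_closed_set[OF closed_closure, of "\<lambda>t. p + t *\<^sub>R (p - c)" _ "at_right (0::real)"])
    show "\<forall>\<^sub>F t in at_right 0. p + t *\<^sub>R (p - c) \<in> closure (\<Omega> \<epsilon>)"
      using that by (rule eventually_mono) (use closure_subset in auto)
    show "((\<lambda>t. p + t *\<^sub>R (p - c)) \<longlongrightarrow> p) (at_right 0)" by (auto intro!: tendsto_eq_intros)
  qed auto
  consider "dist (center1 \<epsilon>) p = 1" | "dist (center2 \<epsilon>) p = 1" | "p \<in> \<Omega> \<epsilon>"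
    using p by (force simp: exterior_domain_iff)
  then show "p \<in> closure (\<Omega> \<epsilon>)"
  proof cases
    case 1
    then show ?thesis using p assms by (intro *[of "center1 \<epsilon>"] normal_ray_exterior[where c'="center2 \<epsilon>"]) auto
  next
    case 2
    then show ?thesis using p assms by (intro *[of "center2 \<epsilon>"] normal_ray_exterior[where c'="center1 \<epsilon>"]) auto
  qed (use closure_subset in auto)
qed

text \<open>What comparison needs of a solution and no more. Unlike the full notion, it passes to
  linear combinations and reflected copies without differentiating a composed gradient.\<close>

definition neumann_harmonic :: "real \<Rightarrow> (real^3 \<Rightarrow> real) \<Rightarrow> bool" where
  "neumann_harmonic \<epsilon> u \<longleftrightarrow> continuous_on (closure (\<Omega> \<epsilon>)) u \<and>
     (\<forall>p\<in>\<Omega> \<epsilon>. has_lap u p 0) \<and>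
     (\<forall>c\<in>{center1 \<epsilon>, center2 \<epsilon>}. \<forall>p. dist c p = 1 \<longrightarrow> has_ray_deriv u p (p - c) 0)"

lemma insulated_solution_neumann_harmonic:
  assumes "insulated_solution \<epsilon> H u"
  shows "neumann_harmonic \<epsilon> u"
proof -
  obtain G where "\<And>x. x \<in> closure (\<Omega> \<epsilon>) \<Longrightarrow>
      (u has_derivative (\<lambda>h. h \<bullet> G x)) (at x within closure (\<Omega> \<epsilon>))"
    using assms by (auto simp: insulated_solution_def C1_up_to_boundary_def)
  then have "continuous_on (closure (\<Omega> \<epsilon>)) u"
    by (meson continuous_on_eq_continuous_within has_derivative_continuous)
  moreover have "\<forall>p\<in>\<Omega> \<epsilon>. has_lap u p 0"
    using assms by (auto simp: insulated_solution_def intro: harmonic_on_has_lap)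
  ultimately show ?thesis using assms
    by (auto simp: neumann_harmonic_def insulated_solution_def zero_normal_derivative_def has_ray_deriv_def)
qed

section \<open>Linear combinations and symmetries\<close>

lemma neumann_harmonic_lincomb:
  assumes "neumann_harmonic \<epsilon> u" "neumann_harmonic \<epsilon> v"
  shows "neumann_harmonic \<epsilon> (\<lambda>x. a * u x + b * v x)"
  using assms has_lap_lincomb[of u _ 0 v 0 a b] has_ray_deriv_lincomb[of u _ _ 0 v 0 a b]
  by (auto simp: neumann_harmonic_def intro!: continuous_intros)

text \<open>\<open>has_lap\<close> looks along coordinate lines only, so invariance is proved for
  maps that send coordinate lines to coordinate lines. Each second derivative picks up the factor
  \<open>s i * s i = 1\<close>, and the sum over the axes is merely permuted.\<close>

lemma has_lap_signed_permutation:
  assumes f: "has_lap f (T p) L" and "bij \<pi>" and s: "\<And>i. s i * s i = (1::real)"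
    and T: "\<And>i t. T (p + t *\<^sub>R axis i 1) = T p + (s i * t) *\<^sub>R axis (\<pi> i) 1"
  shows "has_lap (\<lambda>x. f (T x)) p L"
proof -
  obtain f1 f2 where f: "\<And>i. \<forall>\<^sub>F t in nhds 0. ((\<lambda>t. f (T p + t *\<^sub>R axis i 1)) has_real_derivative f1 i t) (at t)"
     "\<And>i. (f1 i has_real_derivative f2 i) (at 0)" "L = (\<Sum>i\<in>UNIV. f2 i)"
    using f by (rule has_lapE) (rule that; assumption)
  have "\<forall>\<^sub>F t in nhds 0. ((\<lambda>t. f (T (p + t *\<^sub>R axis i 1))) has_real_derivative
      s i * f1 (\<pi> i) (s i * t)) (at t)" for i
  proof -
    have "filterlim (\<lambda>t. s i * t) (nhds (s i * 0)) (nhds 0)"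
      by (intro tendsto_intros filterlim_ident)
    then have "\<forall>\<^sub>F t in nhds 0. ((\<lambda>t. f (T p + t *\<^sub>R axis (\<pi> i) 1)) has_real_derivative
        f1 (\<pi> i) (s i * t)) (at (s i * t))"
      using eventually_compose_filterlim[OF f(1)[of "\<pi> i"]] by simp
    then show ?thesis
    proof (rule eventually_mono)
      fix t assume *: "((\<lambda>t. f (T p + t *\<^sub>R axis (\<pi> i) 1)) has_real_derivative
        f1 (\<pi> i) (s i * t)) (at (s i * t))"
      have "((\<lambda>t. s i * t) has_real_derivative s i) (at t)" by (auto intro!: derivative_eq_intros)
      from DERIV_chain2[OF * this]
      show "((\<lambda>t. f (T (p + t *\<^sub>R axis i 1))) has_real_derivative s i * f1 (\<pi> i) (s i * t)) (at t)"
        by (simp add: T mult.commute)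
    qed
  qed
  moreover have "((\<lambda>t. s i * f1 (\<pi> i) (s i * t)) has_real_derivative f2 (\<pi> i)) (at 0)" for i
  proof -
    have "((\<lambda>t. s i * t) has_real_derivative s i) (at 0)" by (auto intro!: derivative_eq_intros)
    from DERIV_chain2[OF _ this, of "f1 (\<pi> i)" "f2 (\<pi> i)"] f(2)[of "\<pi> i"]
    have "((\<lambda>t. f1 (\<pi> i) (s i * t)) has_real_derivative f2 (\<pi> i) * s i) (at 0)" by simp
    from DERIV_cmult[OF this, of "s i"] show ?thesis
      by (simp add: mult.left_commute[of "s i"] s)
  qed
  moreover have "L = (\<Sum>i\<in>UNIV. f2 (\<pi> i))"
    unfolding f(3) using \<open>bij \<pi>\<close> by (simp add: sum.reindex_bij_betw)
  ultimately show ?thesis unfolding has_lap_def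
    by (intro exI[of _ "\<lambda>i t. s i * f1 (\<pi> i) (s i * t)"] exI[of _ "\<lambda>i. f2 (\<pi> i)"] conjI allI)
qed

definition reflect :: "3 \<Rightarrow> real \<Rightarrow> real^3 \<Rightarrow> real^3" where
  "reflect i q p = (\<chi> j. if j = i then 2 * q - p $ j else p $ j)"

definition swap23 :: "real^3 \<Rightarrow> real^3" where
  "swap23 p = vector [p $ 1, p $ 3, p $ 2]"

lemma swap23_component [simp]: "swap23 p $ 1 = p $ 1" "swap23 p $ 2 = p $ 3" "swap23 p $ 3 = p $ 2"
  by (auto simp: swap23_def)

lemma has_lap_reflect:
  assumes "has_lap f (reflect i q p) L"
  shows "has_lap (\<lambda>x. f (reflect i q x)) p L"
  by (rule has_lap_signed_permutation[of f "reflect i q" p L id "\<lambda>j. if j = i then -1 else 1"])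
     (use assms in \<open>auto simp: reflect_def vec_eq_iff axis_def\<close>)

lemma has_lap_swap23:
  assumes "has_lap f (swap23 p) L"
  shows "has_lap (\<lambda>x. f (swap23 x)) p L"
proof (rule has_lap_signed_permutation[of f swap23 p L "\<lambda>j. if j = 2 then 3 else if j = 3 then 2 else 1" "\<lambda>_. 1"])
  show "bij (\<lambda>j::3. if j = 2 then 3 else if j = 3 then 2 else (1::3))"
    by (rule o_bij[of "\<lambda>j::3. if j = 2 then 3 else if j = 3 then 2 else (1::3)"])
       (auto simp: fun_eq_iff forall_3)
  show "swap23 (p + t *\<^sub>R axis i 1) =
      swap23 p + (1 * t) *\<^sub>R axis (if i = 2 then 3 else if i = 3 then 2 else 1) 1" for i t
    using exhaust_3[of i] by (auto simp: vec_eq_iff forall_3)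
qed (use assms in auto)

lemma neumann_harmonic_compose:
  assumes u: "neumann_harmonic \<epsilon> u" and "linear T" "\<And>x. norm (T x) = norm x"
    and c: "T (center1 \<epsilon>) = center1 \<epsilon>" "T (center2 \<epsilon>) = center2 \<epsilon>"
    and lap: "\<And>f p L. has_lap f (T p) L \<Longrightarrow> has_lap (\<lambda>x. f (T x)) p L" and "0 < \<epsilon>"
  shows "neumann_harmonic \<epsilon> (\<lambda>x. u (T x))"
proof -
  have d: "dist c (T p) = dist c p" if "c \<in> {center1 \<epsilon>, center2 \<epsilon>}" for c p
    using assms(3)[of "c - p"] that c linear_diff[OF \<open>linear T\<close>, of c p] by (auto simp: dist_norm)
  have "continuous_on (closure (\<Omega> \<epsilon>)) (\<lambda>x. u (T x))"
    by (rule continuous_on_compose2[of "closure (\<Omega> \<epsilon>)" u])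
       (use u \<open>linear T\<close> d \<open>0 < \<epsilon>\<close> in \<open>auto simp: neumann_harmonic_def linear_continuous_on linear_linear closure_exterior_domain_iff\<close>)
  moreover have "has_lap (\<lambda>x. u (T x)) p 0" if "p \<in> \<Omega> \<epsilon>" for p
    using that u d by (auto intro!: lap simp: neumann_harmonic_def exterior_domain_iff)
  moreover have "has_ray_deriv (\<lambda>x. u (T x)) p (p - c) 0"
    if "c \<in> {center1 \<epsilon>, center2 \<epsilon>}" "dist c p = 1" for c p
  proof -
    have "T (p + t *\<^sub>R (p - c)) = T p + t *\<^sub>R (T p - c)" for t
      using that(1) c \<open>linear T\<close> by (auto simp: linear_add linear_scale linear_diff)
    moreover have "has_ray_deriv u (T p) (T p - c) 0"
      using u that d[OF that(1)] unfolding neumann_harmonic_def by metis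
    ultimately show ?thesis by (simp add: has_ray_deriv_def)
  qed
  ultimately show ?thesis by (auto simp: neumann_harmonic_def)
qed

lemma norm_reflect: "norm (reflect i 0 x) = norm x"
proof -
  have "(norm (reflect i 0 x))^2 = (norm x)^2" by (auto simp: norm3_sq reflect_def)
  then show ?thesis by simp
qed

lemma norm_swap23: "norm (swap23 x) = norm x"
proof -
  have "(norm (swap23 x))^2 = (norm x)^2" by (simp add: norm3_sq)
  then show ?thesis by simp
qed

lemma neumann_harmonic_reflect2:
  assumes "neumann_harmonic \<epsilon> u" "0 < \<epsilon>"
  shows "neumann_harmonic \<epsilon> (\<lambda>x. u (reflect 2 0 x))"
  by (rule neumann_harmonic_compose[OF assms(1) _ norm_reflect _ _ has_lap_reflect assms(2)])
     (auto simp: linear_iff vec_eq_iff reflect_def forall_3)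

lemma neumann_harmonic_swap23:
  assumes "neumann_harmonic \<epsilon> u" "0 < \<epsilon>"
  shows "neumann_harmonic \<epsilon> (\<lambda>x. u (swap23 x))"
  by (rule neumann_harmonic_compose[OF assms(1) _ norm_swap23 _ _ has_lap_swap23 assms(2)])
     (auto simp: linear_iff vec_eq_iff forall_3)

text \<open>Written in the squared distance \<open>N\<close>, a radial function in three dimensions
  has Laplacian \<open>6 * \<phi>' + 4 * N * \<phi>''\<close>. Along coordinate lines
  \<open>N\<close> is a quadratic polynomial, so no square root is differentiated.\<close>

lemma has_lap_radial:
  assumes \<phi>: "\<And>N. 0 < N \<Longrightarrow> (\<phi> has_real_derivative \<phi>' N) (at N)"
    and \<phi>': "(\<phi>' has_real_derivative k) (at ((norm (p - c))^2))" and "p \<noteq> c"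
    and L: "L = 6 * \<phi>' ((norm (p - c))^2) + 4 * (norm (p - c))^2 * k"
  shows "has_lap (\<lambda>x. \<phi> ((norm (x - c))^2)) p L"
proof -
  define N where "N i t = (norm (p + t *\<^sub>R axis i 1 - c))^2" for i t
  have N: "N i t = (norm (p - c))^2 + 2 * t * (p - c) $ i + t^2" for i t
  proof -
    have "N i t = (norm ((p - c) + t *\<^sub>R axis i 1))^2" by (simp add: N_def algebra_simps)
    also have "\<dots> = (norm (p - c))^2 + 2 * t * (p - c) $ i + t^2"
      unfolding power2_norm_eq_inner by (simp add: inner_add inner_axis inner_axis' power2_eq_square algebra_simps)
    finally show ?thesis .
  qed
  have N1: "(N i has_real_derivative 2 * (p - c) $ i + 2 * t) (at t)" for i t
    unfolding N[abs_def] by (auto intro!: derivative_eq_intros)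
  have N0: "N i 0 = (norm (p - c))^2" for i by (simp add: N)
  then have N0': "0 < N i 0" for i using \<open>p \<noteq> c\<close> by simp
  have ev: "\<forall>\<^sub>F t in nhds 0. 0 < N i t" for i
  proof -
    have "isCont (N i) 0" using N1 DERIV_isCont by blast
    then have "(N i \<longlongrightarrow> N i 0) (nhds 0)" by (simp add: isCont_def tendsto_at_iff_tendsto_nhds)
    then show ?thesis using N0' by (auto dest: order_tendstoD(1))
  qed
  have "\<forall>\<^sub>F t in nhds 0. ((\<lambda>t. \<phi> ((norm (p + t *\<^sub>R axis i 1 - c))^2)) has_real_derivative
      \<phi>' (N i t) * (2 * (p - c) $ i + 2 * t)) (at t)" for i
    using ev[of i]
  proof (rule eventually_mono)
    fix t assume "0 < N i t"
    from DERIV_chain2[OF \<phi>[OF this] N1]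
    show "((\<lambda>t. \<phi> ((norm (p + t *\<^sub>R axis i 1 - c))^2)) has_real_derivative
      \<phi>' (N i t) * (2 * (p - c) $ i + 2 * t)) (at t)" by (simp add: N_def)
  qed
  moreover have "((\<lambda>t. \<phi>' (N i t) * (2 * (p - c) $ i + 2 * t)) has_real_derivative
      4 * ((p - c) $ i)^2 * k + 2 * \<phi>' ((norm (p - c))^2)) (at 0)" for i
  proof -
    have "((\<lambda>t. \<phi>' (N i t)) has_real_derivative k * (2 * (p - c) $ i + 2 * 0)) (at 0)"
      by (rule DERIV_chain2[OF _ N1]) (simp add: N0 \<phi>')
    then show ?thesis
      by (auto intro!: derivative_eq_intros simp: N0 power2_eq_square) (auto simp: algebra_simps)
  qed
  moreover have "L = (\<Sum>i\<in>UNIV. 4 * ((p - c) $ i)^2 * k + 2 * \<phi>' ((norm (p - c))^2))"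
    by (simp add: L sum_3 norm3_sq algebra_simps)
  ultimately show ?thesis unfolding has_lap_def
    by (intro exI[of _ "\<lambda>i t. \<phi>' (N i t) * (2 * (p - c) $ i + 2 * t)"]
         exI[of _ "\<lambda>i. 4 * ((p - c) $ i)^2 * k + 2 * \<phi>' ((norm (p - c))^2)"] conjI allI)
qed

text \<open>A strict supersolution; the constant makes it nonnegative for \<open>norm p \<le> 12\<close>. Adding a small multiple
  of it turns non-strict barriers into strict ones.\<close>

definition log_barrier :: "real \<Rightarrow> real^3 \<Rightarrow> real" where
  "log_barrier \<epsilon> p = 2 * ln 200 - ln ((norm (p - center1 \<epsilon>))^2) - ln ((norm (p - center2 \<epsilon>))^2)"

lemma has_lap_const: "has_lap (\<lambda>_. c) p 0"
  unfolding has_lap_def by (intro exI[of _ "\<lambda>_ _. 0"] exI[of _ "\<lambda>_. 0"]) auto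

lemma has_lap_neg_ln:
  assumes "p \<noteq> c"
  shows "has_lap (\<lambda>x. - ln ((norm (x - c))^2)) p (- 2 / (norm (p - c))^2)"
  by (rule has_lap_radial[where \<phi>'="\<lambda>N. - 1 / N" and k="1 / ((norm (p - c))^2)^2"])
     (use assms in \<open>auto intro!: derivative_eq_intros simp: field_simps power2_eq_square\<close>)

lemma log_barrier_lap:
  assumes "p \<in> \<Omega> \<epsilon>"
  shows "\<exists>L<0. has_lap (log_barrier \<epsilon>) p L"
proof -
  have ne: "p \<noteq> center1 \<epsilon>" "p \<noteq> center2 \<epsilon>" using assms by (auto simp: exterior_domain_iff)
  from has_lap_lincomb[OF has_lap_const[of "2 * ln 200"] has_lap_lincomb[OF has_lap_neg_ln[OF ne(1)] has_lap_neg_ln[OF ne(2)], of 1 1], of 1 1]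
  have "has_lap (log_barrier \<epsilon>) p (- 2 / (norm (p - center1 \<epsilon>))^2 + - 2 / (norm (p - center2 \<epsilon>))^2)"
    by (simp add: log_barrier_def[abs_def] diff_diff_eq2 add_diff_eq)
  moreover have "- 2 / (norm (p - center1 \<epsilon>))^2 + - 2 / (norm (p - center2 \<epsilon>))^2 < 0"
    using ne by (intro add_neg_neg) (auto intro!: divide_neg_pos)
  ultimately show ?thesis by blast
qed

text \<open>The logarithm centred at \<open>c\<close> contributes \<open>- 2\<close>. The other one
  may grow along the normal, fastest at the point facing the other ball, but even there at a rate
  below \<open>2\<close> as long as the balls do not touch.\<close>

lemma log_barrier_ray:
  assumes c: "(c = center1 \<epsilon> \<and> c' = center2 \<epsilon>) \<or> (c = center2 \<epsilon> \<and> c' = center1 \<epsilon>)"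
    and p: "dist c p = 1" and "0 < \<epsilon>"
  shows "\<exists>b<0. has_ray_deriv (log_barrier \<epsilon>) p (p - c) b"
proof -
  define d where "d = p - c"
  define e where "e = c' - c"
  have nd: "d \<bullet> d = 1" using p by (metis d_def dist_commute dist_norm power2_norm_eq_inner power_one)
  have ne: "norm e = 2 + \<epsilon>" using c \<open>0 < \<epsilon>\<close> center_diff[of \<epsilon>] by (auto simp: e_def norm_minus_commute)
  have ee: "e \<bullet> e = (2 + \<epsilon>)^2" using ne by (metis power2_norm_eq_inner)
  have de: "d \<bullet> e \<le> 2 + \<epsilon>"
    using norm_cauchy_schwarz[of d e] ne nd by (simp add: norm_eq_sqrt_inner)
  have eq: "p - c' = d - e" by (simp add: d_def e_def)
  have n1: "(norm (p + t *\<^sub>R (p - c) - c))^2 = (1 + t)^2" for t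
  proof -
    have "p + t *\<^sub>R (p - c) - c = (1 + t) *\<^sub>R d" by (simp add: d_def algebra_simps)
    moreover have "norm d = 1" using p by (metis d_def dist_commute dist_norm)
    ultimately show ?thesis by simp
  qed
  define m where "m = (d - e) \<bullet> (d - e)"
  have m: "m = 1 - 2 * (d \<bullet> e) + (2 + \<epsilon>)^2"
    using nd ee by (simp add: m_def inner_diff inner_commute[of e d])
  have "m > 0" using de \<open>0 < \<epsilon>\<close> by (simp add: m power2_eq_square algebra_simps) (smt (verit) mult_pos_pos)
  have n2: "(norm (p + t *\<^sub>R (p - c) - c'))^2 = m + 2 * t * (1 - d \<bullet> e) + t^2" for t
  proof -
    have "p + t *\<^sub>R (p - c) - c' = (d - e) + t *\<^sub>R d" by (simp add: d_def e_def algebra_simps)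
    then have "(norm (p + t *\<^sub>R (p - c) - c'))^2 = ((d - e) + t *\<^sub>R d) \<bullet> ((d - e) + t *\<^sub>R d)"
      by (simp add: power2_norm_eq_inner)
    also have "\<dots> = m + 2 * t * (1 - d \<bullet> e) + t^2"
      using nd by (simp add: m_def inner_add inner_diff inner_commute[of e d] power2_eq_square algebra_simps)
    finally show ?thesis .
  qed
  let ?b = "- 2 - 2 * (1 - d \<bullet> e) / m"
  have "((\<lambda>t. 2 * ln 200 - ln ((1 + t)^2) - ln (m + 2 * t * (1 - d \<bullet> e) + t^2)) has_real_derivative ?b)
      (at 0 within {0..})"
    using \<open>m > 0\<close> by (auto intro!: derivative_eq_intros)
  moreover have "log_barrier \<epsilon> (p + t *\<^sub>R (p - c)) =
       2 * ln 200 - ln ((1 + t)^2) - ln (m + 2 * t * (1 - d \<bullet> e) + t^2)" for t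
    using c n1[of t] n2[of t] by (auto simp: log_barrier_def)
  ultimately have "has_ray_deriv (log_barrier \<epsilon>) p (p - c) ?b" by (simp add: has_ray_deriv_def)
  moreover have "?b < 0"
  proof -
    \<comment> \<open>With \<open>A = 2 + \<epsilon>\<close> and
      \<open>d \<bullet> e \<le> A\<close> the sum is at least \<open>(A - 1) * (A - 2)\<close>,
      which is positive because \<open>A > 2\<close>.\<close>
    have "0 < m + (1 - d \<bullet> e)"
      using de \<open>0 < \<epsilon>\<close> by (simp add: m power2_eq_square algebra_simps) (smt (verit) mult_pos_pos)
    then show ?thesis using \<open>m > 0\<close> by (simp add: field_simps)
  qed
  ultimately show ?thesis by blast
qed

lemma continuous_on_log_barrier: "0 < \<epsilon> \<Longrightarrow> continuous_on (closure (\<Omega> \<epsilon>)) (log_barrier \<epsilon>)"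
  unfolding log_barrier_def
  by (intro continuous_intros) (auto simp: closure_exterior_domain_iff dist_norm norm_minus_commute)

lemma log_barrier_nonneg:
  assumes "p \<in> closure (\<Omega> \<epsilon>)" "norm p \<le> 12" "0 < \<epsilon>" "\<epsilon> < 1"
  shows "0 \<le> log_barrier \<epsilon> p"
proof -
  have *: "ln ((norm (p - c))^2) \<le> ln 200" if "norm c = 1 + \<epsilon>/2" "1 \<le> dist c p" for c
  proof -
    \<comment> \<open>\<open>12 + 3/2 < 14\<close>, and \<open>14^2 = 196\<close> lies below the
      \<open>200\<close> in \<open>log_barrier\<close>.\<close>
    have "norm (p - c) \<le> 14" using norm_triangle_ineq4[of p c] that assms by simp
    then have "(norm (p - c))^2 \<le> 14^2" by (intro power_mono) auto
    then have "(norm (p - c))^2 \<le> 200" by simp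
    moreover have "0 < (norm (p - c))^2"
      using that by (metis dist_commute dist_norm less_le_trans zero_less_one zero_less_power)
    ultimately show ?thesis by (subst ln_le_cancel_iff) auto
  qed
  have "ln ((norm (p - center1 \<epsilon>))^2) \<le> ln 200" "ln ((norm (p - center2 \<epsilon>))^2) \<le> ln 200"
    using assms by (auto intro!: * simp: closure_exterior_domain_iff norm_center)
  then show ?thesis by (simp add: log_barrier_def)
qed

text \<open>The supersolution conditions in non-strict form, so that constants and barriers with
  exactly zero normal derivative qualify.\<close>

definition barrier_at :: "real \<Rightarrow> (real^3) set \<Rightarrow> (real^3 \<Rightarrow> real) \<Rightarrow> real^3 \<Rightarrow> bool" where
  "barrier_at \<epsilon> K B p \<longleftrightarrow>
     (p \<in> interior K \<and> p \<in> \<Omega> \<epsilon> \<and> (\<exists>L\<le>0. has_lap B p L)) \<or>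
     (\<exists>c\<in>{center1 \<epsilon>, center2 \<epsilon>}. \<exists>b\<le>0. dist c p = 1 \<and>
        (\<forall>\<^sub>F t in at_right 0. p + t *\<^sub>R (p - c) \<in> K) \<and> has_ray_deriv B p (p - c) b)"

text \<open>\<open>B\<close> plus a small positive multiple of \<open>log_barrier\<close> satisfies
  the strict conditions of \<open>comparison_principle\<close>; the multiple then tends to zero.
  Inside \<open>cball 0 12\<close> the added term is nonnegative, so it does no harm where
  \<open>u \<le> B\<close> is already known.\<close>

lemma neumann_comparison:
  assumes u: "neumann_harmonic \<epsilon> u" and eps: "0 < \<epsilon>" "\<epsilon> < 1"
    and K: "compact K" "K \<subseteq> closure (\<Omega> \<epsilon>) \<inter> cball 0 12" and cB: "continuous_on K B"
    and cases: "\<And>p. p \<in> K \<Longrightarrow> u p \<le> B p \<or> barrier_at \<epsilon> K B p"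
    and "x \<in> K"
  shows "u x \<le> B x"
proof (rule field_le_epsilon)
  let ?S = "log_barrier \<epsilon>"
  fix \<eta> :: real assume "0 < \<eta>"
  define \<delta> where "\<delta> = \<eta> / (1 + ?S x)"
  have S: "0 \<le> ?S p" if "p \<in> K" for p using that K(2) eps by (intro log_barrier_nonneg) auto
  then have "\<delta> > 0" using \<open>0 < \<eta>\<close> \<open>x \<in> K\<close> by (force simp: \<delta>_def intro!: divide_pos_pos add_pos_nonneg)
  have "u x \<le> 1 * B x + \<delta> * ?S x"
  proof (rule comparison_principle[OF K(1) _ _ _ \<open>x \<in> K\<close>])
    show "continuous_on K u" using u K(2) by (auto simp: neumann_harmonic_def intro: continuous_on_subset)
    have "continuous_on K ?S"
      by (rule continuous_on_subset[OF continuous_on_log_barrier]) (use K(2) eps in auto)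
    then show "continuous_on K (\<lambda>p. 1 * B p + \<delta> * ?S p)" using cB by (intro continuous_intros)
    fix p assume "p \<in> K"
    from cases[OF this] show "u p \<le> 1 * B p + \<delta> * ?S p \<or>
      (p \<in> interior K \<and> has_lap u p 0 \<and> (\<exists>L<0. has_lap (\<lambda>p. 1 * B p + \<delta> * ?S p) p L)) \<or>
      (\<exists>d b. b < 0 \<and> (\<forall>\<^sub>F t in at_right 0. p + t *\<^sub>R d \<in> K) \<and>
         has_ray_deriv u p d 0 \<and> has_ray_deriv (\<lambda>p. 1 * B p + \<delta> * ?S p) p d b)"
      unfolding barrier_at_def
    proof (elim disjE conjE exE bexE)
      assume "u p \<le> B p"
      moreover have "0 \<le> \<delta> * ?S p" using S[OF \<open>p \<in> K\<close>] \<open>\<delta> > 0\<close> by simp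
      ultimately show ?thesis by auto
    next
      fix L assume A: "p \<in> interior K" "p \<in> \<Omega> \<epsilon>" "L \<le> 0" "has_lap B p L"
      obtain M where M: "M < 0" "has_lap ?S p M" using log_barrier_lap[OF A(2)] by blast
      have "has_lap (\<lambda>p. 1 * B p + \<delta> * ?S p) p (1 * L + \<delta> * M)"
        by (rule has_lap_lincomb[OF A(4) M(2)])
      moreover have "1 * L + \<delta> * M < 0" using A(3) mult_pos_neg[OF \<open>\<delta> > 0\<close> M(1)] by simp
      ultimately show ?thesis using A u by (auto simp: neumann_harmonic_def)
    next
      fix c b assume A: "c \<in> {center1 \<epsilon>, center2 \<epsilon>}" "b \<le> 0" "dist c p = 1"
         "\<forall>\<^sub>F t in at_right 0. p + t *\<^sub>R (p - c) \<in> K" "has_ray_deriv B p (p - c) b"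
      obtain M where M: "M < 0" "has_ray_deriv ?S p (p - c) M"
        using A(1,3) log_barrier_ray[of c \<epsilon> "center2 \<epsilon>"] log_barrier_ray[of c \<epsilon> "center1 \<epsilon>"] eps by blast
      have "has_ray_deriv (\<lambda>p. 1 * B p + \<delta> * ?S p) p (p - c) (1 * b + \<delta> * M)"
        by (rule has_ray_deriv_lincomb[OF A(5) M(2)])
      moreover have "1 * b + \<delta> * M < 0" using A(2) mult_pos_neg[OF \<open>\<delta> > 0\<close> M(1)] by simp
      moreover have "has_ray_deriv u p (p - c) 0" using u A by (auto simp: neumann_harmonic_def)
      ultimately show ?thesis using A(4) by blast
    qed
  qed
  also have "1 * B x + \<delta> * ?S x \<le> B x + \<eta>"
    using S[OF \<open>x \<in> K\<close>] \<open>0 < \<eta>\<close> by (simp add: \<delta>_def field_simps)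
  finally show "u x \<le> B x + \<eta>" .
qed

lemma normal_ray_in:
  assumes "0 < \<epsilon>" "c \<in> {center1 \<epsilon>, center2 \<epsilon>}" "dist c p = 1" "p \<in> closure (\<Omega> \<epsilon>)"
    and "open U" "p \<in> U"
  shows "\<forall>\<^sub>F t in at_right 0. p + t *\<^sub>R (p - c) \<in> \<Omega> \<epsilon> \<inter> U"
proof -
  have "((\<lambda>t. p + t *\<^sub>R (p - c)) \<longlongrightarrow> p) (at_right 0)" by (auto intro!: tendsto_eq_intros)
  then have "\<forall>\<^sub>F t in at_right 0. p + t *\<^sub>R (p - c) \<in> U"
    using assms by (auto dest: topological_tendstoD)
  moreover have "\<forall>\<^sub>F t in at_right 0. p + t *\<^sub>R (p - c) \<in> \<Omega> \<epsilon>"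
    using assms normal_ray_exterior[of c \<epsilon> "center2 \<epsilon>" p] normal_ray_exterior[of c \<epsilon> "center1 \<epsilon>" p]
    by (auto simp: closure_exterior_domain_iff)
  ultimately show ?thesis by eventually_elim auto
qed

section \<open>Uniform bound for solutions\<close>

lemma exterior_domain_norm:
  assumes "0 < \<epsilon>" "\<epsilon> < 1" "5/2 < norm p"
  shows "p \<in> \<Omega> \<epsilon>"
proof -
  have "1 < dist c p" if "norm c = 1 + \<epsilon>/2" for c
    using norm_triangle_ineq2[of p c] that assms by (simp add: dist_norm norm_minus_commute)
  then show ?thesis using assms by (simp add: exterior_domain_iff norm_center)
qed

lemma sphere_norm_le:
  assumes "0 < \<epsilon>" "\<epsilon> < 1" "c \<in> {center1 \<epsilon>, center2 \<epsilon>}" "dist c p = 1"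
  shows "norm p \<le> 5/2"
  using norm_triangle_ineq2[of p c] assms norm_center[of \<epsilon>] by (auto simp: dist_norm norm_minus_commute)

text \<open>\<open>norm q powr (-1/2)\<close> is strictly superharmonic in three dimensions, whereas
  \<open>1 / norm q\<close> would only be harmonic. It halves when the radius grows by the factor 4,
  from 3 to 12: this is the origin of the radius 12 used throughout. The added \<open>\<eta>\<close>
  takes care of a large outer sphere.\<close>

lemma exterior_harmonic_decay:
  fixes w :: "real^3 \<Rightarrow> real"
  assumes cont: "continuous_on {p. 3 \<le> norm p} w" and lap: "\<And>p. 3 < norm p \<Longrightarrow> has_lap w p 0"
    and M: "\<And>p. norm p = 3 \<Longrightarrow> w p \<le> M" "0 < M" and lim: "(w \<longlongrightarrow> 0) at_infinity"
    and p: "12 \<le> norm p"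
  shows "w p \<le> M / 2"
proof (rule field_le_epsilon)
  fix \<eta> :: real assume "0 < \<eta>"
  then obtain R0 where R0: "\<And>x. R0 \<le> norm x \<Longrightarrow> \<bar>w x\<bar> < \<eta>"
    using tendstoD[OF lim, of \<eta>] unfolding eventually_at_infinity by auto
  define R where "R = max R0 (norm p)"
  define B where "B q = M * 9 powr (1/4) * ((norm (q - 0))\<^sup>2 powr (-1/4)) + \<eta> * 1" for q :: "real^3"
  let ?K = "{q::real^3. 3 \<le> norm q \<and> norm q \<le> R}"
  have "w p \<le> B p"
  proof (rule comparison_principle[of ?K])
    have "?K = cball 0 R \<inter> - ball 0 3" by auto
    then show "compact ?K" by (metis closed_Compl compact_Int_closed compact_cball open_ball)
    show "continuous_on ?K w" by (rule continuous_on_subset[OF cont]) auto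
    show "continuous_on ?K B" unfolding B_def by (intro continuous_intros) auto
    show "p \<in> ?K" using p by (auto simp: R_def)
    fix q assume q: "q \<in> ?K"
    consider "norm q = 3" | "norm q = R" | "3 < norm q" "norm q < R" using q by fastforce
    then show "w q \<le> B q \<or> (q \<in> interior ?K \<and> has_lap w q 0 \<and> (\<exists>L<0. has_lap B q L)) \<or>
      (\<exists>d b. b < 0 \<and> (\<forall>\<^sub>F t in at_right 0. q + t *\<^sub>R d \<in> ?K) \<and> has_ray_deriv w q d 0 \<and> has_ray_deriv B q d b)"
    proof cases
      case 1
      have "B q = M * (9 powr (1/4) * 9 powr (-1/4)) + \<eta>" by (simp add: B_def 1)
      also have "9 powr (1/4) * 9 powr (-1/4) = (1::real)" by (simp flip: powr_add)
      finally show ?thesis using M(1)[OF 1] \<open>0 < \<eta>\<close> by simp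
    next
      case 2
      have "w q < \<eta>" using R0[of q] 2 by (simp add: R_def)
      moreover have "\<eta> \<le> B q" using M(2) by (simp add: B_def)
      ultimately show ?thesis by simp
    next
      case 3
      let ?N = "(norm (q - 0))^2"
      have N: "0 < ?N" using 3 by (auto simp: zero_less_power)
      have "has_lap (\<lambda>q. (norm (q - 0))\<^sup>2 powr (-1/4)) q (-1/4 * ?N powr (-5/4))"
      proof (rule has_lap_radial[where \<phi>'="\<lambda>N. -1/4 * N powr (-5/4)" and k="5/16 * ?N powr (-9/4)"])
        have "?N * ?N powr (-9/4) = ?N powr (-5/4)"
          using N by (simp add: powr_mult_base)
        then show "-1/4 * ?N powr (-5/4) = 6 * (-1/4 * ?N powr (-5/4)) + 4 * ?N * (5/16 * ?N powr (-9/4))"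
          by simp
      qed (use 3 N in \<open>auto intro!: derivative_eq_intros\<close>)
      from has_lap_lincomb[OF this has_lap_const[of 1], of "M * 9 powr (1/4)" \<eta>]
      have "has_lap B q (- (M * 9 powr (1/4) / 4 * ?N powr (-5/4)))" by (simp add: B_def[abs_def])
      moreover have "- (M * 9 powr (1/4) / 4 * ?N powr (-5/4)) < 0"
        using M(2) N by (simp add: divide_simps)
      moreover have "q \<in> interior ?K"
      proof (rule interiorI[of "ball 0 R \<inter> - cball 0 3"])
        show "open (ball 0 R \<inter> - cball 0 3 :: (real^3) set)" by (intro open_Int open_Compl) auto
      qed (use 3 in auto)
      ultimately show ?thesis using lap 3(1) by blast
    qed
  qed
  also have "B p \<le> M * (9 powr (1/4) * 144 powr (-1/4)) + \<eta>"
  proof -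
    have "12^2 \<le> (norm p)^2" using p by (intro power_mono) auto
    then have "(norm p)\<^sup>2 powr (-1/4) \<le> 144 powr (-1/4)" by (intro powr_mono2') auto
    then show ?thesis using M(2) by (simp add: B_def)
  qed
  also have "9 powr (1/4) * 144 powr (-1/4) = (1/2::real)"
  proof -
    have "(144::real) = 9 * 2 powr 4" by simp
    then have "144 powr (-1/4) = (9 * 2 powr 4) powr (-1/4::real)" by simp
    also have "\<dots> = 9 powr (-1/4) * (2 powr 4) powr (-1/4::real)" by (simp only: powr_mult)
    also have "\<dots> = 9 powr (-1/4) * 2 powr (-1)" by (simp only: powr_powr) simp
    finally have "144 powr (-1/4) = 9 powr (-1/4) * 2 powr (-1::real)" .
    moreover have "9 powr (1/4) * 9 powr (-1/4) = (1::real)" by (simp flip: powr_add)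
    ultimately show ?thesis by (simp add: powr_minus_divide mult.assoc[symmetric] del: powr_minus)
  qed
  finally show "w p \<le> M / 2 + \<eta>" by simp
qed

text \<open>Constants have zero Laplacian and zero normal derivative, so the sphere of radius 12
  alone supplies boundary data.\<close>

lemma neumann_maximum_principle:
  assumes u: "neumann_harmonic \<epsilon> u" and eps: "0 < \<epsilon>" "\<epsilon> < 1"
    and bd: "\<And>q. norm q = 12 \<Longrightarrow> u q \<le> b"
    and p: "p \<in> closure (\<Omega> \<epsilon>)" "norm p \<le> 12"
  shows "u p \<le> b"
proof (rule neumann_comparison[OF u eps, of "closure (\<Omega> \<epsilon>) \<inter> cball 0 12" "\<lambda>_. b"])
  show "compact (closure (\<Omega> \<epsilon>) \<inter> cball 0 12)" by (simp add: closed_Int_compact)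
  fix q assume q: "q \<in> closure (\<Omega> \<epsilon>) \<inter> cball 0 12"
  consider "norm q = 12" | "norm q < 12" "q \<in> \<Omega> \<epsilon>"
     | c where "c \<in> {center1 \<epsilon>, center2 \<epsilon>}" "dist c q = 1"
    using q eps by (force simp: closure_exterior_domain_iff exterior_domain_iff)
  then show "u q \<le> b \<or> barrier_at \<epsilon> (closure (\<Omega> \<epsilon>) \<inter> cball 0 12) (\<lambda>_. b) q"
  proof cases
    case 1 then show ?thesis using bd by auto
  next
    case 2
    have "q \<in> interior (closure (\<Omega> \<epsilon>) \<inter> cball 0 12)"
      by (rule interiorI[of "\<Omega> \<epsilon> \<inter> ball 0 12"]) (use 2 closure_subset in auto)
    then show ?thesis unfolding barrier_at_def using 2 has_lap_const[of b q] by blast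
  next
    case (3 c)
    have "\<forall>\<^sub>F t in at_right 0. q + t *\<^sub>R (q - c) \<in> \<Omega> \<epsilon> \<inter> ball 0 12"
      using 3 q eps sphere_norm_le[of \<epsilon> c q] by (intro normal_ray_in) auto
    then have "\<forall>\<^sub>F t in at_right 0. q + t *\<^sub>R (q - c) \<in> closure (\<Omega> \<epsilon>) \<inter> cball 0 12"
      by (rule eventually_mono) (use closure_subset in auto)
    moreover have "has_ray_deriv (\<lambda>_. b) q (q - c) 0" by (simp add: has_ray_deriv_def)
    ultimately show ?thesis unfolding barrier_at_def using 3 by blast
  qed
qed (use p in auto)

text \<open>A bound \<open>M\<close> for \<open>\<bar>u - H\<bar>\<close> improves itself to \<open>2 * K + M / 2\<close>: far out by comparison with
  \<open>norm p powr (- 1/2)\<close>, near the balls by the maximum principle for \<open>u\<close>.\<close>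

lemma neumann_harmonic_bound:
  fixes H :: "real^3 \<Rightarrow> real" and K :: real
  assumes u: "neumann_harmonic \<epsilon> u" and eps: "0 < \<epsilon>" "\<epsilon> < 1"
    and H: "continuous_on UNIV H" "\<And>p. has_lap H p 0" and K: "\<And>p. norm p \<le> 12 \<Longrightarrow> \<bar>H p\<bar> \<le> K"
    and lim: "((\<lambda>x. u x - H x) \<longlongrightarrow> 0) at_infinity"
    and p: "p \<in> closure (\<Omega> \<epsilon>)" "norm p \<le> 12"
  shows "\<bar>u p\<bar> \<le> 3 * K"
proof -
  let ?X = "closure (\<Omega> \<epsilon>)"
  define w where "w x = 1 * u x + (-1) * H x" for x
  have cu: "continuous_on ?X u" using u by (simp add: neumann_harmonic_def)
  then have cw: "continuous_on ?X w" unfolding w_def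
    using H(1) by (intro continuous_intros) (auto intro: continuous_on_subset)
  have wlap: "has_lap w q 0" if "q \<in> \<Omega> \<epsilon>" for q
    using has_lap_lincomb[of u q 0 H 0 1 "-1"] u H(2) that
    by (simp add: neumann_harmonic_def w_def[abs_def])
  have wlim: "(w \<longlongrightarrow> 0) at_infinity" using lim by (simp add: w_def[abs_def])
  have K0: "0 \<le> K" using K[of 0] by simp
  have improve: "\<bar>w q\<bar> \<le> 2 * K + M / 2 \<and> (norm q \<le> 12 \<longrightarrow> \<bar>u q\<bar> \<le> K + M / 2)"
    if M: "\<And>q. q \<in> ?X \<Longrightarrow> \<bar>w q\<bar> \<le> M" "0 < M" and q: "q \<in> ?X" for M q
  proof -
    have sub: "{p. 3 \<le> norm p} \<subseteq> ?X"
      using exterior_domain_norm[of \<epsilon>] eps closure_subset[of "\<Omega> \<epsilon>"] by force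
    have edge: "w p \<le> M" "- w p \<le> M" if "norm p = 3" for p
    proof -
      have "p \<in> ?X" using sub that by force
      then show "w p \<le> M" "- w p \<le> M" using M(1)[of p] by linarith+
    qed
    have far: "\<bar>w q\<bar> \<le> M / 2" if "12 \<le> norm q" for q
    proof -
      have "w q \<le> M / 2"
      proof (rule exterior_harmonic_decay)
        show "continuous_on {p. 3 \<le> norm p} w" by (rule continuous_on_subset[OF cw sub])
        show "w p \<le> M" if "norm p = 3" for p using edge[OF that] by simp
      qed (use that wlim \<open>0 < M\<close> exterior_domain_norm[of \<epsilon>] eps wlap in auto)
      moreover have "- w q \<le> M / 2"
      proof (rule exterior_harmonic_decay)
        show "continuous_on {p. 3 \<le> norm p} (\<lambda>x. - w x)"
          by (intro continuous_intros continuous_on_subset[OF cw sub])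
        show "has_lap (\<lambda>x. - w x) p 0" if "3 < norm p" for p
          using has_lap_lincomb[of w p 0 w 0 "-1" 0] wlap exterior_domain_norm[of \<epsilon> p] eps that by auto
        show "- w p \<le> M" if "norm p = 3" for p using edge[OF that] by simp
        show "((\<lambda>x. - w x) \<longlongrightarrow> 0) at_infinity" using tendsto_minus[OF wlim] by simp
      qed (use that \<open>0 < M\<close> in auto)
      ultimately show ?thesis by linarith
    qed
    have bd: "\<bar>u q\<bar> \<le> K + M / 2" if "norm q = 12" for q
    proof -
      have "\<bar>1 * u q + (-1) * H q\<bar> \<le> M / 2" "\<bar>H q\<bar> \<le> K" using far[of q] K[of q] that by (simp_all add: w_def)
      then show ?thesis by linarith
    qed
    have near: "\<bar>u q\<bar> \<le> K + M / 2" if q: "norm q \<le> 12" "q \<in> ?X" for q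
    proof -
      have "u q \<le> K + M / 2"
        by (rule neumann_maximum_principle[OF u eps _ q(2,1)]) (use bd abs_le_D1 in blast)
      moreover have "neumann_harmonic \<epsilon> (\<lambda>x. - u x)"
        using neumann_harmonic_lincomb[OF u u, of "-1" 0] by simp
      then have "- u q \<le> K + M / 2"
        by (rule neumann_maximum_principle[OF _ eps _ q(2,1)]) (use bd abs_le_D2 in blast)
      ultimately show ?thesis by linarith
    qed
    show ?thesis
    proof (cases "norm q \<le> 12")
      case True
      then have "\<bar>u q\<bar> \<le> K + M / 2" "\<bar>H q\<bar> \<le> K" using near[of q] q K[of q] by auto
      then show ?thesis unfolding w_def by linarith
    next
      case False
      then show ?thesis using far[of q] K0 by simp
    qed
  qed
  have "bounded (w ` ?X)"
  proof -
    obtain R where R: "\<And>x. R \<le> norm x \<Longrightarrow> \<bar>w x\<bar> < 1"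
      using tendstoD[OF wlim, of 1] unfolding eventually_at_infinity by auto
    have "compact (?X \<inter> cball 0 R)" by (simp add: closed_Int_compact)
    then have "bounded (w ` (?X \<inter> cball 0 R))"
      by (intro compact_imp_bounded compact_continuous_image continuous_on_subset[OF cw]) auto
    then obtain b where b: "\<forall>x\<in>?X \<inter> cball 0 R. \<bar>w x\<bar> \<le> b"
      unfolding bounded_iff by auto
    have "\<bar>w x\<bar> \<le> max b 1" if "x \<in> ?X" for x
      using b R[of x] that by (cases "norm x \<le> R") (auto simp: le_max_iff_disj)
    then show ?thesis unfolding bounded_iff by auto
  qed
  then have bdd: "bdd_above ((\<lambda>x. \<bar>w x\<bar>) ` ?X)"
    unfolding bounded_iff bdd_above_def by auto
  define m where "m = (SUP x\<in>?X. \<bar>w x\<bar>)"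
  have m: "\<bar>w x\<bar> \<le> m" if "x \<in> ?X" for x unfolding m_def by (rule cSUP_upper[OF that bdd])
  \<comment> \<open>\<open>4 * K\<close> is the fixed point of the improvement from \<open>M\<close>
    to \<open>2 * K + M / 2\<close>, and the supremum cannot exceed it.\<close>
  have "m \<le> 4 * K"
  proof (rule ccontr)
    assume "\<not> m \<le> 4 * K"
    then have "0 < m" using K0 by linarith
    have "m \<le> 2 * K + m / 2" unfolding m_def[symmetric]
      by (subst m_def, rule cSUP_least) (use p improve[OF m \<open>0 < m\<close>] in auto)
    with \<open>\<not> m \<le> 4 * K\<close> show False by simp
  qed
  show ?thesis
  proof (rule field_le_epsilon)
    fix e :: real assume "0 < e"
    \<comment> \<open>The improvement is stated for positive bounds and \<open>4 * K\<close> may be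
      zero, hence the \<open>e\<close>.\<close>
    have "\<bar>u p\<bar> \<le> K + (4 * K + e) / 2"
      using improve[of "4 * K + e" p] m \<open>m \<le> 4 * K\<close> \<open>0 < e\<close> K0 p by fastforce
    also have "K + (4 * K + e) / 2 = 3 * K + e / 2" by (simp add: field_simps)
    finally show "\<bar>u p\<bar> \<le> 3 * K + e" using \<open>0 < e\<close> by linarith
  qed
qed

text \<open>A gradient estimate in disguise: \<open>v\<close> is bounded by the distance to the
  plane on which it is nonpositive. In the half ball the barrier is the sum of
  \<open>M * (norm (x - c))^2\<close>, which reaches \<open>M\<close> on the round part, and a
  concave quadratic in \<open>x $ i - c $ i\<close>, nonnegative there, whose Laplacian
  \<open>- 8 * M\<close> outweighs the \<open>6 * M\<close> of the first term.\<close>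

lemma odd_harmonic_linear_bound:
  fixes v :: "real^3 \<Rightarrow> real" and M t :: real
  assumes cont: "continuous_on (cball c 1 \<inter> {x. c $ i \<le> x $ i}) v"
    and lap: "\<And>x. x \<in> ball c 1 \<Longrightarrow> c $ i < x $ i \<Longrightarrow> has_lap v x 0"
    and zero: "\<And>x. x \<in> cball c 1 \<Longrightarrow> x $ i = c $ i \<Longrightarrow> v x \<le> 0"
    and M: "\<And>x. x \<in> cball c 1 \<Longrightarrow> v x \<le> M" "0 < M" and t: "0 \<le> t" "t \<le> 1"
  shows "v (c + t *\<^sub>R axis i 1) \<le> 5 * M * t"
proof -
  let ?K = "cball c 1 \<inter> {x. c $ i \<le> x $ i}"
  define B where "B x = M * (norm (x - c))^2 + 1 * (4 * M * (x $ i - c $ i) - 4 * M * (x $ i - c $ i)^2)" for x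
  have "v (c + t *\<^sub>R axis i 1) \<le> B (c + t *\<^sub>R axis i 1)"
  proof (rule comparison_principle[of ?K])
    show "compact ?K"
      by (intro compact_Int_closed compact_cball closed_halfspace_component_ge_cart)
    show "continuous_on ?K B" unfolding B_def by (intro continuous_intros)
    show "c + t *\<^sub>R axis i 1 \<in> ?K" using t by (simp add: dist_norm)
    fix x assume x: "x \<in> ?K"
    have "\<bar>(x - c) $ i\<bar> \<le> norm (x - c)" by (rule component_le_norm_cart)
    then have xi: "0 \<le> x $ i - c $ i" "x $ i - c $ i \<le> norm (x - c)" "norm (x - c) \<le> 1"
      using x by (auto simp: dist_norm norm_minus_commute)
    have nn: "0 \<le> 4 * M * (x $ i - c $ i) - 4 * M * (x $ i - c $ i)^2"
    proof -
      have "0 \<le> 4 * M * ((x $ i - c $ i) * (1 - (x $ i - c $ i)))"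
        using M(2) xi by (intro mult_nonneg_nonneg) auto
      then show ?thesis by (simp add: power2_eq_square algebra_simps)
    qed
    consider "x $ i = c $ i" | "norm (x - c) = 1" | "c $ i < x $ i" "x \<in> ball c 1"
      using x xi by (force simp: dist_norm norm_minus_commute)
    then show "v x \<le> B x \<or> (x \<in> interior ?K \<and> has_lap v x 0 \<and> (\<exists>L<0. has_lap B x L)) \<or>
      (\<exists>d b. b < 0 \<and> (\<forall>\<^sub>F t in at_right 0. x + t *\<^sub>R d \<in> ?K) \<and> has_ray_deriv v x d 0 \<and> has_ray_deriv B x d b)"
    proof cases
      case 1
      then show ?thesis using zero[of x] x M(2) by (auto simp: B_def intro: order_trans[of _ 0])
    next
      case 2
      then show ?thesis using M(1)[of x] x nn by (simp add: B_def)
    next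
      case 3
      have "has_lap (\<lambda>x. (norm (x - c))^2) x 6"
        by (cases "x = c") (use 3 has_lap_radial[of "\<lambda>N. N" "\<lambda>_. 1" 0 x c 6] in auto)
      moreover have "has_lap (\<lambda>x. 4 * M * (x $ i - c $ i) - 4 * M * (x $ i - c $ i)^2) x (- 8 * M)"
        unfolding has_lap_def
        by (intro exI[of _ "\<lambda>j t. if j = i then 4 * M - 8 * M * (x $ i + t - c $ i) else 0"]
              exI[of _ "\<lambda>j. if j = i then - 8 * M else 0"] conjI allI always_eventually)
           (auto intro!: derivative_eq_intros simp: axis_def algebra_simps)
      ultimately have "has_lap B x (M * 6 + 1 * (- 8 * M))"
        unfolding B_def by (rule has_lap_lincomb)
      moreover have "M * 6 + 1 * (- 8 * M) < 0" using M(2) by simp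
      moreover have "x \<in> interior ?K"
        by (rule interiorI[of "ball c 1 \<inter> {x. c $ i < x $ i}"])
           (use 3 in \<open>auto intro!: open_Int open_halfspace_component_gt_cart\<close>)
      ultimately show ?thesis using lap 3 by blast
    qed
  qed (rule cont)
  also have "B (c + t *\<^sub>R axis i 1) \<le> 5 * M * t"
  proof -
    have "B (c + t *\<^sub>R axis i 1) = 4 * M * t - 3 * M * t^2" by (simp add: B_def power_mult_distrib algebra_simps)
    also have "\<dots> \<le> 5 * M * t" using M(2) t mult_nonneg_nonneg[of M t] mult_nonneg_nonneg[of M "t^2"]
      by (simp del: mult_nonneg_nonneg)
    finally show ?thesis .
  qed
  finally show ?thesis .
qed

subsection \<open>Transversal derivatives in the neck\<close>

text \<open>With \<open>\<Phi> = f + x^2 * g\<close>, the planar Laplacian of \<open>\<Phi>\<close>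
  is \<open>4 * s * \<Phi>'' + 4 * \<Phi>'\<close>; the product with \<open>y\<close> adds the cross
  term \<open>4 * y * \<Phi>'\<close>, which makes the coefficient 8. The remaining
  \<open>2 * g\<close> is the second derivative in \<open>x\<close>.\<close>

lemma has_lap_axial:
  fixes f g :: "real \<Rightarrow> real"
  assumes f: "\<And>s. lo < s \<Longrightarrow> (f has_real_derivative f' s) (at s)" "(f' has_real_derivative f'') (at s\<^sub>0)"
    and g: "\<And>s. lo < s \<Longrightarrow> (g has_real_derivative g' s) (at s)" "(g' has_real_derivative g'') (at s\<^sub>0)"
    and s: "s\<^sub>0 = (p$2)^2 + (p$3)^2" "lo < s\<^sub>0"
  shows "has_lap (\<lambda>q. q$2 * (f ((q$2)^2 + (q$3)^2) + (q$1)^2 * g ((q$2)^2 + (q$3)^2))) p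
     (p$2 * (2 * g s\<^sub>0 + 4 * s\<^sub>0 * f'' + 8 * f' s\<^sub>0 + (p$1)^2 * (4 * s\<^sub>0 * g'' + 8 * g' s\<^sub>0)))"
proof -
  define \<Phi> where "\<Phi> s = f s + (p$1)^2 * g s" for s
  define \<Phi>' where "\<Phi>' s = f' s + (p$1)^2 * g' s" for s
  define \<Phi>'' where "\<Phi>'' = f'' + (p$1)^2 * g''"
  have \<Phi>: "(\<Phi> has_real_derivative \<Phi>' s) (at s)" if "lo < s" for s
    unfolding \<Phi>_def \<Phi>'_def using f(1) g(1) that by (auto intro!: derivative_eq_intros)
  have \<Phi>': "(\<Phi>' has_real_derivative \<Phi>'') (at s\<^sub>0)"
    unfolding \<Phi>'_def[abs_def] \<Phi>''_def using f(2) g(2) by (auto intro!: derivative_eq_intros)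
  have d: "((\<lambda>t. (b + t)^2 + k) has_real_derivative 2 * (b + t)) (at t)" for b k t :: real
    by (auto intro!: derivative_eq_intros)
  have ev: "\<forall>\<^sub>F t in nhds 0. lo < (b + t)^2 + k" if "lo < b^2 + k" for b k :: real
  proof -
    have "((\<lambda>t. (b + t)^2 + k) \<longlongrightarrow> (b + 0)^2 + k) (nhds 0)" by (intro tendsto_intros filterlim_ident)
    then show ?thesis using that by (auto dest: order_tendstoD(1))
  qed
  let ?B = "\<lambda>q::real^3. q$2 * (f ((q$2)^2 + (q$3)^2) + (q$1)^2 * g ((q$2)^2 + (q$3)^2))"
  show ?thesis
  proof (rule has_lap_coordinates)
    show "\<forall>\<^sub>F t in nhds 0. ((\<lambda>t. ?B (p + t *\<^sub>R axis 1 1))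
       has_real_derivative p$2 * (2 * (p$1 + t) * g s\<^sub>0)) (at t)"
      by (rule always_eventually) (auto intro!: derivative_eq_intros simp: s)
    show "((\<lambda>t. p$2 * (2 * (p$1 + t) * g s\<^sub>0)) has_real_derivative p$2 * (2 * g s\<^sub>0)) (at 0)"
      by (auto intro!: derivative_eq_intros)
    have "\<forall>\<^sub>F t in nhds 0. lo < (p$2 + t)^2 + (p$3)^2" using s by (intro ev) simp
    then show "\<forall>\<^sub>F t in nhds 0. ((\<lambda>t. ?B (p + t *\<^sub>R axis 2 1))
       has_real_derivative \<Phi> ((p$2 + t)^2 + (p$3)^2) +
         2 * (p$2 + t)^2 * \<Phi>' ((p$2 + t)^2 + (p$3)^2)) (at t)"
    proof eventually_elim
      case (elim t)
      have "((\<lambda>t. (p$2 + t) * \<Phi> ((p$2 + t)^2 + (p$3)^2)) has_real_derivative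
         \<Phi> ((p$2 + t)^2 + (p$3)^2) + 2 * (p$2 + t)^2 * \<Phi>' ((p$2 + t)^2 + (p$3)^2)) (at t)"
        by (rule derivative_eq_intros DERIV_chain2[OF \<Phi>[OF elim] d] refl)+ (simp add: power2_eq_square)
      then show ?case by (simp add: \<Phi>_def)
    qed
    have c: "((\<lambda>t. \<Phi>' ((b + t)^2 + k)) has_real_derivative \<Phi>'' * (2 * b)) (at 0)"
            "((\<lambda>t. \<Phi> ((b + t)^2 + k)) has_real_derivative \<Phi>' s\<^sub>0 * (2 * b)) (at 0)" if "b^2 + k = s\<^sub>0" for b k :: real
      using DERIV_chain2[OF _ d[of b k 0], of \<Phi>' \<Phi>''] \<Phi>' DERIV_chain2[OF _ d[of b k 0], of \<Phi> "\<Phi>' s\<^sub>0"] \<Phi>[OF s(2)] that by simp_all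
    show "((\<lambda>t. \<Phi> ((p$2 + t)^2 + (p$3)^2) + 2 * (p$2 + t)^2 * \<Phi>' ((p$2 + t)^2 + (p$3)^2))
       has_real_derivative 6 * p$2 * \<Phi>' s\<^sub>0 + 4 * (p$2)^2 * p$2 * \<Phi>'') (at 0)"
      using c[of "p$2" "(p$3)^2"] s(1)
      by (auto intro!: derivative_eq_intros simp: power2_eq_square algebra_simps)
    have "\<forall>\<^sub>F t in nhds 0. lo < (p$3 + t)^2 + (p$2)^2" using s by (intro ev) (simp add: add.commute)
    then show "\<forall>\<^sub>F t in nhds 0. ((\<lambda>t. ?B (p + t *\<^sub>R axis 3 1))
       has_real_derivative p$2 * (\<Phi>' ((p$3 + t)^2 + (p$2)^2) * (2 * (p$3 + t)))) (at t)"
    proof eventually_elim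
      case (elim t)
      have "((\<lambda>t. p$2 * \<Phi> ((p$3 + t)^2 + (p$2)^2)) has_real_derivative
         p$2 * (\<Phi>' ((p$3 + t)^2 + (p$2)^2) * (2 * (p$3 + t)))) (at t)"
        by (rule DERIV_cmult[OF DERIV_chain2[OF \<Phi>[OF elim] d]])
      then show ?case by (simp add: \<Phi>_def add.commute[of "(p$2)^2"])
    qed
    show "((\<lambda>t. p$2 * (\<Phi>' ((p$3 + t)^2 + (p$2)^2) * (2 * (p$3 + t))))
       has_real_derivative p$2 * (4 * (p$3)^2 * \<Phi>'' + 2 * \<Phi>' s\<^sub>0)) (at 0)"
      using c[of "p$3" "(p$2)^2"] s(1)
      by (auto intro!: derivative_eq_intros simp: power2_eq_square algebra_simps)
    show "p$2 * (2 * g s\<^sub>0 + 4 * s\<^sub>0 * f'' + 8 * f' s\<^sub>0 + (p$1)^2 * (4 * s\<^sub>0 * g'' + 8 * g' s\<^sub>0)) =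
       p$2 * (2 * g s\<^sub>0) + (6 * p$2 * \<Phi>' s\<^sub>0 + 4 * (p$2)^2 * p$2 * \<Phi>'') + p$2 * (4 * (p$3)^2 * \<Phi>'' + 2 * \<Phi>' s\<^sub>0)"
      by (simp add: \<Phi>'_def \<Phi>''_def s(1) algebra_simps)
  qed
qed

text \<open>Since \<open>c\<close> lies on the axis, moving along the ray multiplies
  \<open>y\<close> by \<open>1 + t\<close> and \<open>s\<close> by \<open>(1 + t)^2\<close>; only
  \<open>x\<close> needs separate treatment.\<close>

lemma has_ray_deriv_axial:
  fixes f g :: "real \<Rightarrow> real"
  assumes f: "(f has_real_derivative f') (at s)" and g: "(g has_real_derivative g') (at s)"
    and s: "s = (p$2)^2 + (p$3)^2" and c: "c $ 2 = 0" "c $ 3 = 0"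
  shows "has_ray_deriv (\<lambda>q. q$2 * (f ((q$2)^2 + (q$3)^2) + (q$1)^2 * g ((q$2)^2 + (q$3)^2))) p (p - c)
     (p$2 * (f s + (p$1)^2 * g s + 2 * p$1 * (p$1 - c$1) * g s + 2 * s * (f' + (p$1)^2 * g')))"
proof -
  have eq: "(p$2 + t * p$2)^2 + (p$3 + t * p$3)^2 = s * (1 + t)^2" for t
    by (simp add: s power2_eq_square algebra_simps)
  have d: "((\<lambda>t. s * (1 + t)^2) has_real_derivative 2 * s) (at 0)"
    by (auto intro!: derivative_eq_intros)
  have f': "((\<lambda>t. f (s * (1 + t)^2)) has_real_derivative f' * (2 * s)) (at 0)"
    by (rule DERIV_chain2[OF _ d]) (simp add: f)
  have g': "((\<lambda>t. g (s * (1 + t)^2)) has_real_derivative g' * (2 * s)) (at 0)"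
    by (rule DERIV_chain2[OF _ d]) (simp add: g)
  have *: "((\<lambda>t. (b + t * b) * (F t + (x + t * k)^2 * G t)) has_real_derivative
      b * (F 0 + x^2 * G 0 + 2 * x * k * G 0 + (F1 + x^2 * G1))) (at 0)"
    if "(F has_real_derivative F1) (at 0)" "(G has_real_derivative G1) (at 0)" for F G :: "real \<Rightarrow> real" and F1 G1 b x k
    by (rule that derivative_eq_intros refl)+ (simp add: algebra_simps)
  have "((\<lambda>t. (p$2 + t * p$2) * (f (s * (1 + t)^2) + (p$1 + t * (p$1 - c$1))^2 * g (s * (1 + t)^2)))
     has_real_derivative (p$2 * (f s + (p$1)^2 * g s + 2 * p$1 * (p$1 - c$1) * g s + 2 * s * (f' + (p$1)^2 * g')))) (at 0)"
  proof (rule DERIV_cong[OF *[OF f' g', of "p$2" "p$1" "p$1 - c$1"]])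
    have e: "f' * (2 * s) + (p$1)^2 * (g' * (2 * s)) = 2 * s * (f' + (p$1)^2 * g')" by (simp add: algebra_simps)
    show "p$2 * (f (s * (1 + 0)^2) + (p$1)^2 * g (s * (1 + 0)^2) +
        2 * p$1 * (p$1 - c$1) * g (s * (1 + 0)^2) + (f' * (2 * s) + (p$1)^2 * (g' * (2 * s)))) =
      p$2 * (f s + (p$1)^2 * g s + 2 * p$1 * (p$1 - c$1) * g s + 2 * s * (f' + (p$1)^2 * g'))"
      unfolding e by simp
  qed
  from has_field_derivative_at_within[OF this, of "{0..}"] show ?thesis
    by (simp only: has_ray_deriv_def vector_add_component vector_scaleR_component
        vector_minus_component c diff_zero eq real_scaleR_def)
qed

section \<open>Comparison with the angular barrier\<close>

lemma dist_center_sq: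
  "(dist (center1 \<epsilon>) p)^2 = (p$1 + (1 + \<epsilon>/2))^2 + ((p$2)^2 + (p$3)^2)"
  "(dist (center2 \<epsilon>) p)^2 = (p$1 - (1 + \<epsilon>/2))^2 + ((p$2)^2 + (p$3)^2)"
  unfolding dist_norm norm3_sq by (simp_all add: power2_eq_square algebra_simps)

lemma one_le_dist_iff: "1 \<le> dist c p \<longleftrightarrow> 1 \<le> (dist c p)^2"
  using abs_square_le_1[of "dist c p"] abs_square_eq_1[of "dist c p"] by (auto simp: power2_eq_1_iff)

lemma closure_exterior_domain_coords:
  assumes "0 < \<epsilon>"
  shows "p \<in> closure (\<Omega> \<epsilon>) \<longleftrightarrow>
    1 \<le> (p$1 + (1 + \<epsilon>/2))^2 + ((p$2)^2 + (p$3)^2) \<and> 1 \<le> (p$1 - (1 + \<epsilon>/2))^2 + ((p$2)^2 + (p$3)^2)"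
  using closure_exterior_domain_iff[OF assms, of p] one_le_dist_iff[of "center1 \<epsilon>" p]
    one_le_dist_iff[of "center2 \<epsilon>" p] by (simp add: dist_center_sq)

lemma real_component_sq: "(p$1)^2 \<le> (norm (p::real^3))^2" "(p$2)^2 + (p$3)^2 \<le> (norm p)^2"
  by (simp_all add: norm3_sq)

text \<open>Of oddness in the second coordinate only the zero on the plane is kept: it is the
  boundary condition on the flat side of the half domain.\<close>

definition axial_odd :: "(real^3 \<Rightarrow> real) \<Rightarrow> bool" where
  "axial_odd v \<longleftrightarrow> (\<forall>p. p$2 = 0 \<longrightarrow> v p = 0)"

text \<open>The barrier \<open>y / r\<close> is superharmonic for \<open>y > 0\<close> and, being a function of the angle about the axis, has normal derivative zero on both of them.\<close>

lemma angular_bound: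
  assumes v: "neumann_harmonic \<epsilon> v" "axial_odd v" and eps: "0 < \<epsilon>" "\<epsilon> < 1"
    and M: "\<And>p. p \<in> closure (\<Omega> \<epsilon>) \<Longrightarrow> norm p \<le> 12 \<Longrightarrow> v p \<le> M" "0 < M"
    and p: "p \<in> closure (\<Omega> \<epsilon>)" "norm p \<le> 6" "0 \<le> p$2" "0 < (p$2)^2 + (p$3)^2"
  shows "v p \<le> 30 * M * (p$2 * ((p$2)^2 + (p$3)^2) powr (-1/2))"
proof (rule field_le_epsilon)
  let ?X = "closure (\<Omega> \<epsilon>)"
  let ?s = "\<lambda>q::real^3. (q$2)^2 + (q$3)^2"
  fix \<delta> :: real assume "0 < \<delta>"
  have cv: "continuous_on ?X v" using v by (simp add: neumann_harmonic_def)
  have vlap: "has_lap v q 0" if "q \<in> \<Omega> \<epsilon>" for q using v that by (simp add: neumann_harmonic_def)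
  \<comment> \<open>The barrier is singular on the axis. There \<open>v\<close> vanishes, so by
    compactness \<open>v \<le> \<delta>\<close> in a thin tube around it, and the tube can be cut
    out at the price of adding \<open>\<delta>\<close> to the barrier.\<close>
  obtain \<eta> where \<eta>: "0 < \<eta>" "\<And>q. q \<in> ?X \<Longrightarrow> norm q \<le> 6 \<Longrightarrow> ?s q \<le> \<eta> \<Longrightarrow> v q \<le> \<delta>"
  proof -
    let ?Q = "(?X \<inter> cball 0 6) \<inter> v -` {\<delta>..}"
    have "closed ?Q"
      by (rule continuous_closed_preimage[OF continuous_on_subset[OF cv]]) (auto simp: closed_Int)
    moreover have "?Q = cball 0 6 \<inter> ?Q" by auto
    ultimately have "compact ?Q" using compact_Int_closed[OF compact_cball] by metis
    moreover have "continuous_on ?Q ?s" by (intro continuous_intros)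
    ultimately consider "?Q = {}" | q0 where "q0 \<in> ?Q" "\<And>q. q \<in> ?Q \<Longrightarrow> ?s q0 \<le> ?s q"
      using continuous_attains_inf[of ?Q ?s] by blast
    then show thesis
    proof cases
      case 1
      then have "v q \<le> \<delta>" if "q \<in> ?X" "norm q \<le> 6" for q using that by force
      then show thesis by (intro that[of 1]) auto
    next
      case (2 q0)
      have "?s q0 \<noteq> 0"
      proof
        assume "?s q0 = 0"
        then have "q0 $ 2 = 0" by (simp add: sum_power2_eq_zero_iff)
        then show False using v(2) 2(1) \<open>0 < \<delta>\<close> by (auto simp: axial_odd_def)
      qed
      then have s0: "0 < ?s q0" by (metis sum_power2_ge_zero order_less_le)
      show thesis
      proof (rule that[of "?s q0 / 2"])
        show "0 < ?s q0 / 2" using s0 by simp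
        fix q assume q: "q \<in> ?X" "norm q \<le> 6" "?s q \<le> ?s q0 / 2"
        show "v q \<le> \<delta>"
        proof (rule ccontr)
          assume "\<not> v q \<le> \<delta>"
          then have "q \<in> ?Q" using q by auto
          from order_trans[OF 2(2)[OF this] q(3)] s0 show False by simp
        qed
      qed
    qed
  qed
  define f where "f s = 30 * M * s powr (-1/2)" for s :: real
  define B where "B q = 1 * (q$2 * (f (?s q) + (q$1)^2 * 0)) + \<delta> * 1" for q :: "real^3"
  have f: "(f has_real_derivative - 15 * M * s powr (-3/2)) (at s)"
     "((\<lambda>s. - 15 * M * s powr (-3/2)) has_real_derivative 45/2 * M * s powr (-5/2)) (at s)" if "0 < s" for s
    using that unfolding f_def by (auto intro!: derivative_eq_intros)
  \<comment> \<open>The minimum keeps \<open>p\<close> itself outside the removed tube.\<close>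
  let ?K = "(?X \<inter> cball 0 6) \<inter> {q. 0 \<le> q$2 \<and> min \<eta> (?s p) \<le> ?s q}"
  have m: "0 < min \<eta> (?s p)" using \<eta>(1) p(4) by simp
  have "v p \<le> B p"
  proof (rule neumann_comparison[OF v(1) eps, of ?K])
    have "closed {q::real^3. 0 \<le> q$2 \<and> min \<eta> (?s p) \<le> ?s q}"
      by (intro closed_Collect_conj closed_Collect_le continuous_intros)
    moreover have "compact (?X \<inter> cball 0 6)" by (simp add: closed_Int_compact)
    ultimately show "compact ?K" by (rule compact_Int_closed[rotated])
    show "?K \<subseteq> ?X \<inter> cball 0 12" by auto
    show "continuous_on ?K B" unfolding B_def f_def
      by (intro continuous_intros) (use m in auto)
    show "p \<in> ?K" using p by auto
    fix q assume q: "q \<in> ?K"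
    then have sq: "0 < ?s q" using m by auto
    have s36: "?s q \<le> 36"
      using real_component_sq(2)[of q] power_mono[of "norm q" 6 2] q by auto
    have rt: "1/6 \<le> ?s q powr (-1/2)"
    proof -
      have "36 powr (-1/2) \<le> ?s q powr (-1/2)" by (rule powr_mono2') (use sq s36 in auto)
      moreover have "36 powr (-1/2) = (1/6 :: real)"
        by (simp add: powr_minus_divide powr_half_sqrt real_sqrt_eq_iff real_sqrt_unique)
      ultimately show ?thesis by simp
    qed
    \<comment> \<open>Inside radius 6 one has \<open>r \<le> 6\<close>, so
      \<open>30 * M * y / r\<close> is at least \<open>5 * M * y\<close>, the bound that
      \<open>odd_harmonic_linear_bound\<close> supplies on the outer sphere. Hence
      \<open>30 = 5 * 6\<close>.\<close>
    have Bq: "5 * M * q$2 + \<delta> \<le> B q"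
    proof -
      have "5 * M * q$2 = 30 * M * q$2 * (1/6)" by simp
      also have "\<dots> \<le> 30 * M * q$2 * ?s q powr (-1/2)" using rt M(2) q by (intro mult_left_mono) auto
      finally show ?thesis by (simp add: B_def f_def mult_ac)
    qed
    have nn: "0 \<le> 5 * M * q$2" using M(2) q by auto
    have split: "q \<in> \<Omega> \<epsilon> \<or> (\<exists>c\<in>{center1 \<epsilon>, center2 \<epsilon>}. dist c q = 1)"
      using q eps by (force simp: closure_exterior_domain_iff exterior_domain_iff)
    have "norm q < 6 \<or> norm q = 6" "0 < q$2 \<or> q$2 = 0" "?s q \<le> \<eta> \<or> \<eta> < ?s q" "q$2 < 1 \<or> 1 \<le> q$2"
      using q by auto
    with split consider "q$2 = 0" | "?s q \<le> \<eta>" | "norm q = 6" "q$2 < 1" | "norm q = 6" "1 \<le> q$2"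
      | "0 < q$2" "norm q < 6" "\<eta> < ?s q" "q \<in> \<Omega> \<epsilon>"
      | c where "0 < q$2" "norm q < 6" "\<eta> < ?s q" "c \<in> {center1 \<epsilon>, center2 \<epsilon>}" "dist c q = 1"
      by blast
    then show "v q \<le> B q \<or> barrier_at \<epsilon> ?K B q"
    proof cases
      case 1
      then have "v q = 0" using v(2) by (simp add: axial_odd_def)
      then show ?thesis using Bq nn \<open>0 < \<delta>\<close> by auto
    next
      case 2
      then have "v q \<le> \<delta>" using \<eta>(2) q by auto
      then show ?thesis using Bq nn by auto
    next
      case 3
      \<comment> \<open>The foot of the perpendicular from \<open>q\<close> to the plane
        \<open>y = 0\<close>. The unit ball around it stays clear of both balls and inside radius
        12, so the interior estimate applies.\<close>
      define c where "c = q - q$2 *\<^sub>R axis 2 1"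
      have y: "0 \<le> q$2" using q by auto
      have "norm q - norm c \<le> norm (q - c)" by (rule norm_triangle_ineq2)
      also have "norm (q - c) = q$2" using y by (simp add: c_def)
      finally have "5 \<le> norm c" using 3 by simp
      then have far: "x \<in> \<Omega> \<epsilon>" "norm x \<le> 12" if "x \<in> cball c 1" for x
      proof -
        have "norm (c - x) \<le> 1" using that by (simp add: dist_norm)
        then have "4 \<le> norm x" using norm_triangle_ineq2[of c x] \<open>5 \<le> norm c\<close> by linarith
        then show "x \<in> \<Omega> \<epsilon>" using eps by (intro exterior_domain_norm) auto
        have "norm c \<le> norm q + norm (c - q)" by (metis norm_triangle_sub add.commute)
        also have "norm (c - q) = q$2" using y by (simp add: c_def)
        finally show "norm x \<le> 12"
          using 3 \<open>norm (c - x) \<le> 1\<close> norm_triangle_ineq2[of x c] by (simp add: norm_minus_commute)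
      qed
      have "v (c + q$2 *\<^sub>R axis 2 1) \<le> 5 * M * q$2"
      proof (rule odd_harmonic_linear_bound)
        show "continuous_on (cball c 1 \<inter> {x. c$2 \<le> x$2}) v"
          by (rule continuous_on_subset[OF cv]) (use far(1) closure_subset in blast)
        show "v x \<le> 0" if "x \<in> cball c 1" "x$2 = c$2" for x
          using v(2) that by (simp add: axial_odd_def c_def)
        show "v x \<le> M" if "x \<in> cball c 1" for x
          using M(1) far[OF that] closure_subset by blast
      qed (use far vlap y 3 M(2) in auto)
      then show ?thesis using Bq \<open>0 < \<delta>\<close> by (simp add: c_def)
    next
      case 4
      then have "M \<le> M * q$2" using M(2) by simp
      moreover have "v q \<le> M" using M(1) q by auto
      moreover have "M * q$2 \<le> 5 * M * q$2" using nn by simp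
      ultimately have "v q \<le> B q" using Bq \<open>0 < \<delta>\<close> by linarith
      then show ?thesis by blast
    next
      case 5
      have "has_lap (\<lambda>q. q$2 * (f (?s q) + (q$1)^2 * 0)) q
        (q$2 * (2 * 0 + 4 * ?s q * (45/2 * M * ?s q powr (-5/2)) + 8 * (- 15 * M * ?s q powr (-3/2)) + (q$1)^2 * (4 * ?s q * 0 + 8 * 0)))"
        by (rule has_lap_axial[where lo=0 and g="\<lambda>_. 0" and g'="\<lambda>_. 0"]) (use f sq in auto)
      moreover have pw: "?s q * ?s q powr (-5/2) = ?s q powr (-3/2)" using sq by (simp add: powr_mult_base)
      have "y * (2 * 0 + 4 * s * (45/2 * M * a) + 8 * (- 15 * M * b) + x * (4 * s * 0 + 8 * 0)) = y * (- 30 * M * b)"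
        if "s * a = b" for y s a b x :: real
        by (simp add: that[symmetric] algebra_simps)
      note this[OF pw]
      ultimately have "has_lap (\<lambda>q. q$2 * (f (?s q) + (q$1)^2 * 0)) q (q$2 * (- 30 * M * ?s q powr (-3/2)))"
        by metis
      from has_lap_lincomb[OF this has_lap_const[of 1], of 1 \<delta>]
      have "has_lap B q (q$2 * (- 30 * M * ?s q powr (-3/2)))"
        by (simp add: B_def[abs_def])
      moreover have "q$2 * (- 30 * M * ?s q powr (-3/2)) \<le> 0"
      proof -
        have "0 \<le> q$2 * (30 * M * ?s q powr (-3/2))" using 5(1) M(2) by (intro mult_nonneg_nonneg) auto
        then show ?thesis by simp
      qed
      moreover have "q \<in> interior ?K"
        by (rule interiorI[of "(\<Omega> \<epsilon> \<inter> ball 0 6) \<inter> {q. 0 < q$2 \<and> \<eta> < ?s q}"])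
           (use 5 closure_subset in \<open>auto intro!: open_Int open_Collect_conj open_Collect_less continuous_intros\<close>)
      ultimately show ?thesis unfolding barrier_at_def using 5(4) by blast
    next
      case (6 c)
      let ?U = "ball 0 6 \<inter> {q. 0 < q$2 \<and> \<eta> < ?s q}"
      have "open ?U" by (intro open_Int open_ball open_Collect_conj open_Collect_less continuous_intros)
      then have "\<forall>\<^sub>F t in at_right 0. q + t *\<^sub>R (q - c) \<in> \<Omega> \<epsilon> \<inter> ?U"
        using 6 q eps by (intro normal_ray_in) auto
      then have ev: "\<forall>\<^sub>F t in at_right 0. q + t *\<^sub>R (q - c) \<in> ?K"
        by (rule eventually_mono) (use closure_subset in auto)
      have "has_ray_deriv (\<lambda>q. q$2 * (f (?s q) + (q$1)^2 * 0)) q (q - c)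
         (q$2 * (f (?s q) + (q$1)^2 * 0 + 2 * q$1 * (q$1 - c$1) * 0 + 2 * ?s q * (- 15 * M * ?s q powr (-3/2) + (q$1)^2 * 0)))"
        by (rule has_ray_deriv_axial[where g="\<lambda>_. 0"]) (use f sq 6 in auto)
      moreover have "has_ray_deriv (\<lambda>_. 1) q (q - c) 0" by (simp add: has_ray_deriv_def)
      ultimately have "has_ray_deriv B q (q - c) (1 * (q$2 * (f (?s q) + (q$1)^2 * 0 + 2 * q$1 * (q$1 - c$1) * 0 + 2 * ?s q * (- 15 * M * ?s q powr (-3/2) + (q$1)^2 * 0))) + \<delta> * 0)"
        unfolding B_def by (rule has_ray_deriv_lincomb)
      moreover have pw: "?s q * ?s q powr (-3/2) = ?s q powr (-1/2)" using sq by (simp add: powr_mult_base)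
      have "1 * (y * (30 * M * b + x * 0 + 2 * z * k * 0 + 2 * s * (- 15 * M * a + x * 0))) + \<delta> * 0 = 0"
        if "s * a = b" for y s a b x z k :: real
        by (simp add: that[symmetric] algebra_simps)
      note this[OF pw]
      ultimately have "has_ray_deriv B q (q - c) 0" unfolding f_def by metis
      then show ?thesis unfolding barrier_at_def using ev 6 by blast
    qed
  qed
  then show "v p \<le> 30 * M * (p$2 * ?s p powr (-1/2)) + \<delta>" by (simp add: B_def f_def mult_ac)
qed

section \<open>The barrier in the neck\<close>

definition neck_exponent :: real where "neck_exponent = (2 - sqrt 2) / 2"

text \<open>At \<epsilon> = 0 the function \<open>y * r powr (- 2 * \<gamma>)\<close> equals
  \<open>r powr m\<close> times the cosine of the angle, with \<open>m = 1 - 2 * \<gamma>\<close>,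
  and div(r^2 grad w) = 0 becomes \<open>m^2 + 2 * m - 1 = 0\<close>. The positive root
  \<open>m = sqrt 2 - 1\<close> gives this exponent, and rewriting the equation in \<gamma> gives
  the quadratic. The numerical bracket is for the estimates of products in
  \<open>barrier_algebra\<close>.\<close>

lemma neck_exponent:
  "2 * neck_exponent^2 - 4 * neck_exponent + 1 = 0" "29/100 < neck_exponent" "neck_exponent < 3/10"
proof -
  show "2 * neck_exponent^2 - 4 * neck_exponent + 1 = 0"
    by (simp add: neck_exponent_def power2_eq_square field_simps)
  have "sqrt 2 < sqrt ((142/100)^2)" by (intro real_sqrt_less_mono) (simp add: power2_eq_square)
  then show "29/100 < neck_exponent" by (simp add: neck_exponent_def)
  have "sqrt ((140/100)^2) < sqrt 2" by (intro real_sqrt_less_mono) (simp add: power2_eq_square)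
  then show "neck_exponent < 3/10" by (simp add: neck_exponent_def)
qed

abbreviation "\<gamma> \<equiv> neck_exponent"

text \<open>Here \<open>D = E + s\<close> with \<open>E = (1 + \<epsilon>/2)^2 - 1\<close>, and \<open>P = D powr (- \<gamma>)\<close>. On the right sphere
  \<open>2 * x * (1 + \<epsilon>/2 - x) = D - x^2\<close>, so the normal derivative dictates \<open>g \<approx> (f + 2 * s * f') / D\<close>;
  the \<open>- 1\<close> in \<open>f\<close> gives the slack that absorbs the terms of relative order \<open>D\<close>.\<close>

lemma barrier_algebra:
  fixes P D E x2 s f f' f'' g g' g'' :: real
  assumes D: "0 < D" "D \<le> 1/900" and E: "0 \<le> E" "E \<le> D" and P: "2 \<le> P" "30 * (P * D) \<le> 1"
    and x2: "0 \<le> x2" "x2 \<le> D^2" and s: "s = D - E"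
    and f: "f = P - 1" "f' = - \<gamma> * (P / D)" "f'' = \<gamma> * (\<gamma> + 1) * (P / D^2)"
    and g: "g = (1 - 2*\<gamma>) * (P / D) + 2*\<gamma>*E * (P / D^2) - 1/2 * (1 / D)"
      "g' = - (1 - 2*\<gamma>) * (\<gamma>+1) * (P / D^2) - 2*\<gamma>*(\<gamma>+2)*E * (P / D^3) + 1/2 * (1 / D^2)"
      "g'' = (1 - 2*\<gamma>) * (\<gamma>+1) * (\<gamma>+2) * (P / D^3) + 2*\<gamma>*(\<gamma>+2)*(\<gamma>+3)*E * (P / D^4) - 1 / D^3"
  shows "2 * g + 4 * s * f'' + 8 * f' + x2 * (4 * s * g'' + 8 * g') \<le> 0"
    and "f + x2 * g + (x2 - D) * g + 2 * s * (f' + x2 * g') \<le> 0"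
    and "0 \<le> g" and "1 \<le> f"
proof -
  note \<gamma> = neck_exponent
  \<comment> \<open>With \<open>e\<close> in the unit interval, multiplication by suitable powers of
    \<open>D\<close> makes every term a combination of \<open>P\<close>, \<open>e * P\<close> and
    constants.\<close>
  define e where "e = E / D"
  have e: "0 \<le> e" "e \<le> 1" "E = e * D" "s = D * (1 - e)"
    using D E s by (auto simp: e_def field_simps)
  define k1 where "k1 = (1 - 2*\<gamma>) * (\<gamma>+1)"
  define k2 where "k2 = (1 - 2*\<gamma>) * (\<gamma>+1) * (\<gamma>+2)"
  define k3 where "k3 = 2*\<gamma>*(\<gamma>+2)*(\<gamma>+3)"
  define k4 where "k4 = 2*\<gamma>*(\<gamma>+2)"
  have k1: "1/2 \<le> k1" "k1 \<le> 1"
  proof -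
    have "(4/10) * (129/100) \<le> k1" unfolding k1_def using \<gamma> by (intro mult_mono) auto
    then show "1/2 \<le> k1" by simp
    have "k1 \<le> (42/100) * (13/10)" unfolding k1_def using \<gamma> by (intro mult_mono) auto
    then show "k1 \<le> 1" by simp
  qed
  have k2: "0 \<le> k2" "k2 \<le> 13/10"
  proof -
    show "0 \<le> k2" unfolding k2_def using \<gamma> by (intro mult_nonneg_nonneg) auto
    have "k2 \<le> ((42/100) * (13/10)) * (23/10)" unfolding k2_def using \<gamma> by (intro mult_mono) auto
    then show "k2 \<le> 13/10" by simp
  qed
  have k3: "0 \<le> k3" "k3 \<le> 47/10"
  proof -
    show "0 \<le> k3" unfolding k3_def using \<gamma> by (intro mult_nonneg_nonneg) auto
    have "k3 \<le> ((2*(3/10)) * (23/10)) * (33/10)" unfolding k3_def using \<gamma> by (intro mult_mono) auto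
    then show "k3 \<le> 47/10" by simp
  qed
  have k4: "0 \<le> k4" unfolding k4_def using \<gamma> by (intro mult_nonneg_nonneg) auto
  have g_e: "D * g = (1 - 2*\<gamma>) * P + 2*\<gamma>*e*P - 1/2"
    "D^2 * g' = - k1 * P - k4 * e * P + 1/2"
    "D^3 * g'' = k2 * P + k3 * e * P - 1"
    unfolding g k1_def k2_def k3_def k4_def e(3) using D(1)
    by (simp_all add: field_simps power2_eq_square power3_eq_cube power4_eq_xxxx)
  have f_e: "D * f' = - \<gamma> * P" "D^2 * f'' = \<gamma> * (\<gamma> + 1) * P"
    unfolding f using D(1) by (simp_all add: field_simps)
  have eP: "0 \<le> e * P" "e * P \<le> P" using e P by (auto intro: mult_nonneg_nonneg mult_left_le_one_le)
  have "g' \<le> 0"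
  proof -
    have "1/2 * 2 \<le> k1 * P" using k1 P by (intro mult_mono) auto
    moreover have "0 \<le> k4 * (e * P)" using k4 eP by simp
    ultimately have "D^2 * g' \<le> 0" unfolding g_e by (simp add: mult.assoc)
    then show ?thesis using D(1) by (simp add: mult_le_0_iff)
  qed
  have dg: "1/10 \<le> D * g" "D * g \<le> P - 1/2"
  proof -
    have "(4/10) * 2 \<le> (1 - 2*\<gamma>) * P" using \<gamma> P by (intro mult_mono) auto
    moreover have "0 \<le> 2*\<gamma>*(e*P)" using \<gamma> eP by auto
    moreover have "2*\<gamma>*e*P = 2*\<gamma>*(e*P)" by simp
    ultimately show "1/10 \<le> D * g" unfolding g_e by linarith
    have "2*\<gamma>*(e*P) \<le> 2*\<gamma>*P" using \<gamma> eP by (intro mult_left_mono) auto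
    then show "D * g \<le> P - 1/2" unfolding g_e by (simp add: algebra_simps)
  qed
  then have "0 < D * g" by simp
  then show g0: "0 \<le> g" using D(1) by (simp add: zero_less_mult_iff)
  show "1 \<le> f" using P by (simp add: f)
  show "f + x2 * g + (x2 - D) * g + 2 * s * (f' + x2 * g') \<le> 0"
  proof -
    have "2 * s * f' = 2 * (1 - e) * (D * f')" by (simp add: e)
    \<comment> \<open>The \<open>- 1\<close> of \<open>f\<close> is split: half of it went into
      \<open>g\<close> as the term with \<open>1/2\<close>, the other half stays here as slack
      against the terms with \<open>x2\<close>.\<close>
    then have 1: "f + 2 * s * f' = D * g - 1/2" unfolding f_e g_e f(1) by (simp add: algebra_simps)
    have 2: "2 * s * (x2 * g') \<le> 0"
      using s E x2(1) \<open>g' \<le> 0\<close> by (intro mult_nonneg_nonpos) auto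
    have "x2 * g \<le> D^2 * g" using x2 g0 by (intro mult_right_mono) auto
    also have "D^2 * g = D * (D * g)" by (simp add: power2_eq_square)
    also have "\<dots> \<le> D * P" using dg D(1) by (intro mult_left_mono) auto
    finally have 3: "x2 * g \<le> 1/30" using P(2) by (simp add: mult.commute)
    have "f + x2 * g + (x2 - D) * g + 2 * s * (f' + x2 * g') =
       (f + 2 * s * f') + 2 * (x2 * g) - D * g + 2 * s * (x2 * g')" by (simp add: algebra_simps)
    then show ?thesis using 1 2 3 by linarith
  qed
  show "2 * g + 4 * s * f'' + 8 * f' + x2 * (4 * s * g'' + 8 * g') \<le> 0"
  proof -
    \<comment> \<open>The equation for \<gamma> removes the multiple of \<open>P\<close>. What is
      left is a term of good sign and the slack \<open>- 1\<close>.\<close>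
    have main: "D * (2 * g + 4 * s * f'' + 8 * f') = - 4 * \<gamma>^2 * (e * P) - 1"
    proof -
      have "D * (2 * g + 4 * s * f'' + 8 * f') = 2 * (D * g) + 4 * (1 - e) * (D^2 * f'') + 8 * (D * f')"
        by (simp add: e algebra_simps power2_eq_square)
      also have "\<dots> = 2 * (2 * \<gamma>^2 - 4 * \<gamma> + 1) * P - 4 * \<gamma>^2 * (e * P) - 1"
        unfolding f_e g_e by (simp add: algebra_simps power2_eq_square)
      finally show ?thesis by (simp add: \<gamma>(1))
    qed
    \<comment> \<open>The only term that can have the wrong sign. The constant is
      \<open>24 = 4 * (13/10 + 47/10)\<close>, and \<open>30 * (P * D) \<le> 1\<close> keeps it
      below the slack.\<close>
    have r: "D * (x2 * (4 * s * g'')) \<le> 24 * (P * D)"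
    proof (cases "g'' \<le> 0")
      case True
      then have "x2 * (4 * s * g'') \<le> 0" using x2 s E by (intro mult_nonneg_nonpos) auto
      then have "D * (x2 * (4 * s * g'')) \<le> 0" by (rule mult_nonneg_nonpos[OF less_imp_le[OF D(1)]])
      moreover have "0 \<le> 24 * (P * D)" using P D by auto
      ultimately show ?thesis by linarith
    next
      case False
      have kk: "D^3 * g'' \<le> 6 * P"
      proof -
        have "k2 * P \<le> 13/10 * P" using k2 P by (intro mult_right_mono) auto
        moreover have "k3 * (e * P) \<le> 47/10 * P" using k3 eP by (intro mult_mono) auto
        ultimately show ?thesis unfolding g_e by (simp add: mult.assoc)
      qed
      have "x2 * (4 * s * g'') \<le> D^2 * (4 * D * g'')"
        using x2 False s E D by (intro mult_mono) auto
      also have "\<dots> = 4 * (D^3 * g'')" by (simp add: power2_eq_square power3_eq_cube)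
      also have "\<dots> \<le> 24 * P" using kk by linarith
      finally have "D * (x2 * (4 * s * g'')) \<le> D * (24 * P)" using D by (intro mult_left_mono) auto
      then show ?thesis by (simp add: mult_ac)
    qed
    have "x2 * (8 * g') \<le> 0" using x2 \<open>g' \<le> 0\<close> by (intro mult_nonneg_nonpos) auto
    then have r2: "D * (x2 * (8 * g')) \<le> 0" by (rule mult_nonneg_nonpos[OF less_imp_le[OF D(1)]])
    have "0 \<le> 4 * \<gamma>^2 * (e * P)" using eP by simp
    moreover have "D * (2 * g + 4 * s * f'' + 8 * f' + x2 * (4 * s * g'' + 8 * g')) =
        D * (2 * g + 4 * s * f'' + 8 * f') + D * (x2 * (4 * s * g'')) + D * (x2 * (8 * g'))"
      by (simp add: algebra_simps)
    ultimately have "D * (2 * g + 4 * s * f'' + 8 * f' + x2 * (4 * s * g'' + 8 * g')) \<le> 0"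
      using main r r2 P(2) by linarith
    then show ?thesis using D(1) by (simp add: mult_le_0_iff)
  qed
qed

text \<open>\<gamma> lies between 1/4 and 1/2. The lower end gives
  \<open>D powr (-\<gamma>) \<ge> 16 powr (1/4) = 2\<close>; the upper end gives
  \<open>D powr (1 - \<gamma>) \<le> sqrt D \<le> 1/30\<close>, which is why \<open>D\<close> is
  kept below \<open>1/900\<close>.\<close>

lemma neck_powr:
  assumes D: "0 < D" "D \<le> 1/900"
  shows "2 \<le> D powr (-\<gamma>)" "30 * (D powr (-\<gamma>) * D) \<le> 1"
proof -
  have "(1/16) powr (-1/4) = (2::real)"
  proof -
    have "(1/16::real) = 2 powr (-4)" by (simp add: powr_minus_divide)
    then show ?thesis by (simp only: powr_powr) simp
  qed
  moreover have "(1/16) powr (-1/4) \<le> D powr (-1/4)" using D by (intro powr_mono2') auto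
  moreover have "D powr (-1/4) \<le> D powr (-\<gamma>)" using D neck_exponent by (intro powr_mono') auto
  ultimately show "2 \<le> D powr (-\<gamma>)" by linarith
  have "D powr (-\<gamma>) * D = D powr (1 - \<gamma>)" using D(1) by (simp add: powr_mult_base mult.commute)
  also have "\<dots> \<le> D powr (1/2)" using D neck_exponent by (intro powr_mono') auto
  also have "\<dots> = sqrt D" using D(1) by (simp add: powr_half_sqrt)
  also have "sqrt D \<le> 1/30" using D by (intro real_le_lsqrt) (auto simp: power2_eq_square)
  finally show "30 * (D powr (-\<gamma>) * D) \<le> 1" by simp
qed

text \<open>With \<open>a = 1 + \<epsilon>/2\<close> and \<open>x = \<bar>p$1\<bar>\<close>, lying
  outside the nearer ball means \<open>x * (2 * a - x) \<le> a^2 - 1 + s\<close>, and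
  \<open>2 * a - x \<ge> 1\<close> between the centres. This supplies the hypothesis
  \<open>x2 \<le> D^2\<close> of \<open>barrier_algebra\<close>.\<close>

lemma neck_width:
  assumes p: "p \<in> closure (\<Omega> \<epsilon>)" "\<bar>p$1\<bar> \<le> 1 + \<epsilon>/2" and "0 < \<epsilon>"
  shows "\<bar>p$1\<bar> \<le> (\<epsilon> + \<epsilon>^2/4) + ((p$2)^2 + (p$3)^2)"
proof -
  define a where "a = 1 + \<epsilon>/2"
  define s where "s = (p$2)^2 + (p$3)^2"
  define x where "x = \<bar>p$1\<bar>"
  have "1 \<le> (x - a)^2 + s"
    using p(1) \<open>0 < \<epsilon>\<close> unfolding closure_exterior_domain_coords[OF \<open>0 < \<epsilon>\<close>] x_def a_def s_def
    by (cases "0 \<le> p$1") (auto simp: power2_commute[of "- (p$1)"] power2_eq_square algebra_simps)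
  then have 1: "x * (2 * a - x) \<le> a^2 - 1 + s" by (simp add: power2_eq_square algebra_simps)
  have "x * 1 \<le> x * (2 * a - x)" using p(2) \<open>0 < \<epsilon>\<close> by (intro mult_left_mono) (auto simp: x_def a_def)
  moreover have "a^2 - 1 = \<epsilon> + \<epsilon>^2/4" by (simp add: a_def power2_eq_square algebra_simps)
  ultimately show ?thesis using 1 by (simp add: x_def s_def)
qed

text \<open>\<open>neck_f\<close>, \<open>neck_g\<close> and their derivatives are the functions of
  \<open>barrier_algebra\<close> with \<open>D = E + s\<close>. For \<open>E > 0\<close> they are
  smooth at \<open>s = 0\<close>, so in the neck no tube around the axis has to be removed.\<close>

definition neck_f :: "real \<Rightarrow> real \<Rightarrow> real" where
  "neck_f E s = (E + s) powr (-\<gamma>) - 1"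

definition neck_g :: "real \<Rightarrow> real \<Rightarrow> real" where
  "neck_g E s = (1 - 2*\<gamma>) * (E + s) powr (-\<gamma> - 1) + 2*\<gamma>*E * (E + s) powr (-\<gamma> - 2) - 1/2 * (E + s) powr (-1)"

definition neck_f' :: "real \<Rightarrow> real \<Rightarrow> real" where
  "neck_f' E s = - \<gamma> * (E + s) powr (-\<gamma> - 1)"

definition neck_f'' :: "real \<Rightarrow> real \<Rightarrow> real" where
  "neck_f'' E s = \<gamma> * (\<gamma> + 1) * (E + s) powr (-\<gamma> - 2)"

definition neck_g' :: "real \<Rightarrow> real \<Rightarrow> real" where
  "neck_g' E s = - (1 - 2*\<gamma>) * (\<gamma>+1) * (E + s) powr (-\<gamma> - 2) - 2*\<gamma>*(\<gamma>+2)*E * (E + s) powr (-\<gamma> - 3)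
     + 1/2 * (E + s) powr (-2)"

definition neck_g'' :: "real \<Rightarrow> real \<Rightarrow> real" where
  "neck_g'' E s = (1 - 2*\<gamma>) * (\<gamma>+1) * (\<gamma>+2) * (E + s) powr (-\<gamma> - 3)
     + 2*\<gamma>*(\<gamma>+2)*(\<gamma>+3)*E * (E + s) powr (-\<gamma> - 4) - (E + s) powr (-3)"

lemma neck_powr_div:
  assumes "0 < (D::real)"
  shows "D powr (-\<gamma> - 1) = D powr (-\<gamma>) / D" "D powr (-\<gamma> - 2) = D powr (-\<gamma>) / D^2"
    "D powr (-\<gamma> - 3) = D powr (-\<gamma>) / D^3" "D powr (-\<gamma> - 4) = D powr (-\<gamma>) / D^4"
    "D powr (-1) = 1 / D" "D powr (-2) = 1 / D^2" "D powr (-3) = 1 / D^3"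
  using assms by (simp_all add: powr_diff powr_minus_divide)

lemma neck_derivs:
  assumes s: "0 < E + s"
  shows "(neck_f E has_real_derivative neck_f' E s) (at s)" "(neck_f' E has_real_derivative neck_f'' E s) (at s)"
    "(neck_g E has_real_derivative neck_g' E s) (at s)" "(neck_g' E has_real_derivative neck_g'' E s) (at s)"
proof -
  have d: "((\<lambda>s. (E + s) powr b) has_real_derivative b * (E + s) powr (b - 1)) (at s)" for b
    using s by (auto intro!: derivative_eq_intros)
  have e: "-\<gamma> - 1 - 1 = -\<gamma> - 2" "-\<gamma> - 2 - 1 = -\<gamma> - 3" "-\<gamma> - 3 - 1 = -\<gamma> - 4" "-1 - 1 = (-2::real)" "-2 - 1 = (-3::real)"
    by simp_all
  note neck_defs = neck_f_def[abs_def] neck_f'_def[abs_def] neck_f''_def neck_g_def[abs_def] neck_g'_def[abs_def] neck_g''_def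
  show "(neck_f E has_real_derivative neck_f' E s) (at s)" unfolding neck_defs
    by (rule DERIV_cong[OF DERIV_diff[OF d DERIV_const]]) simp
  show "(neck_f' E has_real_derivative neck_f'' E s) (at s)" unfolding neck_defs
    by (rule DERIV_cong[OF DERIV_cmult[OF d]]) (simp only: e, simp add: algebra_simps)
  show "(neck_g E has_real_derivative neck_g' E s) (at s)" unfolding neck_defs
    by (rule DERIV_cong[OF DERIV_diff[OF DERIV_add[OF DERIV_cmult[OF d] DERIV_cmult[OF d]] DERIV_cmult[OF d]]])
       (simp only: e, simp add: algebra_simps)
  show "(neck_g' E has_real_derivative neck_g'' E s) (at s)" unfolding neck_defs
    by (rule DERIV_cong[OF DERIV_add[OF DERIV_diff[OF DERIV_cmult[OF d] DERIV_cmult[OF d]] DERIV_cmult[OF d]]])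
       (simp only: e, simp add: algebra_simps)
qed

lemma neck_signs:
  fixes E s x2 :: real
  assumes D: "0 < E + s" "E + s \<le> 1/900" and E: "0 \<le> E" "0 \<le> s" and x2: "0 \<le> x2" "x2 \<le> (E + s)^2"
  shows "2 * neck_g E s + 4 * s * neck_f'' E s + 8 * neck_f' E s + x2 * (4 * s * neck_g'' E s + 8 * neck_g' E s) \<le> 0"
    "neck_f E s + x2 * neck_g E s + (x2 - (E + s)) * neck_g E s + 2 * s * (neck_f' E s + x2 * neck_g' E s) \<le> 0"
    "0 \<le> neck_g E s" "1 \<le> neck_f E s"
proof -
  have "E \<le> E + s" using E by simp
  note A = barrier_algebra[OF D E(1) this neck_powr[OF D] x2, of s "neck_f E s" "neck_f' E s" "neck_f'' E s"
      "neck_g E s" "neck_g' E s" "neck_g'' E s"]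
  show "2 * neck_g E s + 4 * s * neck_f'' E s + 8 * neck_f' E s + x2 * (4 * s * neck_g'' E s + 8 * neck_g' E s) \<le> 0"
    "neck_f E s + x2 * neck_g E s + (x2 - (E + s)) * neck_g E s + 2 * s * (neck_f' E s + x2 * neck_g' E s) \<le> 0"
    "0 \<le> neck_g E s" "1 \<le> neck_f E s"
    by (rule A; simp only: neck_f_def neck_f'_def neck_f''_def neck_g_def neck_g'_def neck_g''_def
        neck_powr_div[OF D(1)] add_diff_cancel_left')+
qed

text \<open>Comparison in the half neck \<open>y \<ge> 0\<close>. Both sides vanish for
  \<open>y = 0\<close>; on the spheres and inside, \<open>neck_signs\<close> makes the right-hand
  side a barrier; on the rim the angular bound applies, and there \<open>neck_f \<ge> 1\<close> and
  \<open>neck_g \<ge> 0\<close> ensure that the barrier is at least a multiple of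
  \<open>y\<close>.\<close>

lemma neck_bound:
  assumes v: "neumann_harmonic \<epsilon> v" "axial_odd v" and eps: "0 < \<epsilon>" "\<epsilon> \<le> 1/8000"
    and M: "\<And>p. p \<in> closure (\<Omega> \<epsilon>) \<Longrightarrow> norm p \<le> 12 \<Longrightarrow> v p \<le> M" "0 < M"
    and E: "E = \<epsilon> + \<epsilon>^2/4"
    and p: "p \<in> closure (\<Omega> \<epsilon>)" "\<bar>p$1\<bar> \<le> 1 + \<epsilon>/2" "0 \<le> p$2" "(p$2)^2 + (p$3)^2 \<le> 1/2000"
  shows "v p \<le> 1350 * M * (p$2 * (neck_f E ((p$2)^2 + (p$3)^2) + (p$1)^2 * neck_g E ((p$2)^2 + (p$3)^2)))"
proof -
  let ?X = "closure (\<Omega> \<epsilon>)"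
  let ?s = "\<lambda>q::real^3. (q$2)^2 + (q$3)^2"
  define B0 where "B0 q = q$2 * (neck_f E (?s q) + (q$1)^2 * neck_g E (?s q))" for q
  \<comment> \<open>The summand \<open>0 * 1\<close> puts \<open>B\<close> into the form of
    \<open>has_lap_lincomb\<close> and \<open>has_ray_deriv_lincomb\<close>.\<close>
  define B where "B q = 1350 * M * B0 q + 0 * 1" for q
  \<comment> \<open>Together with \<open>s \<le> 1/2000\<close> this keeps \<open>E + s\<close>
    below the \<open>1/900\<close> of \<open>neck_signs\<close>.\<close>
  have E0: "0 < E" "E \<le> 1/2000"
  proof -
    have "0 \<le> \<epsilon> * (1 - \<epsilon>)" using eps by (intro mult_nonneg_nonneg) auto
    then have "\<epsilon>^2 \<le> \<epsilon>" by (simp add: power2_eq_square algebra_simps)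
    then show "E \<le> 1/2000" using eps by (simp add: E)
    show "0 < E" using eps by (simp add: E add_pos_nonneg)
  qed
  let ?K = "?X \<inter> {q. -(1 + \<epsilon>/2) \<le> q$1 \<and> q$1 \<le> 1 + \<epsilon>/2 \<and> 0 \<le> q$2 \<and> ?s q \<le> 1/2000}"
  have n6: "norm q \<le> 6" if "q \<in> ?K" for q
  proof -
    have "\<bar>q$1\<bar> \<le> 2" using that eps by (auto simp: abs_le_iff)
    then have "\<bar>q$1\<bar>^2 \<le> 2^2" by (intro power_mono) auto
    then have "(norm q)^2 \<le> 6^2" using that unfolding norm3_sq by auto
    then show ?thesis by (rule power2_le_imp_le) simp
  qed
  have F: "2 * neck_g E (?s q) + 4 * ?s q * neck_f'' E (?s q) + 8 * neck_f' E (?s q) +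
        (q$1)^2 * (4 * ?s q * neck_g'' E (?s q) + 8 * neck_g' E (?s q)) \<le> 0"
      "neck_f E (?s q) + (q$1)^2 * neck_g E (?s q) + ((q$1)^2 - (E + ?s q)) * neck_g E (?s q) +
        2 * ?s q * (neck_f' E (?s q) + (q$1)^2 * neck_g' E (?s q)) \<le> 0"
      "0 \<le> neck_g E (?s q)" "1 \<le> neck_f E (?s q)" if q: "q \<in> ?K" for q
  proof -
    have s0: "0 \<le> ?s q" "?s q \<le> 1/2000" using q by auto
    have D: "0 < E + ?s q" "E + ?s q \<le> 1/900" using add_pos_nonneg[OF E0(1) s0(1)] s0(2) E0(2) by auto
    have "\<bar>q$1\<bar> \<le> E + ?s q" using neck_width[of q \<epsilon>] q eps by (auto simp: E abs_le_iff)
    then have "\<bar>q$1\<bar> ^ 2 \<le> (E + ?s q)^2" by (intro power_mono) auto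
    then have "(q$1)^2 \<le> (E + ?s q)^2" by simp
    note A = neck_signs[OF D less_imp_le[OF E0(1)] s0(1) zero_le_power2 this]
    show "2 * neck_g E (?s q) + 4 * ?s q * neck_f'' E (?s q) + 8 * neck_f' E (?s q) +
        (q$1)^2 * (4 * ?s q * neck_g'' E (?s q) + 8 * neck_g' E (?s q)) \<le> 0"
      "neck_f E (?s q) + (q$1)^2 * neck_g E (?s q) + ((q$1)^2 - (E + ?s q)) * neck_g E (?s q) +
        2 * ?s q * (neck_f' E (?s q) + (q$1)^2 * neck_g' E (?s q)) \<le> 0"
      "0 \<le> neck_g E (?s q)" "1 \<le> neck_f E (?s q)" by (rule A)+
  qed
  have "v p \<le> B p"
  proof (rule neumann_comparison[OF v(1) eps(1), of ?K])
    show "\<epsilon> < 1" using eps by simp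
    have cl: "closed {q::real^3. -(1 + \<epsilon>/2) \<le> q$1 \<and> q$1 \<le> 1 + \<epsilon>/2 \<and> 0 \<le> q$2 \<and> ?s q \<le> 1/2000}"
      by (intro closed_Collect_conj closed_Collect_le continuous_intros)
    have sub: "?K \<subseteq> cball 0 6"
    proof
      fix q assume "q \<in> ?K"
      from n6[OF this] show "q \<in> cball 0 6" by simp
    qed
    have "closed ?K" by (rule closed_Int[OF closed_closure cl])
    then show "compact ?K"
      unfolding compact_eq_bounded_closed using bounded_subset[OF bounded_cball sub] by blast
    have "cball 0 6 \<subseteq> cball (0::real^3) 12" by (rule subset_cball) simp
    with sub show "?K \<subseteq> ?X \<inter> cball 0 12" by blast
    have D1: "E + ?s q \<noteq> 0" for q :: "real^3"
      using add_pos_nonneg[OF E0(1) sum_power2_ge_zero] by (metis less_irrefl)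
    have "continuous_on UNIV B" unfolding B_def[abs_def] B0_def[abs_def] neck_f_def neck_g_def
      by (intro continuous_intros ballI D1)
    then show "continuous_on ?K B" by (rule continuous_on_subset) simp
    show "p \<in> ?K" using p by auto
    fix q assume q: "q \<in> ?K"
    note F = F[OF q]
    have s0: "0 \<le> ?s q" by simp
    have D0: "0 < E + ?s q" using E0 by (simp add: add_pos_nonneg)
    have B0q: "q$2 \<le> B0 q"
    proof -
      have "q$2 * 1 \<le> B0 q" unfolding B0_def
        using F(3,4) q by (intro mult_left_mono) (auto intro: add_increasing2)
      then show ?thesis by simp
    qed
    have np: "1350 * M * (y * Q) + 0 * 0 \<le> 0" if "0 < y" "Q \<le> 0" for y Q :: real
      using mult_nonneg_nonpos[of "1350 * M * y" Q] that M(2) by simp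
    have lo: "- E < s \<longleftrightarrow> 0 < E + s" for s by auto
    have split: "q \<in> \<Omega> \<epsilon> \<or> (\<exists>c\<in>{center1 \<epsilon>, center2 \<epsilon>}. dist c q = 1)"
      using q eps by (force simp: closure_exterior_domain_iff exterior_domain_iff)
    \<comment> \<open>The planes through the centres contribute no boundary: points of
      \<open>K\<close> are squeezed between the spheres, far away from them.\<close>
    have "\<bar>q$1\<bar> \<le> 1/900"
      using neck_width[of q \<epsilon>] q eps E0 by (auto simp: E abs_le_iff)
    then have x1: "-(1 + \<epsilon>/2) < q$1" "q$1 < 1 + \<epsilon>/2" using eps by (auto simp: abs_le_iff)
    have "0 < q$2 \<or> q$2 = 0" "?s q = 1/2000 \<or> ?s q < 1/2000" using q by auto
    with split consider "q$2 = 0" | "0 < q$2" "?s q = 1/2000" | "0 < q$2" "?s q < 1/2000" "q \<in> \<Omega> \<epsilon>"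
      | c where "0 < q$2" "?s q < 1/2000" "c \<in> {center1 \<epsilon>, center2 \<epsilon>}" "dist c q = 1"
      by blast
    then show "v q \<le> B q \<or> barrier_at \<epsilon> ?K B q"
    proof cases
      case 1
      then have "v q = 0" using v(2) by (simp add: axial_odd_def)
      then show ?thesis using 1 by (simp add: B_def B0_def)
    next
      case 2
      \<comment> \<open>\<open>2025 = 45^2\<close> is the next convenient square above 2000; hence
        \<open>1350 = 30 * 45\<close>.\<close>
      have pw: "?s q powr (-1/2) \<le> 45"
      proof -
        have "?s q powr (-1/2) \<le> (1/2025) powr (-1/2)" unfolding 2(2) by (intro powr_mono2') auto
        also have "\<dots> = 45" by (simp add: powr_minus_divide powr_half_sqrt real_sqrt_divide real_sqrt_unique)
        finally show ?thesis .
      qed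
      have "v q \<le> 30 * M * (q$2 * ?s q powr (-1/2))"
      proof (rule angular_bound[OF v eps(1) _ M])
        show "\<epsilon> < 1" "0 < ?s q" using eps 2(2) by auto
      qed (use q n6[OF q] in auto)
      also have "\<dots> \<le> 30 * M * (q$2 * 45)"
        by (rule mult_left_mono[OF mult_left_mono[OF pw]]) (use M(2) 2(1) in auto)
      also have "\<dots> = 1350 * M * q$2" by simp
      also have "\<dots> \<le> 1350 * M * B0 q" using B0q M(2) by (intro mult_left_mono) auto
      finally show ?thesis by (simp add: B_def)
    next
      case 3
      have "has_lap B0 q (q$2 * (2 * neck_g E (?s q) + 4 * ?s q * neck_f'' E (?s q) + 8 * neck_f' E (?s q) +
         (q$1)^2 * (4 * ?s q * neck_g'' E (?s q) + 8 * neck_g' E (?s q))))" (is "has_lap B0 q (q$2 * ?Q)")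
        unfolding B0_def[abs_def]
        by (rule has_lap_axial[where lo="-E"]) (use D0 lo neck_derivs in blast)+
      from has_lap_lincomb[OF this has_lap_const[of 1], of "1350 * M" 0]
      have "has_lap B q (1350 * M * (q$2 * ?Q) + 0 * 0)" by (simp only: B_def[abs_def])
      moreover have "1350 * M * (q$2 * ?Q) + 0 * 0 \<le> 0"
        by (rule np[OF 3(1) F(1)])
      moreover have "q \<in> interior ?K"
      proof (rule interiorI[of "\<Omega> \<epsilon> \<inter> {q. -(1 + \<epsilon>/2) < q$1 \<and> q$1 < 1 + \<epsilon>/2 \<and> 0 < q$2 \<and> ?s q < 1/2000}"])
        show "open (\<Omega> \<epsilon> \<inter> {q::real^3. -(1 + \<epsilon>/2) < q$1 \<and> q$1 < 1 + \<epsilon>/2 \<and> 0 < q$2 \<and> ?s q < 1/2000})"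
          by (intro open_Int open_exterior_domain open_Collect_conj open_Collect_less continuous_intros)
      qed (use 3 x1 closure_subset in auto)
      ultimately show ?thesis unfolding barrier_at_def using 3(3) by blast
    next
      case (4 c)
      let ?U = "{q::real^3. -(1 + \<epsilon>/2) < q$1 \<and> q$1 < 1 + \<epsilon>/2 \<and> 0 < q$2 \<and> ?s q < 1/2000}"
      have "open ?U" by (intro open_Collect_conj open_Collect_less continuous_intros)
      then have "\<forall>\<^sub>F t in at_right 0. q + t *\<^sub>R (q - c) \<in> \<Omega> \<epsilon> \<inter> ?U"
        using 4 q eps x1 by (intro normal_ray_in) auto
      then have ev: "\<forall>\<^sub>F t in at_right 0. q + t *\<^sub>R (q - c) \<in> ?K"
        by (rule eventually_mono) (use closure_subset in auto)
      let ?Q = "neck_f E (?s q) + (q$1)^2 * neck_g E (?s q) + 2 * q$1 * (q$1 - c$1) * neck_g E (?s q) +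
        2 * ?s q * (neck_f' E (?s q) + (q$1)^2 * neck_g' E (?s q))"
      have "has_ray_deriv B0 q (q - c) (q$2 * ?Q)"
        unfolding B0_def[abs_def] by (rule has_ray_deriv_axial[OF neck_derivs(1,3)[OF D0] refl]) (use 4 in auto)
      moreover have "has_ray_deriv (\<lambda>_. 1) q (q - c) 0" by (simp add: has_ray_deriv_def)
      ultimately have "has_ray_deriv B q (q - c) (1350 * M * (q$2 * ?Q) + 0 * 0)"
        unfolding B_def by (rule has_ray_deriv_lincomb)
      \<comment> \<open>The equation of the sphere together with \<open>(c$1)^2 = 1 + E\<close>, for
        either centre; it brings the slope into the form of \<open>neck_signs\<close>.\<close>
      moreover have "2 * q$1 * (q$1 - c$1) = (q$1)^2 - (E + ?s q)"
      proof -
        have "(dist c q)^2 = 1" using 4 by simp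
        moreover have "(c$1)^2 = 1 + E"
          using 4(3) by (auto simp: E power2_eq_square algebra_simps)
        moreover have "(dist c q)^2 = (q$1 - c$1)^2 + ?s q"
          using 4(3) dist_center_sq[of \<epsilon> q] by (auto simp: algebra_simps)
        ultimately show ?thesis by (simp add: power2_eq_square algebra_simps)
      qed
      then have "?Q \<le> 0" using F(2) by (simp only:)
      then have "1350 * M * (q$2 * ?Q) + 0 * 0 \<le> 0"
        by (rule np[OF 4(1)])
      ultimately show ?thesis unfolding barrier_at_def using ev 4 by blast
    qed
  qed
  then show ?thesis by (simp add: B_def B0_def)
qed

text \<open>The odd part with respect to the plane through \<open>p\<close> vanishes at
  \<open>p\<close> and has the same \<open>i\<close>-th partial derivative as \<open>u\<close>. A
  linear bound on the odd part therefore bounds \<open>D $ i\<close>; taking \<sigma> to be 1 or -1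
  gives both signs.\<close>

lemma odd_part_limit:
  fixes u :: "real^3 \<Rightarrow> real"
  assumes D: "(u has_derivative (\<lambda>h. h \<bullet> D)) (at p)"
  shows "((\<lambda>t. (\<sigma>/2 * u (p + t *\<^sub>R axis i 1) + (- \<sigma>/2) * u (reflect i (p$i) (p + t *\<^sub>R axis i 1))) / t) \<longlongrightarrow> \<sigma> * D $ i) (at_right 0)"
proof -
  define w where "w t = \<sigma>/2 * u (p + t *\<^sub>R axis i 1) + (- \<sigma>/2) * u (p + (-t) *\<^sub>R axis i 1)" for t
  have d: "((\<lambda>t. u (p + t *\<^sub>R axis i 1)) has_real_derivative D $ i) (at 0)"
    using has_derivative_line[of u D p 0 "axis i 1"] D by (simp add: inner_axis')
  have d': "((\<lambda>t. u (p + (-t) *\<^sub>R axis i 1)) has_real_derivative - D $ i) (at 0)"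
    using DERIV_chain2[of "\<lambda>t. u (p + t *\<^sub>R axis i 1)" "D $ i" uminus 0 "-1"] d
    by (simp add: DERIV_minus[OF DERIV_ident])
  have "(w has_real_derivative \<sigma> * D $ i) (at 0)"
    unfolding w_def[abs_def] using DERIV_add[OF DERIV_cmult[OF d, of "\<sigma>/2"] DERIV_cmult[OF d', of "- \<sigma>/2"]] by simp
  then have "((\<lambda>t. (w t - w 0) / (t - 0)) \<longlongrightarrow> \<sigma> * D $ i) (at 0)" by (simp only: has_field_derivative_iff)
  moreover have "w 0 = 0" by (simp add: w_def)
  moreover have "reflect i (p$i) (p + t *\<^sub>R axis i 1) = p + (-t) *\<^sub>R axis i 1" for t
    by (auto simp: vec_eq_iff reflect_def axis_def)
  ultimately show ?thesis unfolding w_def by (auto intro: filterlim_mono at_le simp: at_within_le_at)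
qed

text \<open>Dividing \<open>neck_bound\<close> for the odd part in \<open>y\<close> by
  \<open>y\<close> and letting \<open>y\<close> tend to zero leaves the barrier on the axis, where
  both \<open>neck_f\<close> and \<open>x^2 * neck_g\<close> are at most
  \<open>\<epsilon> powr (-\<gamma>)\<close>; so \<open>2700 = 2 * 1350\<close>.\<close>

lemma transversal_derivative_bound:
  assumes u: "neumann_harmonic \<epsilon> u" and eps: "0 < \<epsilon>" "\<epsilon> \<le> 1/8000"
    and M: "\<And>p. p \<in> closure (\<Omega> \<epsilon>) \<Longrightarrow> norm p \<le> 12 \<Longrightarrow> \<bar>u p\<bar> \<le> M" "0 < M"
    and p: "p = vector [x, 0, 0]" "\<bar>x\<bar> < \<epsilon>/2" and D: "(u has_derivative (\<lambda>h. h \<bullet> D)) (at p)"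
  shows "\<bar>D $ 2\<bar> \<le> 2700 * M * \<epsilon> powr (-\<gamma>)"
proof -
  let ?X = "closure (\<Omega> \<epsilon>)"
  define E where "E = \<epsilon> + \<epsilon>^2/4"
  have E: "0 < E" "\<epsilon> \<le> E" using eps by (auto simp: E_def add_pos_nonneg)
  define v where "v q = 1/2 * u q + (-1/2) * u (reflect 2 0 q)" for q
  have v: "neumann_harmonic \<epsilon> v" unfolding v_def[abs_def]
    by (rule neumann_harmonic_lincomb[OF u neumann_harmonic_reflect2[OF u eps(1)]])
  have v': "neumann_harmonic \<epsilon> (\<lambda>q. - v q)" using neumann_harmonic_lincomb[OF v v, of "-1" 0] by simp
  have odd: "axial_odd v"
  proof -
    have "reflect 2 0 q = q" if "q$2 = 0" for q using that by (auto simp: reflect_def vec_eq_iff)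
    then show ?thesis by (simp add: axial_odd_def v_def)
  qed
  then have odd': "axial_odd (\<lambda>q. - v q)" by (simp add: axial_odd_def)
  have refl_X: "reflect 2 0 q \<in> ?X" if "q \<in> ?X" for q
    using that by (simp add: closure_exterior_domain_coords[OF eps(1)] reflect_def)
  have vM: "v q \<le> M" "- v q \<le> M" if "q \<in> ?X" "norm q \<le> 12" for q
  proof -
    have "\<bar>u q\<bar> \<le> M" "\<bar>u (reflect 2 0 q)\<bar> \<le> M"
      using M(1)[OF that] M(1)[OF refl_X[OF that(1)]] that(2) by (auto simp: norm_reflect)
    then show "v q \<le> M" "- v q \<le> M" unfolding v_def by linarith+
  qed
  have pt: "(p + t *\<^sub>R axis 2 1) $ 1 = x" "(p + t *\<^sub>R axis 2 1) $ 2 = t" "(p + t *\<^sub>R axis 2 1) $ 3 = 0" for t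
    by (simp_all add: p(1) vector_3)
  have X: "p + t *\<^sub>R axis 2 1 \<in> ?X" for t
  proof -
    have "1^2 \<le> (1 + \<epsilon>/2 - \<bar>x\<bar>)^2" using p(2) by (intro power_mono) auto
    moreover have "(1 + \<epsilon>/2 - \<bar>x\<bar>)^2 \<le> (x + (1 + \<epsilon>/2))^2" "(1 + \<epsilon>/2 - \<bar>x\<bar>)^2 \<le> (x - (1 + \<epsilon>/2))^2"
      using p(2) eps by (auto simp: abs_le_square_iff[symmetric])
    ultimately show ?thesis
      unfolding closure_exterior_domain_coords[OF eps(1)] pt by (simp add: add_increasing2)
  qed
  define F where "F t = 1350 * M * (neck_f E (t^2) + x^2 * neck_g E (t^2))" for t
  \<comment> \<open>\<open>(1/50)^2 = 1/2500\<close> stays below the rim value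
    \<open>1/2000\<close>.\<close>
  have "\<forall>\<^sub>F t in at_right (0::real). 0 < t \<and> t < 1/50"
    unfolding eventually_at_right_field by (intro exI[of _ "1/50"]) auto
  then have ev: "\<forall>\<^sub>F t in at_right 0. \<bar>v (p + t *\<^sub>R axis 2 1) / t\<bar> \<le> F t"
  proof eventually_elim
    case (elim t)
    let ?q = "p + t *\<^sub>R axis 2 1"
    have "t^2 \<le> (1/50)^2" using elim by (intro power_mono) auto
    then have t2: "(?q$2)^2 + (?q$3)^2 \<le> 1/2000" unfolding pt by (simp add: power2_eq_square)
    have q: "\<bar>?q$1\<bar> \<le> 1 + \<epsilon>/2" "0 \<le> ?q$2" using p(2) elim eps unfolding pt by auto
    have "v ?q \<le> t * F t"
      using neck_bound[OF v odd eps vM(1) M(2) E_def X q t2] unfolding pt F_def by (simp add: mult_ac)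
    moreover have "- v ?q \<le> t * F t"
      using neck_bound[OF v' odd' eps vM(2) M(2) E_def X q t2] unfolding pt F_def by (simp add: mult_ac)
    ultimately have "\<bar>v ?q\<bar> \<le> t * F t" by linarith
    then show ?case using elim by (simp add: abs_divide divide_le_eq mult.commute)
  qed
  have "reflect 2 0 = reflect 2 (p $ 2)" by (simp add: p(1) vector_3)
  then have lim1: "((\<lambda>t. v (p + t *\<^sub>R axis 2 1) / t) \<longlongrightarrow> D $ 2) (at_right 0)"
    using odd_part_limit[OF D, of 1 2] by (simp add: v_def)
  have lim2: "(F \<longlongrightarrow> F 0) (at_right 0)"
  proof -
    have c: "isCont (neck_f E) 0" "isCont (neck_g E) 0"
      using neck_derivs(1,3)[of E 0] E(1) by (auto intro: DERIV_isCont)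
    have sq: "((\<lambda>t::real. t^2) \<longlongrightarrow> 0) (at_right 0)" by (auto intro!: tendsto_eq_intros)
    show ?thesis unfolding F_def[abs_def]
      using isCont_tendsto_compose[OF c(1) sq] isCont_tendsto_compose[OF c(2) sq]
      by (auto intro!: tendsto_eq_intros)
  qed
  have "\<bar>D $ 2\<bar> \<le> F 0"
    by (rule tendsto_le[OF _ lim2 tendsto_rabs[OF lim1] ev]) simp
  also have "F 0 \<le> 1350 * M * (2 * \<epsilon> powr (-\<gamma>))"
  proof -
    define P where "P = E powr (-\<gamma>)"
    have P0: "0 < P" using E(1) by (simp add: P_def)
    have "P \<le> \<epsilon> powr (-\<gamma>)" unfolding P_def
      using E eps neck_exponent by (intro powr_mono2') auto
    moreover have "neck_f E 0 \<le> P" by (simp add: neck_f_def P_def)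
    moreover have "x^2 * neck_g E 0 \<le> P"
    proof -
      \<comment> \<open>At \<open>s = 0\<close> the base \<open>E + s\<close> is \<open>E\<close>,
        so the two terms with \<open>P\<close> add up to \<open>P / E\<close>.\<close>
      have "neck_g E 0 = (P - 1/2) / E"
        unfolding neck_g_def add_0_right neck_powr_div[OF E(1)] P_def[symmetric]
        using E(1) by (simp add: field_simps power2_eq_square)
      also have "\<dots> \<le> P / E" using E(1) by (intro divide_right_mono) auto
      finally have "x^2 * neck_g E 0 \<le> x^2 * (P / E)" by (intro mult_left_mono) auto
      also have "\<dots> \<le> E * (P / E)"
      proof (intro mult_right_mono)
        have "\<bar>x\<bar>^2 \<le> (\<epsilon>/2)^2" using p(2) by (intro power_mono) auto
        then show "x^2 \<le> E" using eps by (simp add: E_def power_divide)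
      qed (use P0 E in auto)
      finally show ?thesis using E(1) by simp
    qed
    ultimately have "neck_f E 0 + x^2 * neck_g E 0 \<le> 2 * \<epsilon> powr (-\<gamma>)" by linarith
    then show ?thesis unfolding F_def using M(2) by (intro mult_left_mono) auto
  qed
  finally show ?thesis by simp
qed

text \<open>\<open>swap23\<close> is a symmetry of the two balls that fixes the axis pointwise and
  exchanges the transversal directions.\<close>

lemma transversal_derivative_bound_3:
  assumes u: "neumann_harmonic \<epsilon> u" and eps: "0 < \<epsilon>" "\<epsilon> \<le> 1/8000"
    and M: "\<And>p. p \<in> closure (\<Omega> \<epsilon>) \<Longrightarrow> norm p \<le> 12 \<Longrightarrow> \<bar>u p\<bar> \<le> M" "0 < M"
    and p: "p = vector [x, 0, 0]" "\<bar>x\<bar> < \<epsilon>/2" and D: "(u has_derivative (\<lambda>h. h \<bullet> D)) (at p)"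
  shows "\<bar>D $ 3\<bar> \<le> 2700 * M * \<epsilon> powr (-\<gamma>)"
proof -
  have sp: "swap23 p = p" by (auto simp: vec_eq_iff forall_3 p(1) vector_3)
  have lin: "linear swap23" by (auto simp: linear_iff vec_eq_iff forall_3)
  have "(swap23 has_derivative swap23) (at p)"
    by (rule linear_imp_has_derivative[OF lin])
  from has_derivative_compose[OF this, of u] D
  have "((\<lambda>q. u (swap23 q)) has_derivative (\<lambda>h. swap23 h \<bullet> D)) (at p)" by (simp add: sp)
  moreover have "swap23 h \<bullet> D = h \<bullet> swap23 D" for h by (simp add: inner_vec_def sum_3)
  ultimately have "((\<lambda>q. u (swap23 q)) has_derivative (\<lambda>h. h \<bullet> swap23 D)) (at p)" by simp
  moreover have "\<bar>u (swap23 q)\<bar> \<le> M" if "q \<in> closure (\<Omega> \<epsilon>)" "norm q \<le> 12" for q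
    using that by (intro M(1)) (auto simp: norm_swap23 closure_exterior_domain_coords[OF eps(1)] add.commute)
  ultimately have "\<bar>swap23 D $ 2\<bar> \<le> 2700 * M * \<epsilon> powr (-\<gamma>)"
    using transversal_derivative_bound[OF neumann_harmonic_swap23[OF u eps(1)] eps _ M(2) p] by blast
  then show ?thesis by simp
qed

subsection \<open>The stream function of the rotational mean\<close>

text \<open>The mean value theorem, first in direction \<open>i\<close> for the difference in
  direction \<open>j\<close>, then in direction \<open>j\<close> for the partial derivative.\<close>

lemma second_difference:
  fixes f :: "real^3 \<Rightarrow> real"
  assumes f: "\<And>y. y \<in> ball x d \<Longrightarrow> (f has_derivative (\<lambda>h. h \<bullet> g y)) (at y)"
    and g: "\<And>y. y \<in> ball x d \<Longrightarrow> ((\<lambda>y. g y $ i) has_derivative (\<lambda>h. h \<bullet> K y)) (at y)"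
    and h: "0 < h" "2 * h < d"
  shows "\<exists>y. dist x y < d \<and>
    f (x + h *\<^sub>R axis i 1 + h *\<^sub>R axis j 1) - f (x + h *\<^sub>R axis i 1) - f (x + h *\<^sub>R axis j 1) + f x = h * (h * K y $ j)"
proof -
  have in_ball: "x + s *\<^sub>R axis i 1 + t *\<^sub>R axis j 1 \<in> ball x d" if "0 \<le> s" "s \<le> h" "0 \<le> t" "t \<le> h" for s t
  proof -
    have "x + s *\<^sub>R axis i 1 + t *\<^sub>R axis j 1 - x = s *\<^sub>R axis i 1 + t *\<^sub>R axis j 1" by simp
    then have "norm (x + s *\<^sub>R axis i 1 + t *\<^sub>R axis j 1 - x) \<le> norm (s *\<^sub>R axis i (1::real)) + norm (t *\<^sub>R axis j (1::real))"
      by (metis norm_triangle_ineq)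
    also have "\<dots> \<le> 2 * h" using that by simp
    finally show ?thesis using h(2) unfolding mem_ball dist_norm norm_minus_commute[of x] by linarith
  qed
  define F where "F s = f (x + h *\<^sub>R axis j 1 + s *\<^sub>R axis i 1) - f (x + s *\<^sub>R axis i 1)" for s
  have dF: "(F has_real_derivative (g (x + h *\<^sub>R axis j 1 + s *\<^sub>R axis i 1) $ i - g (x + s *\<^sub>R axis i 1) $ i)) (at s)"
    if "0 \<le> s" "s \<le> h" for s
  proof -
    have 1: "x + h *\<^sub>R axis j 1 + s *\<^sub>R axis i 1 \<in> ball x d" using in_ball[of s h] that h(1) by (simp add: add_ac)
    have 2: "x + s *\<^sub>R axis i 1 \<in> ball x d" using in_ball[of s 0] that h(1) by simp
    show ?thesis unfolding F_def[abs_def]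
      using DERIV_diff[OF has_derivative_line[OF f[OF 1]] has_derivative_line[OF f[OF 2]]] by (simp add: inner_axis')
  qed
  obtain s where s: "0 < s" "s < h"
    "F h - F 0 = (h - 0) * (g (x + h *\<^sub>R axis j 1 + s *\<^sub>R axis i 1) $ i - g (x + s *\<^sub>R axis i 1) $ i)"
    using MVT2[OF h(1) dF] by blast
  have dG: "((\<lambda>t. g (x + s *\<^sub>R axis i 1 + t *\<^sub>R axis j 1) $ i) has_real_derivative K (x + s *\<^sub>R axis i 1 + t *\<^sub>R axis j 1) $ j) (at t)"
    if "0 \<le> t" "t \<le> h" for t
    using has_derivative_line[OF g, of "x + s *\<^sub>R axis i 1" t "axis j 1"] in_ball[of s t] that s by (simp add: inner_axis')
  obtain t where t: "0 < t" "t < h"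
    "g (x + s *\<^sub>R axis i 1 + h *\<^sub>R axis j 1) $ i - g (x + s *\<^sub>R axis i 1 + 0 *\<^sub>R axis j 1) $ i =
      (h - 0) * K (x + s *\<^sub>R axis i 1 + t *\<^sub>R axis j 1) $ j"
    using MVT2[OF h(1) dG] by blast
  show ?thesis
  proof (intro exI[of _ "x + s *\<^sub>R axis i 1 + t *\<^sub>R axis j 1"] conjI)
    show "f (x + h *\<^sub>R axis i 1 + h *\<^sub>R axis j 1) - f (x + h *\<^sub>R axis i 1) - f (x + h *\<^sub>R axis j 1) + f x =
      h * (h * K (x + s *\<^sub>R axis i 1 + t *\<^sub>R axis j 1) $ j)"
      using s(3) t(3) by (simp add: F_def add_ac)
  qed (use in_ball[of s t] s t in auto)
qed

text \<open>Both mixed derivatives, taken at nearby points, represent one and the same second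
  difference, which is symmetric in \<open>i\<close> and \<open>j\<close>; continuity moves both to
  \<open>x\<close>.\<close>

lemma mixed_partials_symmetric:
  fixes f :: "real^3 \<Rightarrow> real"
  assumes S: "open S" "x \<in> S"
    and f: "\<And>y. y \<in> S \<Longrightarrow> (f has_derivative (\<lambda>h. h \<bullet> g y)) (at y)"
    and g: "\<And>y i. y \<in> S \<Longrightarrow> ((\<lambda>y. g y $ i) has_derivative (\<lambda>h. h \<bullet> K i y)) (at y)"
    and K: "\<And>i. continuous_on S (K i)"
  shows "K i x $ j = K j x $ i"
proof (rule ccontr)
  assume "K i x $ j \<noteq> K j x $ i"
  define \<eta> where "\<eta> = \<bar>K i x $ j - K j x $ i\<bar> / 2"
  have \<eta>: "0 < \<eta>" using \<open>K i x $ j \<noteq> K j x $ i\<close> by (simp add: \<eta>_def)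
  have c: "isCont (\<lambda>y. K a y $ b) x" for a b
    using K[of a] S by (intro continuous_intros) (simp add: continuous_on_eq_continuous_at)
  obtain d1 where d1: "0 < d1" "\<And>y. dist y x < d1 \<Longrightarrow> dist (K i y $ j) (K i x $ j) < \<eta>"
    using c[of i j] \<eta> unfolding continuous_at_eps_delta by blast
  obtain d2 where d2: "0 < d2" "\<And>y. dist y x < d2 \<Longrightarrow> dist (K j y $ i) (K j x $ i) < \<eta>"
    using c[of j i] \<eta> unfolding continuous_at_eps_delta by blast
  obtain d3 where d3: "0 < d3" "ball x d3 \<subseteq> S" using S openE by blast
  define d where "d = min d1 (min d2 d3)"
  define h where "h = d / 3"
  have h: "0 < h" "2 * h < d" "0 < d" using d1 d2 d3 by (auto simp: h_def d_def)
  have sub: "ball x d \<subseteq> S" using d3 by (auto simp: d_def)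
  obtain y where y: "dist x y < d"
    "f (x + h *\<^sub>R axis i 1 + h *\<^sub>R axis j 1) - f (x + h *\<^sub>R axis i 1) - f (x + h *\<^sub>R axis j 1) + f x = h * (h * K i y $ j)"
    using second_difference[of x d f g i "K i" h j, OF f[OF subsetD[OF sub]] g[OF subsetD[OF sub]] h(1,2)] by blast
  obtain z where z: "dist x z < d"
    "f (x + h *\<^sub>R axis j 1 + h *\<^sub>R axis i 1) - f (x + h *\<^sub>R axis j 1) - f (x + h *\<^sub>R axis i 1) + f x = h * (h * K j z $ i)"
    using second_difference[of x d f g j "K j" h i, OF f[OF subsetD[OF sub]] g[OF subsetD[OF sub]] h(1,2)] by blast
  have "h * (h * K i y $ j) = h * (h * K j z $ i)"
    unfolding y(2)[symmetric] z(2)[symmetric] by (simp add: add_ac)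
  then have "K i y $ j = K j z $ i" using h(1) by simp
  moreover have "dist (K i y $ j) (K i x $ j) < \<eta>" "dist (K j z $ i) (K j x $ i) < \<eta>"
    using d1(2)[of y] d2(2)[of z] y(1) z(1) by (auto simp: d_def dist_commute)
  ultimately show False unfolding dist_real_def \<eta>_def by (auto simp: abs_if split: if_splits)
qed

section \<open>Cylindrical coordinates and angular means\<close>

definition merid :: "real \<Rightarrow> real \<Rightarrow> real \<Rightarrow> real^3" where
  "merid x r \<theta> = vector [x, r * cos \<theta>, r * sin \<theta>]"

text \<open>The dummy angle gives all three directions the same type, so that each can serve as
  weight in \<open>mean\<close> and \<open>mean2\<close>.\<close>

abbreviation axial_dir :: "real \<Rightarrow> real^3" where "axial_dir \<equiv> \<lambda>_. vector [1, 0, 0]"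
definition radial_dir :: "real \<Rightarrow> real^3" where "radial_dir \<theta> = vector [0, cos \<theta>, sin \<theta>]"
definition angular_dir :: "real \<Rightarrow> real^3" where "angular_dir \<theta> = vector [0, - sin \<theta>, cos \<theta>]"

lemma merid_component [simp]: "merid x r \<theta> $ 1 = x" "merid x r \<theta> $ 2 = r * cos \<theta>" "merid x r \<theta> $ 3 = r * sin \<theta>"
  by (simp_all add: merid_def vector_3)
lemma radial_dir_component [simp]: "radial_dir \<theta> $ 1 = 0" "radial_dir \<theta> $ 2 = cos \<theta>" "radial_dir \<theta> $ 3 = sin \<theta>"
  by (simp_all add: radial_dir_def vector_3)
lemma angular_dir_component [simp]: "angular_dir \<theta> $ 1 = 0" "angular_dir \<theta> $ 2 = - sin \<theta>" "angular_dir \<theta> $ 3 = cos \<theta>"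
  by (simp_all add: angular_dir_def vector_3)
lemma axial_dir_component [simp]: "axial_dir \<theta> $ 1 = 1" "axial_dir \<theta> $ 2 = 0" "axial_dir \<theta> $ 3 = 0"
  by (simp_all add: vector_3)

lemma inner_3: "(a::real^3) \<bullet> b = a$1 * b$1 + a$2 * b$2 + a$3 * b$3"
  by (simp add: inner_vec_def sum_3)

lemma continuous_on_vec3:
  fixes f :: "'a::topological_space \<Rightarrow> real^3"
  assumes "continuous_on S (\<lambda>x. f x $ 1)" "continuous_on S (\<lambda>x. f x $ 2)" "continuous_on S (\<lambda>x. f x $ 3)"
  shows "continuous_on S f"
proof -
  have "continuous_on S (\<lambda>x. \<chi> i. f x $ i)"
  proof (rule continuous_on_vec_lambda)
    show "continuous_on S (\<lambda>x. f x $ i)" for i using assms exhaust_3[of i] by auto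
  qed
  then show ?thesis by simp
qed

lemma merid_line: "merid 0 r \<theta> + x *\<^sub>R axial_dir \<theta> = merid x r \<theta>" "merid x 0 \<theta> + r *\<^sub>R radial_dir \<theta> = merid x r \<theta>"
  by (simp_all add: vec_eq_iff forall_3 vector_3)

text \<open>\<open>G\<close> is the gradient of a solution up to the boundary, \<open>K i\<close> the gradient of its \<open>i\<close>-th component.\<close>

locale neumann_gradient =
  fixes \<epsilon> L :: real and G :: "real^3 \<Rightarrow> real^3" and K :: "3 \<Rightarrow> real^3 \<Rightarrow> real^3"
  assumes eps: "0 < \<epsilon>" "\<epsilon> < 1"
    and G_cont: "continuous_on (closure (\<Omega> \<epsilon>)) G"
    and G_deriv: "\<And>y i. y \<in> \<Omega> \<epsilon> \<Longrightarrow> ((\<lambda>y. G y $ i) has_derivative (\<lambda>h. h \<bullet> K i y)) (at y)"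
    and K_cont: "\<And>i. continuous_on (\<Omega> \<epsilon>) (K i)"
    and K_trace: "\<And>y. y \<in> \<Omega> \<epsilon> \<Longrightarrow> K 1 y $ 1 + K 2 y $ 2 + K 3 y $ 3 = 0"
    and K_sym: "\<And>y i j. y \<in> \<Omega> \<epsilon> \<Longrightarrow> K i y $ j = K j y $ i"
    and neumann: "\<And>c p. c \<in> {center1 \<epsilon>, center2 \<epsilon>} \<Longrightarrow> dist c p = 1 \<Longrightarrow> G p \<bullet> (p - c) = 0"
    and G_bound: "\<And>p i. 4 \<le> norm p \<Longrightarrow> norm p \<le> 6 \<Longrightarrow> \<bar>G p $ i\<bar> \<le> L"
begin

text \<open>The meridian section of the exterior, with \<open>r\<close> of either sign: the axis
  then consists of interior points, and derivatives in \<open>r\<close> at \<open>r = 0\<close> are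
  two-sided.\<close>

definition D :: "(real \<times> real) set" where
  "D = {(x, r). 1 < (x + (1 + \<epsilon>/2))^2 + r^2 \<and> 1 < (x - (1 + \<epsilon>/2))^2 + r^2}"

definition Dc :: "(real \<times> real) set" where
  "Dc = {(x, r). 1 \<le> (x + (1 + \<epsilon>/2))^2 + r^2 \<and> 1 \<le> (x - (1 + \<epsilon>/2))^2 + r^2}"

lemma D_subset: "D \<subseteq> Dc" by (auto simp: D_def Dc_def)

lemma open_D: "open D"
  unfolding D_def case_prod_beta by (intro open_Collect_conj open_Collect_less continuous_intros)

lemma closed_Dc: "closed Dc"
  unfolding Dc_def case_prod_beta by (intro closed_Collect_conj closed_Collect_le continuous_intros)

lemma merid_closure: "merid x r \<theta> \<in> closure (\<Omega> \<epsilon>) \<longleftrightarrow> (x, r) \<in> Dc"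
proof -
  have "(r * cos \<theta>)^2 + (r * sin \<theta>)^2 = r^2 * ((cos \<theta>)^2 + (sin \<theta>)^2)" by (simp only: power_mult_distrib distrib_left)
  then have "(r * cos \<theta>)^2 + (r * sin \<theta>)^2 = r^2" by simp
  then show ?thesis by (simp add: closure_exterior_domain_coords[OF eps(1)] Dc_def)
qed

lemma merid_exterior: "merid x r \<theta> \<in> \<Omega> \<epsilon> \<longleftrightarrow> (x, r) \<in> D"
proof -
  have "(r * cos \<theta>)^2 + (r * sin \<theta>)^2 = r^2 * ((cos \<theta>)^2 + (sin \<theta>)^2)" by (simp only: power_mult_distrib distrib_left)
  then have 1: "(r * cos \<theta>)^2 + (r * sin \<theta>)^2 = r^2" by simp
  have 2: "1 < dist c p \<longleftrightarrow> 1 < (dist c p)^2" for c p :: "real^3"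
    using one_less_power[of "dist c p" 2] power_le_one[of "dist c p" 2] by (metis not_le zero_le_dist zero_less_numeral)
  show ?thesis unfolding exterior_domain_iff 2 dist_center_sq by (simp add: 1 D_def)
qed

text \<open>The integral is not divided by \<open>2 * pi\<close>; the factor is accounted for in
  \<open>axial_gradient_bound\<close>.\<close>

definition mean :: "(real \<Rightarrow> real^3) \<Rightarrow> real \<Rightarrow> real \<Rightarrow> real" where
  "mean w x r = integral (cbox 0 (2*pi)) (\<lambda>\<theta>. w \<theta> \<bullet> G (merid x r \<theta>))"

text \<open>The Hessian of the solution as a bilinear form: the derivative of
  \<open>w \<bullet> G\<close> in direction \<open>d\<close>.\<close>

definition bil :: "real^3 \<Rightarrow> real^3 \<Rightarrow> real^3 \<Rightarrow> real" where
  "bil w d y = w$1 * (d \<bullet> K 1 y) + w$2 * (d \<bullet> K 2 y) + w$3 * (d \<bullet> K 3 y)"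

definition mean2 :: "(real \<Rightarrow> real^3) \<Rightarrow> (real \<Rightarrow> real^3) \<Rightarrow> real \<Rightarrow> real \<Rightarrow> real" where
  "mean2 w d x r = integral (cbox 0 (2*pi)) (\<lambda>\<theta>. bil (w \<theta>) (d \<theta>) (merid x r \<theta>))"

lemma cont_merid: "continuous_on UNIV (\<lambda>((x, r), \<theta>). merid x r \<theta>)"
  by (rule continuous_on_vec3; simp only: case_prod_beta merid_component;
      intro continuous_on_fst continuous_on_snd continuous_on_mult continuous_on_cos continuous_on_sin continuous_on_id)

lemma cont_dirs: "continuous_on UNIV axial_dir" "continuous_on UNIV radial_dir" "continuous_on UNIV angular_dir"
  by (rule continuous_on_vec3; simp only: axial_dir_component radial_dir_component angular_dir_component;
      intro continuous_on_minus continuous_on_cos continuous_on_sin continuous_on_id continuous_on_const)+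

lemma cont_G_merid: "continuous_on (Dc \<times> UNIV) (\<lambda>((x, r), \<theta>). G (merid x r \<theta>))"
proof -
  have "continuous_on (Dc \<times> UNIV) (G \<circ> (\<lambda>((x, r), \<theta>). merid x r \<theta>))"
    by (intro continuous_on_compose continuous_on_subset[OF cont_merid] continuous_on_subset[OF G_cont])
       (auto simp: merid_closure)
  then show ?thesis by (simp add: o_def case_prod_beta)
qed

lemma cont_K_merid: "continuous_on (D \<times> UNIV) (\<lambda>((x, r), \<theta>). K i (merid x r \<theta>))"
proof -
  have "continuous_on (D \<times> UNIV) (K i \<circ> (\<lambda>((x, r), \<theta>). merid x r \<theta>))"
    by (intro continuous_on_compose continuous_on_subset[OF cont_merid] continuous_on_subset[OF K_cont])
       (auto simp: merid_exterior)
  then show ?thesis by (simp add: o_def case_prod_beta)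
qed

lemma cont_integrand:
  assumes "continuous_on UNIV w"
  shows "continuous_on (Dc \<times> UNIV) (\<lambda>((x, r), \<theta>). w \<theta> \<bullet> G (merid x r \<theta>))"
  using cont_G_merid unfolding case_prod_beta
  by (intro continuous_intros continuous_on_compose2[OF assms]) auto

lemma cont_integrand2:
  assumes "continuous_on UNIV w" "continuous_on UNIV d"
  shows "continuous_on (D \<times> UNIV) (\<lambda>((x, r), \<theta>). bil (w \<theta>) (d \<theta>) (merid x r \<theta>))"
  using cont_K_merid unfolding case_prod_beta bil_def
  by (intro continuous_intros continuous_on_compose2[OF assms(1)] continuous_on_compose2[OF assms(2)]) auto

lemma mean_cont:
  assumes "continuous_on UNIV w"
  shows "continuous_on Dc (\<lambda>(x, r). mean w x r)"
proof -
  have "continuous_on Dc (\<lambda>z. integral (cbox 0 (2*pi)) (\<lambda>\<theta>. w \<theta> \<bullet> G (merid (fst z) (snd z) \<theta>)))"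
    by (rule integral_continuous_on_param)
       (use continuous_on_subset[OF cont_integrand[OF assms], of "Dc \<times> cbox 0 (2*pi)"] in \<open>auto simp: case_prod_beta\<close>)
  then show ?thesis by (simp add: mean_def case_prod_beta)
qed

lemma mean2_cont:
  assumes "continuous_on UNIV w" "continuous_on UNIV d"
  shows "continuous_on D (\<lambda>(x, r). mean2 w d x r)"
proof -
  have "continuous_on D (\<lambda>z. integral (cbox 0 (2*pi)) (\<lambda>\<theta>. bil (w \<theta>) (d \<theta>) (merid (fst z) (snd z) \<theta>)))"
    by (rule integral_continuous_on_param)
       (use continuous_on_subset[OF cont_integrand2[OF assms], of "D \<times> cbox 0 (2*pi)"] in \<open>auto simp: case_prod_beta\<close>)
  then show ?thesis by (simp add: mean2_def case_prod_beta)
qed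

lemma integrable_mean:
  assumes w: "continuous_on UNIV w" and "(x, r) \<in> Dc"
  shows "(\<lambda>\<theta>. w \<theta> \<bullet> G (merid x r \<theta>)) integrable_on cbox 0 (2*pi)"
proof -
  have "continuous_on UNIV ((\<lambda>((x, r), \<theta>). w \<theta> \<bullet> G (merid x r \<theta>)) \<circ> (\<lambda>\<theta>. ((x, r), \<theta>)))"
    by (rule continuous_on_compose[OF _ continuous_on_subset[OF cont_integrand[OF w]]])
       (use assms(2) in \<open>auto intro!: continuous_on_Pair continuous_on_id continuous_on_const\<close>)
  then have "continuous_on (cbox 0 (2*pi)) (\<lambda>\<theta>. w \<theta> \<bullet> G (merid x r \<theta>))"
    unfolding o_def by (auto elim: continuous_on_subset)
  then show ?thesis by (rule integrable_continuous)
qed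

lemma G_line:
  assumes "p + t *\<^sub>R d \<in> \<Omega> \<epsilon>"
  shows "((\<lambda>t. w \<bullet> G (p + t *\<^sub>R d)) has_real_derivative bil w d (p + t *\<^sub>R d)) (at t)"
  unfolding inner_3[of w] bil_def
  by (intro DERIV_add DERIV_cmult has_derivative_line[OF G_deriv[OF assms]])

lemma open_slice:
  assumes "(x0, r0) \<in> D"
  shows "\<exists>e>0. \<forall>x r. \<bar>x - x0\<bar> < e \<longrightarrow> \<bar>r - r0\<bar> < e \<longrightarrow> (x, r) \<in> D"
proof -
  obtain e where e: "0 < e" "ball (x0, r0) e \<subseteq> D" using open_D assms openE by blast
  show ?thesis
  proof (intro exI[of _ "e/2"] conjI allI impI)
    fix x r assume "\<bar>x - x0\<bar> < e/2" "\<bar>r - r0\<bar> < e/2"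
    then have "dist (x, r) (x0, r0) < e"
      using sqrt_sum_squares_le_sum_abs[of "x - x0" "r - r0"] by (simp add: dist_Pair_Pair dist_real_def)
    then show "(x, r) \<in> D" using e(2) by (auto simp: dist_commute)
  qed (use e in simp)
qed

text \<open>For each fixed angle the curve is a straight line in direction
  \<open>d \<theta>\<close>, so differentiation under the integral sign treats both meridian
  coordinates at once.\<close>

lemma mean_deriv_line:
  assumes w: "continuous_on UNIV w" and d: "continuous_on UNIV d" and e: "0 < e"
    and xr: "continuous_on UNIV x" "continuous_on UNIV r" "\<And>t. t \<in> ball t0 e \<Longrightarrow> (x t, r t) \<in> D"
    and line: "\<And>t \<theta>. merid (x t) (r t) \<theta> = p \<theta> + t *\<^sub>R d \<theta>"
  shows "((\<lambda>t. mean w (x t) (r t)) has_real_derivative mean2 w d (x t0) (r t0)) (at t0)"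
proof -
  let ?U = "ball t0 e"
  have "((\<lambda>t. integral (cbox 0 (2*pi)) (\<lambda>\<theta>. w \<theta> \<bullet> G (merid (x t) (r t) \<theta>))) has_real_derivative
     integral (cbox 0 (2*pi)) (\<lambda>\<theta>. bil (w \<theta>) (d \<theta>) (merid (x t0) (r t0) \<theta>))) (at t0 within ?U)"
  proof (rule leibniz_rule_field_derivative)
    fix t \<theta> assume "t \<in> ?U"
    then have "p \<theta> + t *\<^sub>R d \<theta> \<in> \<Omega> \<epsilon>"
      unfolding line[symmetric] merid_exterior by (rule xr(3))
    from G_line[OF this, of "w \<theta>"] show "((\<lambda>t. w \<theta> \<bullet> G (merid (x t) (r t) \<theta>)) has_real_derivative
        bil (w \<theta>) (d \<theta>) (merid (x t) (r t) \<theta>)) (at t within ?U)"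
      unfolding line by (rule has_field_derivative_at_within)
  next
    fix t assume "t \<in> ?U"
    then show "(\<lambda>\<theta>. w \<theta> \<bullet> G (merid (x t) (r t) \<theta>)) integrable_on cbox 0 (2*pi)"
      using xr(3)[of t] D_subset by (intro integrable_mean[OF w]) auto
  next
    show "continuous_on (?U \<times> cbox 0 (2*pi)) (\<lambda>(t, \<theta>). bil (w \<theta>) (d \<theta>) (merid (x t) (r t) \<theta>))"
    proof -
      have "continuous_on (?U \<times> cbox 0 (2*pi)) (\<lambda>z. ((x (fst z), r (fst z)), snd z))"
        by (intro continuous_on_Pair continuous_on_compose2[OF xr(1)] continuous_on_compose2[OF xr(2)]
            continuous_on_fst continuous_on_snd continuous_on_id subset_UNIV)
      from continuous_on_compose2[OF cont_integrand2[OF w d] this] xr(3)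
      show ?thesis by (simp add: case_prod_beta image_subset_iff)
    qed
  qed (use e in auto)
  moreover have "at t0 within ?U = at t0" using e by (intro at_within_open) auto
  ultimately show ?thesis unfolding mean_def mean2_def by (simp only:)
qed

lemma mean_deriv_x:
  assumes w: "continuous_on UNIV w" and D: "(x0, r0) \<in> D"
  shows "((\<lambda>x. mean w x r0) has_real_derivative mean2 w axial_dir x0 r0) (at x0)"
proof -
  obtain e where e: "0 < e" "\<And>x r. \<bar>x - x0\<bar> < e \<Longrightarrow> \<bar>r - r0\<bar> < e \<Longrightarrow> (x, r) \<in> D"
    using open_slice[OF D] by blast
  show ?thesis
    by (rule mean_deriv_line[OF w cont_dirs(1) e(1), of "\<lambda>x. x" "\<lambda>_. r0", OF _ _ _ merid_line(1)[symmetric]])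
       (use e in \<open>auto simp: dist_real_def\<close>)
qed

lemma mean_deriv_r:
  assumes w: "continuous_on UNIV w" and D: "(x0, r0) \<in> D"
  shows "((\<lambda>r. mean w x0 r) has_real_derivative mean2 w radial_dir x0 r0) (at r0)"
proof -
  obtain e where e: "0 < e" "\<And>x r. \<bar>x - x0\<bar> < e \<Longrightarrow> \<bar>r - r0\<bar> < e \<Longrightarrow> (x, r) \<in> D"
    using open_slice[OF D] by blast
  show ?thesis
    by (rule mean_deriv_line[OF w cont_dirs(2) e(1), of "\<lambda>_. x0" "\<lambda>r. r", OF _ _ _ merid_line(2)[symmetric]])
       (use e in \<open>auto simp: dist_real_def\<close>)
qed

lemma mean2_has_integral:
  assumes "continuous_on UNIV w" "continuous_on UNIV d" "(x, r) \<in> D"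
  shows "((\<lambda>\<theta>. bil (w \<theta>) (d \<theta>) (merid x r \<theta>)) has_integral mean2 w d x r) (cbox 0 (2*pi))"
proof -
  have "continuous_on UNIV ((\<lambda>((x, r), \<theta>). bil (w \<theta>) (d \<theta>) (merid x r \<theta>)) \<circ> (\<lambda>\<theta>. ((x, r), \<theta>)))"
    by (rule continuous_on_compose[OF _ continuous_on_subset[OF cont_integrand2[OF assms(1,2)]]])
       (use assms(3) in \<open>auto intro!: continuous_on_Pair continuous_on_id continuous_on_const\<close>)
  then have "continuous_on (cbox 0 (2*pi)) (\<lambda>\<theta>. bil (w \<theta>) (d \<theta>) (merid x r \<theta>))"
    unfolding o_def by (auto elim: continuous_on_subset)
  then show ?thesis unfolding mean2_def by (intro integrable_integral integrable_continuous)
qed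

lemma mean_has_integral:
  assumes "continuous_on UNIV w" "(x, r) \<in> Dc"
  shows "((\<lambda>\<theta>. w \<theta> \<bullet> G (merid x r \<theta>)) has_integral mean w x r) (cbox 0 (2*pi))"
  unfolding mean_def by (intro integrable_integral integrable_mean assms)

text \<open>The mean field is irrotational. In terms of \<open>psi\<close> this is its second-order
  equation, while \<open>mean_continuity_equation\<close> is what makes \<open>psi\<close> a stream
  function.\<close>

lemma mean2_mixed:
  assumes "(x, r) \<in> D"
  shows "mean2 axial_dir radial_dir x r = mean2 radial_dir axial_dir x r"
  unfolding mean2_def
proof (rule integral_cong)
  fix \<theta>
  have "merid x r \<theta> \<in> \<Omega> \<epsilon>" using assms by (simp add: merid_exterior)
  from K_sym[OF this, of 1 2] K_sym[OF this, of 1 3]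
  show "bil (axial_dir \<theta>) (radial_dir \<theta>) (merid x r \<theta>) = bil (radial_dir \<theta>) (axial_dir \<theta>) (merid x r \<theta>)"
    by (simp add: bil_def inner_3)
qed

lemma merid_deriv: "(merid x r has_derivative (\<lambda>h. h *\<^sub>R (r *\<^sub>R angular_dir \<theta>))) (at \<theta>)"
proof -
  have "((\<lambda>\<theta>. x *\<^sub>R axis 1 1 + (r * cos \<theta>) *\<^sub>R axis 2 1 + (r * sin \<theta>) *\<^sub>R (axis 3 1 :: real^3)) has_derivative
     (\<lambda>h. (h * (- sin \<theta>) * r) *\<^sub>R axis 2 1 + (h * cos \<theta> * r) *\<^sub>R axis 3 1)) (at \<theta>)"
    by (auto intro!: derivative_eq_intros simp: fun_eq_iff algebra_simps)
  moreover have "merid x r = (\<lambda>\<theta>. x *\<^sub>R axis 1 1 + (r * cos \<theta>) *\<^sub>R axis 2 1 + (r * sin \<theta>) *\<^sub>R axis 3 1)"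
    by (simp add: fun_eq_iff vec_eq_iff forall_3)
  moreover have "(\<lambda>h. (h * (- sin \<theta>) * r) *\<^sub>R axis 2 1 + (h * cos \<theta> * r) *\<^sub>R axis 3 1) = (\<lambda>h. h *\<^sub>R (r *\<^sub>R angular_dir \<theta>))"
    by (simp add: fun_eq_iff vec_eq_iff forall_3)
  ultimately show ?thesis by simp
qed

text \<open>The Laplace equation in cylindrical coordinates, multiplied by \<open>r\<close> and
  integrated over the angle. Up to the radial term, the second angular derivative is the
  \<theta>-derivative \<open>R\<close> of \<open>angular_dir \<theta> \<bullet> G\<close>, and the
  integral of \<open>R\<close> over a period vanishes.\<close>

lemma mean_continuity_equation:
  assumes D: "(x, r) \<in> D"
  shows "r * mean2 axial_dir axial_dir x r + mean radial_dir x r + r * mean2 radial_dir radial_dir x r = 0"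
proof -
  define R where "R \<theta> = - radial_dir \<theta> \<bullet> G (merid x r \<theta>) + r * bil (angular_dir \<theta>) (angular_dir \<theta>) (merid x r \<theta>)" for \<theta>
  have S: "merid x r \<theta> \<in> \<Omega> \<epsilon>" for \<theta> using D by (simp add: merid_exterior)
  have Gi: "((\<lambda>\<theta>. G (merid x r \<theta>) $ i) has_real_derivative (r * (angular_dir \<theta> \<bullet> K i (merid x r \<theta>)))) (at \<theta>)" for i \<theta>
    using has_derivative_compose[OF merid_deriv G_deriv[OF S]]
    by (simp add: has_field_derivative_def mult_commute_abs mult.assoc)
  have "((\<lambda>\<theta>. - sin \<theta> * G (merid x r \<theta>) $ 2 + cos \<theta> * G (merid x r \<theta>) $ 3) has_real_derivative R \<theta>) (at \<theta>)" for \<theta>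
    by (rule DERIV_cong[OF DERIV_add[OF DERIV_mult[OF DERIV_minus[OF DERIV_sin] Gi] DERIV_mult[OF DERIV_cos Gi]]])
       (simp add: R_def bil_def inner_3[of "radial_dir \<theta>"] algebra_simps)
  then have "(R has_integral ((- sin (2*pi) * G (merid x r (2*pi)) $ 2 + cos (2*pi) * G (merid x r (2*pi)) $ 3) -
       (- sin 0 * G (merid x r 0) $ 2 + cos 0 * G (merid x r 0) $ 3))) {0..2*pi}"
    by (intro fundamental_theorem_of_calculus)
       (auto simp: has_real_derivative_iff_has_vector_derivative[symmetric] intro: has_field_derivative_at_within)
  then have "((\<lambda>\<theta>. - R \<theta>) has_integral - 0) (cbox 0 (2*pi))"
    by (intro has_integral_neg) (simp add: merid_def)
  moreover have "- R \<theta> = r * bil (axial_dir \<theta>) (axial_dir \<theta>) (merid x r \<theta>) + radial_dir \<theta> \<bullet> G (merid x r \<theta>) +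
      r * bil (radial_dir \<theta>) (radial_dir \<theta>) (merid x r \<theta>)" for \<theta>
  proof -
    let ?y = "merid x r \<theta>"
    \<comment> \<open>The trace of the transversal block of the Hessian does not depend on the
      orthonormal frame.\<close>
    have "bil (angular_dir \<theta>) (angular_dir \<theta>) ?y + bil (radial_dir \<theta>) (radial_dir \<theta>) ?y =
       ((sin \<theta>)^2 + (cos \<theta>)^2) * (K 2 ?y $ 2 + K 3 ?y $ 3)"
      by (simp only: bil_def inner_3 angular_dir_component radial_dir_component) algebra
    also have "\<dots> = - bil (axial_dir \<theta>) (axial_dir \<theta>) ?y"
      using K_trace[OF S, of \<theta>] by (simp add: bil_def inner_3)
    finally have z: "bil (angular_dir \<theta>) (angular_dir \<theta>) ?y =
        - bil (axial_dir \<theta>) (axial_dir \<theta>) ?y - bil (radial_dir \<theta>) (radial_dir \<theta>) ?y" by linarith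
    show ?thesis unfolding R_def z by (simp add: algebra_simps)
  qed
  moreover have "((\<lambda>\<theta>. r * bil (axial_dir \<theta>) (axial_dir \<theta>) (merid x r \<theta>) + radial_dir \<theta> \<bullet> G (merid x r \<theta>) +
      r * bil (radial_dir \<theta>) (radial_dir \<theta>) (merid x r \<theta>)) has_integral
     (r * mean2 axial_dir axial_dir x r + mean radial_dir x r + r * mean2 radial_dir radial_dir x r)) (cbox 0 (2*pi))"
    using D D_subset cont_dirs
    by (intro has_integral_add has_integral_mult_right mean2_has_integral mean_has_integral) auto
  ultimately show ?thesis using has_integral_unique by (metis (no_types, lifting) has_integral_cong neg_0_equal_iff_equal)
qed

text \<open>For \<open>r \<ge> 0\<close>, increasing \<open>r\<close> moves away from both balls, so
  the vertical segment up to \<open>r = 4\<close> never leaves the domain. This allows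
  \<open>psi\<close> to be defined by integrating down from the top, with no path around the balls
  to choose.\<close>

lemma Dc_up: "(x, r) \<in> Dc \<Longrightarrow> 0 \<le> r \<Longrightarrow> r \<le> s \<Longrightarrow> (x, s) \<in> Dc"
  and D_up: "(x, r) \<in> D \<Longrightarrow> 0 \<le> r \<Longrightarrow> r \<le> s \<Longrightarrow> (x, s) \<in> D"
proof -
  assume "0 \<le> r" "r \<le> s"
  then have "r^2 \<le> s^2" by (intro power_mono) auto
  then show "(x, r) \<in> Dc \<Longrightarrow> (x, s) \<in> Dc" "(x, r) \<in> D \<Longrightarrow> (x, s) \<in> D" unfolding Dc_def D_def by auto
qed

lemma D_top: "(x, 4) \<in> D" "(x, 4) \<in> Dc"
proof -
  have "1 < (y::real)^2 + 4^2" for y by (simp add: add_pos_nonneg)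
  then show "(x, 4) \<in> D" unfolding D_def by blast
  then show "(x, 4) \<in> Dc" using D_subset by blast
qed

section \<open>Construction of the stream function\<close>

abbreviation "axial_mean \<equiv> mean axial_dir"
abbreviation "radial_mean \<equiv> mean radial_dir"

definition flux :: "real \<Rightarrow> real \<Rightarrow> real" where "flux x s = s * axial_mean x s"

text \<open>The constant is chosen such that \<open>psi (-4) 0 = 0\<close>; the gradient of \<open>psi\<close> is
  \<open>(- r * radial_mean x r, r * axial_mean x r)\<close>.\<close>

definition psi :: "real \<Rightarrow> real \<Rightarrow> real" where
  "psi x r = integral {0..4} (flux (-4)) - 4 * integral {-4..x} (\<lambda>t. radial_mean t 4) - integral {r..4} (flux x)"

lemma mean_cont_compose:
  assumes "continuous_on UNIV w" "continuous_on S a" "continuous_on S b" "\<And>z. z \<in> S \<Longrightarrow> (a z, b z) \<in> Dc"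
  shows "continuous_on S (\<lambda>z. mean w (a z) (b z))"
  using continuous_on_compose2[OF mean_cont[OF assms(1)] continuous_on_Pair[OF assms(2,3)]] assms(4)
  by (auto simp: image_subset_iff)

lemma mean2_cont_compose:
  assumes "continuous_on UNIV w" "continuous_on UNIV d" "continuous_on S a" "continuous_on S b" "\<And>z. z \<in> S \<Longrightarrow> (a z, b z) \<in> D"
  shows "continuous_on S (\<lambda>z. mean2 w d (a z) (b z))"
  using continuous_on_compose2[OF mean2_cont[OF assms(1,2)] continuous_on_Pair[OF assms(3,4)]] assms(5)
  by (auto simp: image_subset_iff)

lemma cont_flux:
  assumes "continuous_on S a" "continuous_on S b" "\<And>z. z \<in> S \<Longrightarrow> (a z, b z) \<in> Dc"
  shows "continuous_on S (\<lambda>z. flux (a z) (b z))"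
  unfolding flux_def by (intro continuous_on_mult mean_cont_compose cont_dirs assms)

lemma integrable_flux:
  assumes "(x, r) \<in> Dc" "0 \<le> r"
  shows "flux x integrable_on {r..s}"
  by (rule integrable_continuous_interval, rule cont_flux)
     (use Dc_up[OF assms] in \<open>auto intro: continuous_on_id continuous_on_const\<close>)

lemma integrable_top: "(\<lambda>t. radial_mean t 4) integrable_on {a..b}"
  by (rule integrable_continuous_interval, rule mean_cont_compose)
     (use D_top cont_dirs in \<open>auto intro: continuous_on_id continuous_on_const\<close>)

lemma psi_deriv_r:
  assumes D: "(x, r) \<in> D" and r: "0 < r" "r < 4"
  shows "((\<lambda>r. psi x r) has_real_derivative r * axial_mean x r) (at r)"
proof -
  obtain e where e: "0 < e" "\<And>x' r'. \<bar>x' - x\<bar> < e \<Longrightarrow> \<bar>r' - r\<bar> < e \<Longrightarrow> (x', r') \<in> D"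
    using open_slice[OF D] by blast
  \<comment> \<open>A base point slightly below \<open>r\<close> that is still in the domain; the
    vertical segment down to the axis may run into a ball.\<close>
  define b where "b = r - min e r / 2"
  have b: "0 < b" "b < r" "(x, b) \<in> Dc"
    using e(1) r e(2)[of x b] D_subset by (auto simp: b_def min_def split: if_splits)
  have "((\<lambda>y. integral {b..y} (flux x)) has_real_derivative flux x r) (at r within {b..4})"
  proof (rule integral_has_real_derivative)
    show "continuous_on {b..4} (flux x)"
      by (rule cont_flux) (use Dc_up[OF b(3)] b in \<open>auto intro: continuous_on_id continuous_on_const\<close>)
  qed (use b r in auto)
  moreover have "at r within {b..4} = at r" using b r by (intro at_within_interior) simp
  ultimately have "((\<lambda>y. integral {b..y} (flux x)) has_real_derivative flux x r) (at r)" by simp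
  then have "((\<lambda>y. integral {0..4} (flux (-4)) - 4 * integral {-4..x} (\<lambda>t. radial_mean t 4) -
      (integral {b..4} (flux x) - integral {b..y} (flux x))) has_real_derivative r * axial_mean x r) (at r)"
    by (auto intro!: derivative_eq_intros simp: flux_def)
  then show ?thesis
  proof (rule has_field_derivative_transform_within_open[of _ _ _ "{b<..<4}"])
    fix y assume "y \<in> {b<..<4}"
    then have "integral {b..y} (flux x) + integral {y..4} (flux x) = integral {b..4} (flux x)"
      using b by (intro Henstock_Kurzweil_Integration.integral_combine integrable_flux) auto
    then show "integral {0..4} (flux (-4)) - 4 * integral {-4..x} (\<lambda>t. radial_mean t 4) -
      (integral {b..4} (flux x) - integral {b..y} (flux x)) = psi x y" by (simp add: psi_def)
  qed (use b r in auto)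
qed

text \<open>By the continuity equation the \<open>x\<close>-derivative of the vertical integrand is
  minus the \<open>s\<close>-derivative of \<open>s * radial_mean\<close>. The integral telescopes,
  and its value at \<open>s = 4\<close> cancels the derivative of the integral along the
  top.\<close>

lemma psi_deriv_x:
  assumes D: "(x0, r) \<in> D" and r: "0 \<le> r" "r \<le> 4" and x0: "-4 < x0" "x0 < 4"
  shows "((\<lambda>x. psi x r) has_real_derivative - (r * radial_mean x0 r)) (at x0)"
proof -
  have "((\<lambda>x. integral {-4..x} (\<lambda>t. radial_mean t 4)) has_real_derivative radial_mean x0 4) (at x0 within {-4..4})"
    by (rule integral_has_real_derivative, rule mean_cont_compose)
       (use D_top cont_dirs x0 in \<open>auto intro: continuous_on_id continuous_on_const\<close>)
  moreover have "at x0 within {-4..4} = at x0" using x0 by (intro at_within_interior) simp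
  ultimately have top: "((\<lambda>x. integral {-4..x} (\<lambda>t. radial_mean t 4)) has_real_derivative radial_mean x0 4) (at x0)" by simp
  obtain e where e: "0 < e" "\<And>x' r'. \<bar>x' - x0\<bar> < e \<Longrightarrow> \<bar>r' - r\<bar> < e \<Longrightarrow> (x', r') \<in> D"
    using open_slice[OF D] by blast
  let ?U = "ball x0 e"
  have U: "(x, s) \<in> D" if "x \<in> ?U" "r \<le> s" for x s
    using D_up[of x r s] e(2)[of x r] that r e(1) by (auto simp: dist_real_def)
  have "((\<lambda>x. integral (cbox r 4) (flux x)) has_real_derivative
     integral (cbox r 4) (\<lambda>s. s * mean2 axial_dir axial_dir x0 s)) (at x0 within ?U)"
  proof (rule leibniz_rule_field_derivative)
    fix x s assume "x \<in> ?U" "s \<in> cbox r 4"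
    then have "(x, s) \<in> D" using U by auto
    from DERIV_cmult[OF mean_deriv_x[OF cont_dirs(1) this], of s]
    show "((\<lambda>x. flux x s) has_real_derivative s * mean2 axial_dir axial_dir x s) (at x within ?U)"
      unfolding flux_def by (rule has_field_derivative_at_within)
  next
    fix x assume "x \<in> ?U"
    then have "(x, r) \<in> Dc" using U D_subset by auto
    then show "flux x integrable_on cbox r 4" using integrable_flux r by simp
  next
    show "continuous_on (?U \<times> cbox r 4) (\<lambda>(x, s). s * mean2 axial_dir axial_dir x s)"
      unfolding case_prod_beta
      by (intro continuous_on_mult mean2_cont_compose cont_dirs continuous_on_fst continuous_on_snd continuous_on_id)
         (use U in auto)
  qed (use e in auto)
  moreover have "at x0 within ?U = at x0" using e(1) by (intro at_within_open) auto
  ultimately have vert: "((\<lambda>x. integral {r..4} (flux x)) has_real_derivative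
     integral {r..4} (\<lambda>s. s * mean2 axial_dir axial_dir x0 s)) (at x0)" by simp
  have "((\<lambda>s. - (s * mean2 axial_dir axial_dir x0 s)) has_integral (4 * radial_mean x0 4 - r * radial_mean x0 r)) {r..4}"
  proof (rule fundamental_theorem_of_calculus)
    fix s assume s: "s \<in> {r..4}"
    then have Ds: "(x0, s) \<in> D" using D_up[OF D] r by auto
    have "((\<lambda>s. s * radial_mean x0 s) has_real_derivative (1 * radial_mean x0 s + mean2 radial_dir radial_dir x0 s * s)) (at s)"
      by (rule DERIV_mult[OF DERIV_ident mean_deriv_r[OF cont_dirs(2) Ds]])
    also have "1 * radial_mean x0 s + mean2 radial_dir radial_dir x0 s * s = - (s * mean2 axial_dir axial_dir x0 s)"
      using mean_continuity_equation[OF Ds] by (simp add: mult.commute)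
    finally show "((\<lambda>s. s * radial_mean x0 s) has_vector_derivative - (s * mean2 axial_dir axial_dir x0 s)) (at s within {r..4})"
      by (simp add: has_real_derivative_iff_has_vector_derivative[symmetric] has_field_derivative_at_within)
  qed (use r in simp)
  from integral_unique[OF has_integral_neg[OF this]]
  have "integral {r..4} (\<lambda>s. s * mean2 axial_dir axial_dir x0 s) = - (4 * radial_mean x0 4 - r * radial_mean x0 r)" by simp
  with vert have vert': "((\<lambda>x. integral {r..4} (flux x)) has_real_derivative - (4 * radial_mean x0 4 - r * radial_mean x0 r)) (at x0)"
    by simp
  show ?thesis unfolding psi_def
    by (rule DERIV_cong[OF DERIV_diff[OF DERIV_diff[OF DERIV_const DERIV_cmult[OF top]] vert']]) simp
qed

text \<open>The outer edges of this rectangle have distance between \<open>4\<close> and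
  \<open>4 * sqrt 2 < 6\<close> from the origin, hence lie in the shell of
  \<open>G_bound\<close>.\<close>

definition Q :: "(real \<times> real) set" where
  "Q = Dc \<inter> {(x, r). -4 \<le> x \<and> x \<le> 4 \<and> 0 \<le> r \<and> r \<le> 4}"

lemma compact_Q: "compact Q"
proof -
  have "{(x, r). -4 \<le> x \<and> x \<le> 4 \<and> 0 \<le> r \<and> r \<le> (4::real)} = cbox (-4::real, 0) (4, 4)" by auto
  then show ?thesis unfolding Q_def using closed_Int_compact[OF closed_Dc compact_cbox] by simp
qed

lemma psi_cont: "continuous_on Q (\<lambda>(x, r). psi x r)"
proof -
  have "continuous_on {-4..4} (\<lambda>x. integral {-4..x} (\<lambda>t. radial_mean t 4))"
    by (rule indefinite_integral_continuous_1[OF integrable_top])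
  then have top: "continuous_on Q (\<lambda>z. integral {-4..fst z} (\<lambda>t. radial_mean t 4))"
    by (rule continuous_on_compose2) (auto simp: Q_def intro: continuous_on_fst continuous_on_id)
  have up: "(x, max r s) \<in> Dc" if "(x, r) \<in> Q" for x r s
    using that Dc_up[of x r "max r s"] by (auto simp: Q_def)
  \<comment> \<open>Continuing the integrand below \<open>r\<close> by its value at \<open>r\<close>
    fixes the interval of integration, so continuity in the parameters applies; the continuation
    adds just \<open>r * flux x r\<close>.\<close>
  have "continuous_on Q (\<lambda>z. integral (cbox 0 4) (\<lambda>s. flux (fst z) (max (snd z) s)))"
    by (rule integral_continuous_on_param)
       (auto simp: case_prod_beta up intro!: cont_flux continuous_on_max continuous_on_fst continuous_on_snd continuous_on_id)
  moreover have "continuous_on Q (\<lambda>z. flux (fst z) (snd z))"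
    by (rule cont_flux) (auto simp: Q_def intro: continuous_on_fst continuous_on_snd continuous_on_id)
  moreover have "integral {r..4} (flux x) = integral (cbox 0 4) (\<lambda>s. flux x (max r s)) - r * flux x r" if z: "(x, r) \<in> Q" for x r
  proof -
    have r: "0 \<le> r" "r \<le> 4" using z by (auto simp: Q_def)
    have "(\<lambda>s. flux x (max r s)) integrable_on {0..4}"
      by (rule integrable_continuous_interval, rule cont_flux)
         (use up[OF z] in \<open>auto intro: continuous_on_max continuous_on_id continuous_on_const\<close>)
    from Henstock_Kurzweil_Integration.integral_combine[OF r this]
    have "integral {0..4} (\<lambda>s. flux x (max r s)) = integral {0..r} (\<lambda>s. flux x (max r s)) + integral {r..4} (\<lambda>s. flux x (max r s))"
      by simp
    also have "integral {0..r} (\<lambda>s. flux x (max r s)) = integral {0..r} (\<lambda>s. flux x r)"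
      by (rule integral_cong) (simp add: max_absorb1)
    also have "integral {r..4} (\<lambda>s. flux x (max r s)) = integral {r..4} (flux x)"
      by (rule integral_cong) (simp add: max_absorb2)
    finally show ?thesis using r by simp
  qed
  ultimately have "continuous_on Q (\<lambda>z. integral {0..4} (flux (-4)) - 4 * integral {-4..fst z} (\<lambda>t. radial_mean t 4) -
      (integral (cbox 0 4) (\<lambda>s. flux (fst z) (max (snd z) s)) - snd z * flux (fst z) (snd z)))"
    using top by (intro continuous_intros)
  then show ?thesis
  proof (rule continuous_on_eq)
    fix z assume "z \<in> Q"
    moreover obtain x r where "z = (x, r)" by (cases z)
    ultimately show "integral {0..4} (flux (-4)) - 4 * integral {-4..fst z} (\<lambda>t. radial_mean t 4) -
      (integral (cbox 0 4) (\<lambda>s. flux (fst z) (max (snd z) s)) - snd z * flux (fst z) (snd z)) = (case z of (x, r) \<Rightarrow> psi x r)"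
      using \<open>\<And>x r. (x, r) \<in> Q \<Longrightarrow> integral {r..4} (flux x) = integral (cbox 0 4) (\<lambda>s. flux x (max r s)) - r * flux x r\<close>[of x r]
      by (simp add: psi_def)
  qed
qed

lemma psi_corner: "psi (-4) 0 = 0"
  by (simp add: psi_def)

text \<open>On the axis the \<open>x\<close>-derivative of \<open>psi\<close> carries the factor
  \<open>r = 0\<close>. The end points may lie on a sphere, where continuity suffices.\<close>

lemma psi_axis:
  assumes ab: "a < b" "-4 \<le> a" "b \<le> 4" and Dc: "\<And>x. a \<le> x \<Longrightarrow> x \<le> b \<Longrightarrow> (x, 0) \<in> Dc"
    and D: "\<And>x. a < x \<Longrightarrow> x < b \<Longrightarrow> (x, 0) \<in> D" and x: "a \<le> x" "x \<le> b"
  shows "psi x 0 = psi a 0"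
proof (cases "a = x")
  case False
  show ?thesis
  proof (rule DERIV_isconst_end[where f="\<lambda>x. psi x 0" and a=a and b=x])
    show "continuous_on {a..x} (\<lambda>x. psi x 0)"
    proof -
      have "continuous_on {a..x} (\<lambda>x. (x, 0::real))" by (intro continuous_on_Pair continuous_on_id continuous_on_const)
      moreover have "(\<lambda>x. (x, 0::real)) ` {a..x} \<subseteq> Q" using ab Dc x by (auto simp: Q_def)
      ultimately show ?thesis using continuous_on_compose2[OF psi_cont] by force
    qed
    show "((\<lambda>x. psi x 0) has_real_derivative 0) (at y)" if "a < y" "y < x" for y
      using psi_deriv_x[of y 0] D[of y] that x ab by simp
  qed (use False x in auto)
qed simp

text \<open>Total differentiability from the two partial derivatives, the one in \<open>r\<close>
  being continuous; it is what the chain rule along circles requires.\<close>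

lemma psi_has_derivative:
  assumes D: "(x0, r0) \<in> D" and r: "0 < r0" "r0 < 4" and x0: "-4 < x0" "x0 < 4"
  shows "((\<lambda>(x, r). psi x r) has_derivative (\<lambda>(tx, tr). tx * - (r0 * radial_mean x0 r0) + tr * (r0 * axial_mean x0 r0))) (at (x0, r0))"
proof -
  obtain e0 where e0: "0 < e0" "\<And>x' r'. \<bar>x' - x0\<bar> < e0 \<Longrightarrow> \<bar>r' - r0\<bar> < e0 \<Longrightarrow> (x', r') \<in> D"
    using open_slice[OF D] by blast
  define e where "e = min e0 (min r0 (4 - r0))"
  have e: "0 < e" using e0 r by (simp add: e_def)
  let ?X = "ball x0 e" and ?Y = "ball r0 e"
  have in_D: "(x, r) \<in> D" "0 < r" "r < 4" if "x \<in> ?X" "r \<in> ?Y" for x r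
    using that e0(2)[of x r] by (auto simp: e_def dist_real_def)
  have px: "((\<lambda>x. psi x r0) has_derivative (*) (- (r0 * radial_mean x0 r0))) (at x0 within ?X)"
    by (rule has_derivative_at_withinI, rule psi_deriv_x[unfolded has_field_derivative_def, OF D])
       (use r x0 in auto)
  have pr: "((\<lambda>r. psi x r) has_derivative blinfun_apply (blinfun_mult_right (r * axial_mean x r))) (at r within ?Y)"
    if "x \<in> ?X" "r \<in> ?Y" for x r
    unfolding blinfun_mult_right.rep_eq
    by (rule has_derivative_at_withinI, rule psi_deriv_r[unfolded has_field_derivative_def, OF in_D[OF that]])
  have "((\<lambda>(x, r). psi x r) has_derivative
      (\<lambda>(tx, tr). (- (r0 * radial_mean x0 r0)) * tx + blinfun_apply (blinfun_mult_right (r0 * axial_mean x0 r0)) tr)) (at (x0, r0) within ?X \<times> ?Y)"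
  proof (rule has_derivative_partialsI[of psi r0 "(*) (- (r0 * radial_mean x0 r0))" x0 ?X ?Y "\<lambda>x r. blinfun_mult_right (r * axial_mean x r)", OF px pr])
    have "continuous_on (?X \<times> ?Y) (\<lambda>z. blinfun_mult_right (flux (fst z) (snd z)))"
    proof (intro bounded_linear.continuous_on[OF bounded_linear_blinfun_mult_right] cont_flux
        continuous_on_fst continuous_on_snd continuous_on_id)
      fix z assume "z \<in> ?X \<times> ?Y"
      then show "(fst z, snd z) \<in> Dc" using in_D(1)[of "fst z" "snd z"] D_subset by auto
    qed
    then have "continuous (at (x0, r0) within ?X \<times> ?Y) (\<lambda>z. blinfun_mult_right (flux (fst z) (snd z)))"
      using e by (auto simp: continuous_on_eq_continuous_within)
    then show "continuous (at (x0, r0) within ?X \<times> ?Y) (\<lambda>(x, r). blinfun_mult_right (r * axial_mean x r))"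
      unfolding flux_def case_prod_beta .
  qed (use e in auto)
  moreover have "at (x0, r0) within ?X \<times> ?Y = at (x0, r0)"
    by (rule at_within_open) (use e in \<open>auto intro: open_Times\<close>)
  moreover have "(\<lambda>(tx, tr). (- (r0 * radial_mean x0 r0)) * tx + blinfun_apply (blinfun_mult_right (r0 * axial_mean x0 r0)) tr) =
      (\<lambda>(tx, tr). tx * - (r0 * radial_mean x0 r0) + tr * (r0 * axial_mean x0 r0))"
    unfolding blinfun_mult_right.rep_eq by (simp only: mult.commute)
  ultimately show ?thesis by (simp only:)
qed

section \<open>Boundary values of the stream function\<close>

definition bc :: "real set" where "bc = {- (1 + \<epsilon>/2), 1 + \<epsilon>/2}"

text \<open>The centres are \<open>2 + \<epsilon>\<close> apart, so the circle of radius
  \<open>1 + \<delta>\<close> keeps distance at least \<open>1 + \<epsilon> - \<delta> > 1\<close>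
  from the other centre.\<close>

lemma circle_Dc:
  assumes b: "b \<in> bc" and d: "0 \<le> \<delta>" "\<delta> \<le> \<epsilon>/2"
  shows "(b + (1 + \<delta>) * cos \<phi>, (1 + \<delta>) * sin \<phi>) \<in> Dc"
    and "0 < \<delta> \<Longrightarrow> (b + (1 + \<delta>) * cos \<phi>, (1 + \<delta>) * sin \<phi>) \<in> D"
proof -
  let ?x = "b + (1 + \<delta>) * cos \<phi>" and ?r = "(1 + \<delta>) * sin \<phi>"
  have cs: "(cos \<phi>)^2 + (sin \<phi>)^2 = 1" by simp
  have own: "(?x - b)^2 + ?r^2 = (1 + \<delta>)^2"
    using cs by (simp only: add_diff_cancel_left' power_mult_distrib distrib_left[symmetric] mult_1_right)
  have "(?x + b)^2 + ?r^2 = (2 * b)^2 + 2 * (2 * b) * ((1 + \<delta>) * cos \<phi>) + (1 + \<delta>)^2 * ((cos \<phi>)^2 + (sin \<phi>)^2)"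
    by (simp add: power2_eq_square algebra_simps del: sin_cos_squared_add sin_cos_squared_add2 sin_cos_squared_add3)
  also have "\<dots> \<ge> (2 * b)^2 - 2 * \<bar>2 * b\<bar> * (1 + \<delta>) + (1 + \<delta>)^2"
  proof -
    have "\<bar>2 * (2 * b) * ((1 + \<delta>) * cos \<phi>)\<bar> = 2 * \<bar>2 * b\<bar> * (1 + \<delta>) * \<bar>cos \<phi>\<bar>"
      using d by (simp add: abs_mult)
    also have "\<dots> \<le> 2 * \<bar>2 * b\<bar> * (1 + \<delta>) * 1" using d by (intro mult_left_mono) auto
    finally show ?thesis unfolding cs by linarith
  qed
  finally have "(\<bar>2 * b\<bar> - (1 + \<delta>))^2 \<le> (?x + b)^2 + ?r^2" by (simp add: power2_diff)
  moreover have "\<bar>2 * b\<bar> - (1 + \<delta>) = 1 + \<epsilon> - \<delta>" using b eps by (auto simp: bc_def)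
  ultimately have other: "(1 + \<epsilon> - \<delta>)^2 \<le> (?x + b)^2 + ?r^2" by (simp only:)
  have "1^2 < (1 + \<epsilon> - \<delta>)^2" using d eps by (intro power_strict_mono) auto
  then have o: "1 < (?x + b)^2 + ?r^2" using other by simp
  define a where "a = 1 + \<epsilon>/2"
  have b': "b = - a \<or> b = a" using b by (simp add: bc_def a_def)
  have inD: "1 \<le> (x - b)^2 + r^2 \<Longrightarrow> 1 < (x + b)^2 + r^2 \<Longrightarrow> (x, r) \<in> Dc"
    "1 < (x - b)^2 + r^2 \<Longrightarrow> 1 < (x + b)^2 + r^2 \<Longrightarrow> (x, r) \<in> D" for x r
    using b' unfolding Dc_def D_def a_def[symmetric] by auto
  have "1^2 \<le> (1 + \<delta>)^2" using d by (intro power_mono) auto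
  then have "1 \<le> (?x - b)^2 + ?r^2" unfolding own by simp
  then show "(?x, ?r) \<in> Dc" using o by (rule inD(1))
  assume "0 < \<delta>"
  then have "1^2 < (1 + \<delta>)^2" by (intro power_strict_mono) auto
  then have "1 < (?x - b)^2 + ?r^2" unfolding own by simp
  then show "(?x, ?r) \<in> D" using o by (rule inD(2))
qed

lemma circle_range:
  assumes "b \<in> bc" "0 \<le> \<delta>" "\<delta> \<le> \<epsilon>/2"
  shows "- 4 < b + (1 + \<delta>) * cos \<phi>" "b + (1 + \<delta>) * cos \<phi> < 4" "(1 + \<delta>) * sin \<phi> < 4" "\<bar>(1 + \<delta>) * sin \<phi>\<bar> \<le> 2"
proof -
  define e where "e = \<epsilon> / 2"
  have e: "\<delta> \<le> e" "e < 1" using assms eps by (auto simp: e_def)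
  have *: "- 4 < b + A" "b + A < 4" "A < 4" "\<bar>A\<bar> \<le> 2" if "\<bar>A\<bar> \<le> 1 + \<delta>" for A
  proof -
    have "\<bar>A\<bar> < 2" using that e by simp
    moreover have "\<bar>b\<bar> = 1 + e" using assms eps by (auto simp: bc_def e_def)
    then have "\<bar>b\<bar> < 2" using e by simp
    ultimately show "- 4 < b + A" "b + A < 4" "A < 4" "\<bar>A\<bar> \<le> 2" by (auto simp: abs_less_iff)
  qed
  have "\<bar>(1 + \<delta>) * cos \<phi>\<bar> \<le> (1 + \<delta>) * 1" "\<bar>(1 + \<delta>) * sin \<phi>\<bar> \<le> (1 + \<delta>) * 1"
    unfolding abs_mult using assms by (auto intro!: mult_mono)
  then show "- 4 < b + (1 + \<delta>) * cos \<phi>" "b + (1 + \<delta>) * cos \<phi> < 4" "(1 + \<delta>) * sin \<phi> < 4" "\<bar>(1 + \<delta>) * sin \<phi>\<bar> \<le> 2"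
    using *[of "(1 + \<delta>) * cos \<phi>"] *[of "(1 + \<delta>) * sin \<phi>"] by (simp_all only: mult_1_right)
qed

lemma circle_Q:
  assumes "b \<in> bc" "0 \<le> \<delta>" "\<delta> \<le> \<epsilon>/2" "0 \<le> \<phi>" "\<phi> \<le> pi"
  shows "(b + (1 + \<delta>) * cos \<phi>, (1 + \<delta>) * sin \<phi>) \<in> Q"
  using circle_Dc(1)[OF assms(1-3), of \<phi>] circle_range[OF assms(1-3), of \<phi>] sin_ge_zero[OF assms(4,5)] assms(2)
  by (auto simp: Q_def)

definition normal_mean :: "real \<Rightarrow> real \<Rightarrow> real \<Rightarrow> real" where
  "normal_mean b \<delta> \<phi> = cos \<phi> * axial_mean (b + (1 + \<delta>) * cos \<phi>) ((1 + \<delta>) * sin \<phi>) +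
     sin \<phi> * radial_mean (b + (1 + \<delta>) * cos \<phi>) ((1 + \<delta>) * sin \<phi>)"

lemma normal_mean_0:
  assumes b: "b \<in> bc"
  shows "normal_mean b 0 \<phi> = 0"
proof -
  let ?x = "b + (1 + 0) * cos \<phi>" and ?r = "(1 + 0) * sin \<phi>"
  have Dc: "(?x, ?r) \<in> Dc" using circle_Dc(1)[OF b, of 0 \<phi>] eps by simp
  define c where "c = (if b = 1 + \<epsilon>/2 then center2 \<epsilon> else center1 \<epsilon>)"
  have c: "c \<in> {center1 \<epsilon>, center2 \<epsilon>}" "c $ 1 = b" "c $ 2 = 0" "c $ 3 = 0"
    using b by (auto simp: c_def bc_def)
  have zero: "cos \<phi> * (axial_dir \<theta> \<bullet> G (merid ?x ?r \<theta>)) + sin \<phi> * (radial_dir \<theta> \<bullet> G (merid ?x ?r \<theta>)) = 0" for \<theta>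
  proof -
    have "(norm (merid ?x ?r \<theta> - c))^2 = (cos \<phi>)^2 + (sin \<phi>)^2 * ((cos \<theta>)^2 + (sin \<theta>)^2)"
      unfolding norm3_sq by (simp add: c power_mult_distrib distrib_left del: sin_cos_squared_add sin_cos_squared_add2 sin_cos_squared_add3)
    then have "norm (merid ?x ?r \<theta> - c) = 1" by (simp add: power2_eq_1_iff) (metis norm_ge_zero neg_0_le_iff_le not_one_le_zero)
    then have "dist c (merid ?x ?r \<theta>) = 1" by (simp add: dist_norm norm_minus_commute)
    from neumann[OF c(1) this] show ?thesis by (simp add: inner_3 c algebra_simps)
  qed
  have "((\<lambda>\<theta>. cos \<phi> * (axial_dir \<theta> \<bullet> G (merid ?x ?r \<theta>)) + sin \<phi> * (radial_dir \<theta> \<bullet> G (merid ?x ?r \<theta>))) has_integral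
      normal_mean b 0 \<phi>) (cbox 0 (2*pi))"
    unfolding normal_mean_def using Dc cont_dirs
    by (intro has_integral_add has_integral_mult_right mean_has_integral)
  then have "((\<lambda>\<theta>. 0) has_integral normal_mean b 0 \<phi>) (cbox 0 (2*pi))" unfolding zero .
  then show ?thesis by simp
qed

text \<open>The gradient of \<open>psi\<close> is \<open>r\<close> times the mean gradient turned by
  a right angle, so differentiating along the circle yields \<open>r\<close> times the mean normal
  derivative, times the speed \<open>1 + \<delta>\<close>.\<close>

lemma psi_circle_deriv:
  assumes b: "b \<in> bc" and d: "0 < \<delta>" "\<delta> \<le> \<epsilon>/2" and \<phi>: "0 < \<phi>" "\<phi> < pi"
  shows "((\<lambda>\<phi>. psi (b + (1 + \<delta>) * cos \<phi>) ((1 + \<delta>) * sin \<phi>)) has_real_derivative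
     (1 + \<delta>) * ((1 + \<delta>) * sin \<phi>) * normal_mean b \<delta> \<phi>) (at \<phi>)"
proof -
  let ?x = "b + (1 + \<delta>) * cos \<phi>" and ?r = "(1 + \<delta>) * sin \<phi>"
  have curve: "((\<lambda>\<phi>. (b + (1 + \<delta>) * cos \<phi>, (1 + \<delta>) * sin \<phi>)) has_derivative
     (\<lambda>h. (h * (- (1 + \<delta>) * sin \<phi>), h * ((1 + \<delta>) * cos \<phi>)))) (at \<phi>)"
    by (intro has_derivative_Pair) (auto intro!: derivative_eq_intros simp: fun_eq_iff algebra_simps)
  have "0 < ?r" using d sin_gt_zero[OF \<phi>] by simp
  from psi_has_derivative[OF circle_Dc(2)[OF b less_imp_le[OF d(1)] d(2,1)] this]
  have "((\<lambda>(x, r). psi x r) has_derivative (\<lambda>(tx, tr). tx * - (?r * radial_mean ?x ?r) + tr * (?r * axial_mean ?x ?r))) (at (?x, ?r))"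
    using circle_range[OF b less_imp_le[OF d(1)] d(2), of \<phi>] by blast
  from has_derivative_compose[OF curve this]
  have "((\<lambda>\<phi>. psi (b + (1 + \<delta>) * cos \<phi>) ((1 + \<delta>) * sin \<phi>)) has_derivative
     (\<lambda>h. h * (- (1 + \<delta>) * sin \<phi>) * - (?r * radial_mean ?x ?r) + h * ((1 + \<delta>) * cos \<phi>) * (?r * axial_mean ?x ?r))) (at \<phi>)"
    by simp
  moreover have "(\<lambda>h. h * (- (1 + \<delta>) * sin \<phi>) * - (?r * radial_mean ?x ?r) + h * ((1 + \<delta>) * cos \<phi>) * (?r * axial_mean ?x ?r)) =
      (*) ((1 + \<delta>) * ?r * normal_mean b \<delta> \<phi>)"
    unfolding normal_mean_def fun_eq_iff by algebra
  ultimately show ?thesis unfolding has_field_derivative_def by simp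
qed

text \<open>The derivative is controlled on concentric circles of radius \<open>1 + \<delta>\<close>, because the second derivatives
  need not extend to the boundary.\<close>

lemma psi_circle:
  assumes b: "b \<in> bc" and \<phi>: "0 \<le> \<phi>" "\<phi> \<le> pi"
  shows "psi (b + cos \<phi>) (sin \<phi>) = psi (b + 1) 0"
proof -
  define h where "h \<delta> = psi (b + (1 + \<delta>) * cos \<phi>) ((1 + \<delta>) * sin \<phi>) - psi (b + (1 + \<delta>) * cos 0) ((1 + \<delta>) * sin 0)" for \<delta>
  have psi_curve: "continuous_on S (\<lambda>z. psi (b + (1 + f z) * cos (g z)) ((1 + f z) * sin (g z)))"
    if "continuous_on S f" "continuous_on S g" "\<And>z. z \<in> S \<Longrightarrow> 0 \<le> f z \<and> f z \<le> \<epsilon>/2 \<and> 0 \<le> g z \<and> g z \<le> pi"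
    for f g and S :: "real set"
  proof -
    have "continuous_on S (\<lambda>z. (b + (1 + f z) * cos (g z), (1 + f z) * sin (g z)))"
      using that(1,2) by (intro continuous_on_Pair continuous_on_add continuous_on_mult continuous_on_const continuous_on_cos continuous_on_sin)
    from continuous_on_compose2[OF psi_cont this] show ?thesis
      using circle_Q[OF b] that(3) by (auto simp: image_subset_iff)
  qed
  have hc: "continuous_on {0..\<epsilon>/2} h" unfolding h_def
    by (intro continuous_on_diff psi_curve continuous_on_id continuous_on_const) (use \<phi> in auto)
  have "\<bar>h 0\<bar> \<le> 0"
  proof (rule field_le_epsilon)
    fix \<eta> :: real assume "0 < \<eta>"
    \<comment> \<open>The arc has angle at most \<open>pi\<close>, and the factor of
      \<open>normal_mean\<close> in the derivative is at most \<open>2 * 2\<close>.\<close>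
    define \<eta>' where "\<eta>' = \<eta> / (4 * pi)"
    have \<eta>': "0 < \<eta>'" using \<open>0 < \<eta>\<close> by (simp add: \<eta>'_def)
    let ?R = "{0..\<epsilon>/2} \<times> {0..pi}"
    \<comment> \<open>Uniform continuity carries the zero of \<open>normal_mean\<close> at
      \<open>\<delta> = 0\<close> to all nearby circles at a rate independent of the angle.\<close>
    have "continuous_on ?R (\<lambda>z. normal_mean b (fst z) (snd z))"
      unfolding normal_mean_def
      by (intro continuous_on_add continuous_on_mult mean_cont_compose cont_dirs continuous_on_cos continuous_on_sin
           continuous_on_fst continuous_on_snd continuous_on_id continuous_on_const)
         (use circle_Dc(1)[OF b] in auto)
    moreover have "compact ?R" by (intro compact_Times) auto
    ultimately have "uniformly_continuous_on ?R (\<lambda>z. normal_mean b (fst z) (snd z))"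
      by (rule compact_uniformly_continuous)
    then obtain d where d: "0 < d" "\<And>z z'. z \<in> ?R \<Longrightarrow> z' \<in> ?R \<Longrightarrow> dist z' z < d \<Longrightarrow>
        dist (normal_mean b (fst z') (snd z')) (normal_mean b (fst z) (snd z)) < \<eta>'"
      using \<eta>' unfolding uniformly_continuous_on_def by blast
    have small: "\<bar>normal_mean b \<delta> t\<bar> \<le> \<eta>'" if "0 < \<delta>" "\<delta> < d" "\<delta> \<le> \<epsilon>/2" "0 \<le> t" "t \<le> pi" for \<delta> t
      using d(2)[of "(0, t)" "(\<delta>, t)"] normal_mean_0[OF b, of t] that by (simp add: dist_Pair_Pair dist_real_def)
    have "\<bar>h \<delta>\<bar> \<le> \<eta>" if \<delta>: "0 < \<delta>" "\<delta> < d" "\<delta> \<le> \<epsilon>/2" for \<delta>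
    proof (cases "\<phi> = 0")
      case True
      then show ?thesis using \<open>0 < \<eta>\<close> by (simp add: h_def)
    next
      case False
      then have "0 < \<phi>" using \<phi> by simp
      let ?f = "\<lambda>\<phi>. psi (b + (1 + \<delta>) * cos \<phi>) ((1 + \<delta>) * sin \<phi>)"
      have "\<exists>l z. 0 < z \<and> z < \<phi> \<and> (?f has_real_derivative l) (at z) \<and> ?f \<phi> - ?f 0 = (\<phi> - 0) * l"
      proof (rule MVT[OF \<open>0 < \<phi>\<close>])
        show "continuous_on {0..\<phi>} ?f"
          by (intro psi_curve continuous_on_id continuous_on_const) (use \<delta> \<phi> in auto)
        show "?f differentiable (at z)" if "0 < z" "z < \<phi>" for z
          using psi_circle_deriv[OF b \<delta>(1,3), of z] that \<phi> real_differentiable_def by auto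
      qed
      then obtain l z where z: "0 < z" "z < \<phi>" "(?f has_real_derivative l) (at z)" "h \<delta> = \<phi> * l"
        by (auto simp: h_def)
      have "l = (1 + \<delta>) * ((1 + \<delta>) * sin z) * normal_mean b \<delta> z"
        by (rule DERIV_unique[OF z(3) psi_circle_deriv[OF b \<delta>(1,3)]]) (use z \<phi> in auto)
      moreover have "\<bar>normal_mean b \<delta> z\<bar> \<le> \<eta>'" using small[OF \<delta>, of z] z \<phi> by simp
      moreover have "\<bar>(1 + \<delta>) * ((1 + \<delta>) * sin z)\<bar> \<le> 2 * 2"
        unfolding abs_mult[of "1 + \<delta>"] using circle_range(4)[OF b less_imp_le[OF \<delta>(1)] \<delta>(3), of z] \<delta> eps
        by (intro mult_mono) (auto simp: abs_mult)
      ultimately have "\<bar>l\<bar> \<le> (2 * 2) * \<eta>'" unfolding abs_mult[of _ "normal_mean b \<delta> z"] by (auto simp only: abs_mult intro!: mult_mono)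
      then have "\<bar>\<phi>\<bar> * \<bar>l\<bar> \<le> pi * ((2 * 2) * \<eta>')" using \<phi> by (intro mult_mono) auto
      then show ?thesis by (simp add: z(4) abs_mult \<eta>'_def)
    qed
    then have ev: "\<forall>\<^sub>F \<delta> in at_right 0. \<bar>h \<delta>\<bar> \<le> \<eta>"
      unfolding eventually_at_right_field using d(1) eps by (intro exI[of _ "min d (\<epsilon>/2)"]) auto
    have "(h \<longlongrightarrow> h 0) (at 0 within {0..\<epsilon>/2})"
      using hc eps by (auto simp: continuous_on)
    then have "(h \<longlongrightarrow> h 0) (at_right 0)"
      using at_within_Icc_at_right[of 0 "\<epsilon>/2"] eps by simp
    from tendsto_upperbound[OF tendsto_rabs[OF this] ev] show "\<bar>h 0\<bar> \<le> 0 + \<eta>" by simp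
  qed
  then show ?thesis by (simp add: h_def)
qed

text \<open>The zero at the corner is handed on along a connected chain: left piece of the axis,
  first half circle, gap, second half circle, right piece of the axis.\<close>

lemma psi_boundary:
  assumes Q: "(x, r) \<in> Q" and b: "r = 0 \<or> (x, r) \<notin> D"
  shows "psi x r = 0"
proof -
  let ?a = "1 + \<epsilon>/2"
  have bcs: "- ?a \<in> bc" "?a \<in> bc" by (auto simp: bc_def)
  have Dc0: "(y, 0) \<in> Dc \<longleftrightarrow> 1 \<le> \<bar>y + ?a\<bar> \<and> 1 \<le> \<bar>y - ?a\<bar>" "(y, 0) \<in> D \<longleftrightarrow> 1 < \<bar>y + ?a\<bar> \<and> 1 < \<bar>y - ?a\<bar>" for y
  proof -
    have "1 \<le> t^2 \<longleftrightarrow> 1 \<le> \<bar>t\<bar>" "1 < t^2 \<longleftrightarrow> 1 < \<bar>t\<bar>" for t :: real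
      using abs_le_square_iff[of 1 t] abs_le_square_iff[of t 1] by auto
    then show "(y, 0) \<in> Dc \<longleftrightarrow> 1 \<le> \<bar>y + ?a\<bar> \<and> 1 \<le> \<bar>y - ?a\<bar>" "(y, 0) \<in> D \<longleftrightarrow> 1 < \<bar>y + ?a\<bar> \<and> 1 < \<bar>y - ?a\<bar>"
      by (simp_all add: Dc_def D_def)
  qed
  have left: "psi y 0 = 0" if "-4 \<le> y" "y \<le> - ?a - 1" for y
    using psi_axis[of "-4" "- ?a - 1" y] psi_corner that eps unfolding Dc0 by auto
  have c1: "psi (- ?a + cos t) (sin t) = 0" if "0 \<le> t" "t \<le> pi" for t
    using psi_circle[OF bcs(1) that] psi_circle[OF bcs(1), of pi] left[of "- ?a - 1"] eps by simp
  have gap: "psi y 0 = 0" if "- ?a + 1 \<le> y" "y \<le> ?a - 1" for y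
    using psi_axis[of "- ?a + 1" "?a - 1" y] c1[of 0] that eps unfolding Dc0 by auto
  have c2: "psi (?a + cos t) (sin t) = 0" if "0 \<le> t" "t \<le> pi" for t
    using psi_circle[OF bcs(2) that] psi_circle[OF bcs(2), of pi] gap[of "?a - 1"] eps by simp
  have right: "psi y 0 = 0" if "?a + 1 \<le> y" "y \<le> 4" for y
    using psi_axis[of "?a + 1" 4 y] c2[of 0] that eps unfolding Dc0 by auto
  show ?thesis
  proof (cases "r = 0")
    case True
    then have "(x, 0) \<in> Dc" "-4 \<le> x" "x \<le> 4" using Q by (auto simp: Q_def)
    then have "x \<le> - ?a - 1 \<or> (- ?a + 1 \<le> x \<and> x \<le> ?a - 1) \<or> ?a + 1 \<le> x"
      unfolding Dc0 by (auto simp: abs_if split: if_splits)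
    then show ?thesis using left gap right True \<open>-4 \<le> x\<close> \<open>x \<le> 4\<close> by blast
  next
    case False
    have r: "0 \<le> r" using Q by (simp add: Q_def)
    have "(x + ?a)^2 + r^2 = 1 \<or> (x - ?a)^2 + r^2 = 1"
      using Q b False by (auto simp: Q_def D_def Dc_def)
    moreover have "\<exists>t. 0 \<le> t \<and> t \<le> pi \<and> y = cos t \<and> r = sin t" if "y^2 + r^2 = 1" for y
    proof -
      have "y^2 \<le> 1" using that by (metis le_add_same_cancel1 zero_le_power2)
      then have y: "\<bar>y\<bar> \<le> 1" by (simp add: abs_square_le_1)
      have "r^2 = 1 - y^2" using that by simp
      then have "r = sqrt (1 - y^2)" using r by (metis real_sqrt_unique)
      then show ?thesis using y
        by (intro exI[of _ "arccos y"]) (auto simp: arccos_lbound arccos_ubound cos_arccos sin_arccos abs_le_iff)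
    qed
    ultimately consider t where "0 \<le> t" "t \<le> pi" "x + ?a = cos t" "r = sin t" | t where "0 \<le> t" "t \<le> pi" "x - ?a = cos t" "r = sin t"
      by blast
    then show ?thesis
    proof cases
      case (1 t)
      then have "x = - ?a + cos t" by linarith
      then show ?thesis using c1[OF 1(1,2)] 1(4) by (simp only:)
    next
      case (2 t)
      then have "x = ?a + cos t" by linarith
      then show ?thesis using c2[OF 2(1,2)] 2(4) by (simp only:)
    qed
  qed
qed

section \<open>Bounds for the stream function\<close>

lemma L_nonneg: "0 \<le> L"
proof -
  have "\<bar>G (4 *\<^sub>R axis 1 1) $ 1\<bar> \<le> L" by (rule G_bound) simp_all
  then show ?thesis by (rule order_trans[OF abs_ge_zero])
qed

lemma outer_mean_bound:
  assumes "(x, r) \<in> Dc" "16 \<le> x^2 + r^2" "x^2 + r^2 \<le> 36"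
  shows "\<bar>axial_mean x r\<bar> \<le> 2 * pi * L" "\<bar>radial_mean x r\<bar> \<le> 4 * pi * L"
proof -
  have GL: "\<bar>G (merid x r \<theta>) $ i\<bar> \<le> L" for i \<theta>
  proof (rule G_bound)
    have "(norm (merid x r \<theta>))^2 = x^2 + r^2 * ((cos \<theta>)^2 + (sin \<theta>)^2)"
      unfolding norm3_sq merid_component power_mult_distrib by (simp only: distrib_left add.assoc)
    also have "\<dots> = x^2 + r^2" by simp
    finally have n: "4^2 \<le> (norm (merid x r \<theta>))^2" "(norm (merid x r \<theta>))^2 \<le> 6^2"
      using assms(2,3) by simp_all
    show "4 \<le> norm (merid x r \<theta>)" by (rule power2_le_imp_le[OF n(1)]) simp
    show "norm (merid x r \<theta>) \<le> 6" by (rule power2_le_imp_le[OF n(2)]) simp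
  qed
  have "norm (axial_mean x r) \<le> L * measure lborel (cbox 0 (2*pi))"
    by (rule has_integral_bound[OF L_nonneg mean_has_integral[OF cont_dirs(1) assms(1)]])
       (simp add: inner_3 GL)
  then show "\<bar>axial_mean x r\<bar> \<le> 2 * pi * L" by (simp add: mult_ac)
  have "norm (radial_mean x r) \<le> (2 * L) * measure lborel (cbox 0 (2*pi))"
  proof (rule has_integral_bound[OF _ mean_has_integral[OF cont_dirs(2) assms(1)]])
    fix \<theta>
    have "\<bar>cos \<theta> * G (merid x r \<theta>) $ 2\<bar> \<le> 1 * L" "\<bar>sin \<theta> * G (merid x r \<theta>) $ 3\<bar> \<le> 1 * L"
      unfolding abs_mult by (intro mult_mono GL abs_cos_le_one abs_sin_le_one; simp)+
    then show "norm (radial_dir \<theta> \<bullet> G (merid x r \<theta>)) \<le> 2 * L" by (simp add: inner_3)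
  qed (use L_nonneg in simp)
  then show "\<bar>radial_mean x r\<bar> \<le> 4 * pi * L" by (simp add: mult_ac)
qed

lemma psi_from_axis:
  assumes "(x, 0) \<in> Dc" "0 \<le> r" "r \<le> 4"
  shows "psi x r = psi x 0 + integral {0..r} (flux x)"
  using Henstock_Kurzweil_Integration.integral_combine[OF assms(2,3) integrable_flux[OF assms(1)]] by (simp add: psi_def)

lemma linear_has_integral: "0 \<le> r \<Longrightarrow> ((\<lambda>s. c * s) has_integral c * r^2 / 2) {0..r::real}"
proof -
  assume "0 \<le> r"
  have "((\<lambda>s. c * s) has_integral (c * r^2 / 2 - c * 0^2 / 2)) {0..r}"
    by (rule fundamental_theorem_of_calculus[OF \<open>0 \<le> r\<close>])
       (auto intro!: derivative_eq_intros simp: has_real_derivative_iff_has_vector_derivative[symmetric])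
  then show ?thesis by simp
qed

lemma side_Dc:
  assumes x: "\<bar>x\<bar> = 4"
  shows "(x, 0) \<in> Dc"
proof -
  have "1 + \<epsilon>/2 \<le> 2" using eps by simp
  then have "1 \<le> \<bar>x + (1 + \<epsilon>/2)\<bar>" "1 \<le> \<bar>x - (1 + \<epsilon>/2)\<bar>" using x eps by (auto simp: abs_if split: if_splits)
  then show ?thesis
    unfolding Dc_def using abs_le_square_iff[of 1 "x + (1 + \<epsilon>/2)"] abs_le_square_iff[of 1 "x - (1 + \<epsilon>/2)"] by simp
qed

lemma side_flux_bound:
  assumes x: "\<bar>x\<bar> = 4" and r: "0 \<le> r" "r \<le> 4"
  shows "\<bar>integral {0..r} (flux x)\<bar> \<le> pi * L * r^2"
proof -
  have x2: "x^2 = 16" using power2_abs[of x] x by simp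
  note Dc = side_Dc[OF x]
  have "norm (integral {0..r} (flux x)) \<le> integral {0..r} (\<lambda>s. 2 * pi * L * s)"
  proof (rule integral_norm_bound_integral)
    show "(\<lambda>s. 2 * pi * L * s) integrable_on {0..r}"
      using linear_has_integral[OF r(1)] by blast
    fix s assume s: "s \<in> {0..r}"
    then have "s^2 \<le> 4^2" using r by (intro power_mono) auto
    then have "\<bar>axial_mean x s\<bar> \<le> 2 * pi * L" using Dc_up[OF Dc, of s] s x2 by (intro outer_mean_bound) auto
    then have "s * \<bar>axial_mean x s\<bar> \<le> s * (2 * pi * L)" using s by (intro mult_left_mono) auto
    then show "norm (flux x s) \<le> 2 * pi * L * s" using s by (simp add: flux_def abs_mult mult_ac)
  qed (rule integrable_flux[OF Dc order_refl])
  also have "\<dots> = pi * L * r^2" using integral_unique[OF linear_has_integral[OF r(1), of "2 * pi * L"]] by simp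
  finally show ?thesis by simp
qed

text \<open>On the vertical sides \<open>psi\<close> starts from zero on the axis, which gives
  \<open>pi * L * r^2\<close>. On the top the two integrals give
  \<open>16 * pi * L + 128 * pi * L = 9 * pi * L * 4^2\<close>: hence the 9.\<close>

lemma psi_outer:
  assumes Q: "(x, r) \<in> Q" and outer: "\<bar>x\<bar> = 4 \<or> r = 4"
  shows "\<bar>psi x r\<bar> \<le> 9 * pi * L * r^2"
proof -
  have r: "0 \<le> r" "r \<le> 4" and x: "-4 \<le> x" "x \<le> 4" using Q by (auto simp: Q_def)
  have side: "\<bar>psi x r\<bar> \<le> pi * L * r^2" if "\<bar>x\<bar> = 4"
  proof -
    note Dc = side_Dc[OF that]
    then have "psi x 0 = 0" by (intro psi_boundary) (use x in \<open>auto simp: Q_def\<close>)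
    then show ?thesis using psi_from_axis[OF Dc r] side_flux_bound[OF that r] by simp
  qed
  show ?thesis
  proof (cases "\<bar>x\<bar> = 4")
    case True
    have "pi * L * r^2 \<le> 9 * (pi * L * r^2)" using L_nonneg by simp
    then show ?thesis using side[OF True] by simp
  next
    case False
    then have "r = 4" using outer by simp
    have k: "\<bar>integral {0..4} (flux (-4))\<bar> \<le> 16 * pi * L" using side_flux_bound[of "-4" 4] by simp
    have "norm (integral {-4..x} (\<lambda>t. radial_mean t 4)) \<le> 4 * pi * L * (x - -4)"
    proof (rule integral_bound)
      show "continuous_on {-4..x} (\<lambda>t. radial_mean t 4)"
        by (rule mean_cont_compose) (use D_top cont_dirs in \<open>auto intro: continuous_on_id continuous_on_const\<close>)
      fix t assume "t \<in> {-4..x}"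
      then have "\<bar>t\<bar>^2 \<le> 4^2" using x by (intro power_mono) auto
      then show "norm (radial_mean t 4) \<le> 4 * pi * L"
        using outer_mean_bound(2)[OF D_top(2), of t] by simp
    qed (use x in auto)
    also have "\<dots> \<le> 4 * pi * L * 8" using L_nonneg x by (intro mult_left_mono) auto
    finally have "\<bar>4 * integral {-4..x} (\<lambda>t. radial_mean t 4)\<bar> \<le> 128 * pi * L" by simp
    then have "\<bar>integral {0..4} (flux (-4))\<bar> + \<bar>4 * integral {-4..x} (\<lambda>t. radial_mean t 4)\<bar> \<le> 16 * pi * L + 128 * pi * L"
      by (rule add_mono[OF k])
    moreover have "psi x 4 = integral {0..4} (flux (-4)) - 4 * integral {-4..x} (\<lambda>t. radial_mean t 4)"
      by (simp add: psi_def)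
    ultimately have "\<bar>psi x 4\<bar> \<le> 16 * pi * L + 128 * pi * L"
      by (metis abs_triangle_ineq4 order_trans)
    also have "\<dots> = 9 * pi * L * 4^2" by simp
    finally show ?thesis unfolding \<open>r = 4\<close> .
  qed
qed

text \<open>Both \<open>r^2\<close> and constants satisfy \<open>\<psi>\<^sub>x\<^sub>x + \<psi>\<^sub>r\<^sub>r - \<psi>\<^sub>r / r = 0\<close>, the equation of \<open>psi\<close>.\<close>

lemma psi_bound:
  assumes Q: "(x, r) \<in> Q" and \<sigma>: "\<bar>\<sigma>\<bar> = (1::real)"
  shows "\<sigma> * psi x r \<le> 9 * pi * L * r^2"
proof (rule field_le_epsilon)
  fix \<eta> :: real assume "0 < \<eta>"
  define C where "C = 9 * pi * L"
  have C: "0 \<le> C" using L_nonneg by (simp add: C_def)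
  define \<delta> where "\<delta> = \<eta> / 17"
  have \<delta>: "0 < \<delta>" using \<open>0 < \<eta>\<close> by (simp add: \<delta>_def)
  \<comment> \<open>The term with \<delta> makes the comparison strict: it is positive because
    \<open>x^2 \<le> 16\<close> on \<open>Q\<close>, and its second derivative is
    \<open>- 2 * \<delta>\<close>.\<close>
  define f where "f x r = C * r^2 + \<delta> * (17 - x^2) - \<sigma> * psi x r" for x r
  have "continuous_on Q (\<lambda>z. psi (fst z) (snd z))" using psi_cont by (simp add: case_prod_beta)
  then have cf: "continuous_on Q (\<lambda>z. f (fst z) (snd z))" unfolding f_def
    by (intro continuous_on_diff continuous_on_add continuous_on_mult continuous_on_const continuous_on_power
        continuous_on_fst continuous_on_snd continuous_on_id)
  have "Q \<noteq> {}" using Q by blast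
  from continuous_attains_inf[OF compact_Q this cf] obtain z where z: "z \<in> Q" "\<And>y. y \<in> Q \<Longrightarrow> f (fst z) (snd z) \<le> f (fst y) (snd y)"
    by blast
  obtain x0 r0 where z_eq: "z = (x0, r0)" by (cases z)
  have zQ: "(x0, r0) \<in> Q" and min: "\<And>x r. (x, r) \<in> Q \<Longrightarrow> f x0 r0 \<le> f x r"
    using z unfolding z_eq by auto
  have xr: "-4 \<le> x0" "x0 \<le> 4" "0 \<le> r0" "r0 \<le> 4" using zQ by (auto simp: Q_def)
  have "\<bar>x0\<bar>^2 \<le> 4^2" using xr by (intro power_mono) auto
  then have pos: "0 < \<delta> * (17 - x0^2)" using \<delta> by simp
  have "0 \<le> f x0 r0"
  proof (cases "r0 = 0 \<or> (x0, r0) \<notin> D")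
    case True
    then have "psi x0 r0 = 0" by (rule psi_boundary[OF zQ])
    then show ?thesis using pos C by (simp add: f_def)
  next
    case False
    then have D: "(x0, r0) \<in> D" and r0: "0 < r0" using xr by auto
    show ?thesis
    proof (cases "\<bar>x0\<bar> = 4 \<or> r0 = 4")
      case True
      have "\<bar>\<sigma> * psi x0 r0\<bar> \<le> C * r0^2" using psi_outer[OF zQ True] \<sigma> by (simp add: abs_mult C_def)
      then show ?thesis using pos by (simp add: f_def)
    next
      case inner: False
      then have in4: "-4 < x0" "x0 < 4" "r0 < 4" using xr by auto
      obtain e0 where e0: "0 < e0" "\<And>x' r'. \<bar>x' - x0\<bar> < e0 \<Longrightarrow> \<bar>r' - r0\<bar> < e0 \<Longrightarrow> (x', r') \<in> D"
        using open_slice[OF D] by blast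
      define e where "e = Min {e0, r0, 4 - r0, 4 - x0, x0 + 4}"
      have e: "0 < e" using e0(1) r0 in4 by (simp add: e_def)
      have nb: "(x0 + t, r0) \<in> D" "(x0, r0 + t) \<in> D" "(x0 + t, r0) \<in> Q" "(x0, r0 + t) \<in> Q"
        "0 < r0 + t" "r0 + t < 4" "-4 < x0 + t" "x0 + t < 4" if "\<bar>t\<bar> < e" for t
      proof -
        have t: "\<bar>t\<bar> < e0" "\<bar>t\<bar> < r0" "\<bar>t\<bar> < 4 - r0" "\<bar>t\<bar> < 4 - x0" "\<bar>t\<bar> < x0 + 4" using that by (auto simp: e_def)
        show 1: "(x0 + t, r0) \<in> D" "(x0, r0 + t) \<in> D" using e0(2)[of "x0 + t" r0] e0(2)[of x0 "r0 + t"] t(1) e0(1) by simp_all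
        show 2: "0 < r0 + t" "r0 + t < 4" "-4 < x0 + t" "x0 + t < 4" using t by linarith+
        show "(x0 + t, r0) \<in> Q" "(x0, r0 + t) \<in> Q" using 1 2 D_subset xr by (auto simp: Q_def)
      qed
      have ev: "\<forall>\<^sub>F t in nhds 0. \<bar>t\<bar> < e"
        using e by (auto simp: eventually_nhds_metric dist_real_def)
      have shift: "((\<lambda>t. a + t) has_real_derivative 1) (at t)" for a t :: real
        by (auto intro!: derivative_eq_intros)
      have dx: "((\<lambda>t. f (x0 + t) r0) has_real_derivative (- 2 * \<delta> * (x0 + t) + \<sigma> * (r0 * radial_mean (x0 + t) r0))) (at t)"
        if "\<bar>t\<bar> < e" for t
      proof -
        have "((\<lambda>t. psi (x0 + t) r0) has_real_derivative - (r0 * radial_mean (x0 + t) r0) * 1) (at t)"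
          using nb[OF that] xr by (intro DERIV_chain2[OF psi_deriv_x shift]) auto
        then show ?thesis unfolding f_def by (auto intro!: derivative_eq_intros simp: algebra_simps)
      qed
      have dr: "((\<lambda>t. f x0 (r0 + t)) has_real_derivative (2 * C * (r0 + t) - \<sigma> * ((r0 + t) * axial_mean x0 (r0 + t)))) (at t)"
        if "\<bar>t\<bar> < e" for t
      proof -
        have "((\<lambda>t. psi x0 (r0 + t)) has_real_derivative ((r0 + t) * axial_mean x0 (r0 + t)) * 1) (at t)"
          using nb[OF that] by (intro DERIV_chain2[OF psi_deriv_r shift]) auto
        then show ?thesis unfolding f_def by (auto intro!: derivative_eq_intros simp: algebra_simps)
      qed
      have "0 \<le> - 2 * \<delta> + \<sigma> * (r0 * mean2 radial_dir axial_dir x0 r0)"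
      proof (rule second_derivative_test_min)
        show "\<forall>\<^sub>F t in nhds 0. ((\<lambda>t. f (x0 + t) r0) has_real_derivative (- 2 * \<delta> * (x0 + t) + \<sigma> * (r0 * radial_mean (x0 + t) r0))) (at t)"
          by (rule eventually_mono[OF ev]) (rule dx)
        show "\<forall>\<^sub>F t in nhds 0. f (x0 + 0) r0 \<le> f (x0 + t) r0"
          by (rule eventually_mono[OF ev]) (use min nb in simp)
        have "((\<lambda>t. radial_mean (x0 + t) r0) has_real_derivative mean2 radial_dir axial_dir x0 r0 * 1) (at 0)"
          by (rule DERIV_chain2[OF _ shift]) (use mean_deriv_x[OF cont_dirs(2) D] in simp)
        then show "((\<lambda>t. - 2 * \<delta> * (x0 + t) + \<sigma> * (r0 * radial_mean (x0 + t) r0)) has_real_derivative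
            - 2 * \<delta> + \<sigma> * (r0 * mean2 radial_dir axial_dir x0 r0)) (at 0)"
          by (auto intro!: derivative_eq_intros)
      qed
      moreover have "0 \<le> 2 * C - \<sigma> * (axial_mean x0 r0 + r0 * mean2 axial_dir radial_dir x0 r0)"
      proof (rule second_derivative_test_min)
        show "\<forall>\<^sub>F t in nhds 0. ((\<lambda>t. f x0 (r0 + t)) has_real_derivative (2 * C * (r0 + t) - \<sigma> * ((r0 + t) * axial_mean x0 (r0 + t)))) (at t)"
          by (rule eventually_mono[OF ev]) (rule dr)
        show "\<forall>\<^sub>F t in nhds 0. f x0 (r0 + 0) \<le> f x0 (r0 + t)"
          by (rule eventually_mono[OF ev]) (use min nb in simp)
        have "((\<lambda>t. axial_mean x0 (r0 + t)) has_real_derivative mean2 axial_dir radial_dir x0 r0 * 1) (at 0)"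
          by (rule DERIV_chain2[OF _ shift]) (use mean_deriv_r[OF cont_dirs(1) D] in simp)
        then show "((\<lambda>t. 2 * C * (r0 + t) - \<sigma> * ((r0 + t) * axial_mean x0 (r0 + t))) has_real_derivative
            2 * C - \<sigma> * (axial_mean x0 r0 + r0 * mean2 axial_dir radial_dir x0 r0)) (at 0)"
          by (auto intro!: derivative_eq_intros)
      qed
      moreover have "2 * C * r0 - \<sigma> * (r0 * axial_mean x0 r0) = 0"
        using DERIV_local_min[OF dr[of 0] e] e min nb by simp
      then have "\<sigma> * axial_mean x0 r0 = 2 * C" using r0 by (simp add: algebra_simps)
      \<comment> \<open>Adding the two second-order conditions, the mixed terms cancel by the
        symmetry of the Hessian, the first-order condition removes \<open>2 * C\<close>, and
        \<open>0 \<le> - 2 * \<delta>\<close> is left.\<close>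
      ultimately have False
        using \<delta> mean2_mixed[OF D] by (simp add: algebra_simps)
      then show ?thesis ..
    qed
  qed
  then have "0 \<le> f x r" using min[OF Q] by linarith
  moreover have "\<delta> * (17 - x^2) \<le> \<delta> * 17" using \<delta> by (intro mult_left_mono) auto
  ultimately show "\<sigma> * psi x r \<le> 9 * pi * L * r^2 + \<eta>" by (simp add: f_def C_def \<delta>_def)
qed

text \<open>Near the axis \<open>psi x r\<close> behaves like
  \<open>axial_mean x 0 * r^2 / 2\<close>, so the bound \<open>9 * pi * L * r^2\<close> yields twice
  its constant. The intermediate \<open>m\<close> makes this precise without a limit.\<close>

lemma axial_gradient_bound_signed:
  assumes x: "\<bar>x\<bar> < \<epsilon>/2" and \<sigma>: "\<bar>\<sigma>\<bar> = (1::real)"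
  shows "\<sigma> * axial_mean x 0 \<le> 18 * pi * L"
proof (rule ccontr)
  define C where "C = 9 * pi * L"
  assume "\<not> \<sigma> * axial_mean x 0 \<le> 18 * pi * L"
  then have "2 * C < \<sigma> * axial_mean x 0" by (simp add: C_def)
  then obtain m where m: "2 * C < m" "m < \<sigma> * axial_mean x 0" using dense by blast
  have "1 < \<bar>x + (1 + \<epsilon>/2)\<bar>" "1 < \<bar>x - (1 + \<epsilon>/2)\<bar>" using x by (auto simp: abs_if split: if_splits)
  then have D: "(x, 0) \<in> D"
    unfolding D_def using abs_le_square_iff[of "x + (1 + \<epsilon>/2)" 1] abs_le_square_iff[of "x - (1 + \<epsilon>/2)" 1] by auto
  then have Dc: "(x, 0) \<in> Dc" using D_subset by auto
  have "isCont (\<lambda>r. \<sigma> * axial_mean x r) 0"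
    using DERIV_isCont[OF mean_deriv_r[OF cont_dirs(1) D]] by (intro continuous_intros)
  then have "((\<lambda>r. \<sigma> * axial_mean x r) \<longlongrightarrow> \<sigma> * axial_mean x 0) (nhds 0)"
    unfolding isCont_def by (rule tendsto_at_iff_tendsto_nhds[THEN iffD1])
  then have "\<forall>\<^sub>F r in nhds 0. m < \<sigma> * axial_mean x r" using m(2) by (rule order_tendstoD)
  then obtain d where d: "0 < d" "\<And>r. \<bar>r\<bar> < d \<Longrightarrow> m < \<sigma> * axial_mean x r"
    by (auto simp: eventually_nhds_metric dist_real_def)
  define r where "r = min 1 (d/2)"
  have r: "0 < r" "r < d" "r \<le> 4" using d(1) by (auto simp: r_def)
  have "psi x 0 = 0" by (rule psi_boundary) (use Dc x eps in \<open>auto simp: Q_def\<close>)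
  then have "\<sigma> * psi x r = \<sigma> * integral {0..r} (flux x)" using psi_from_axis[OF Dc, of r] r by simp
  also have "\<dots> = integral {0..r} (\<lambda>s. \<sigma> * flux x s)" by simp
  also have "\<dots> \<ge> integral {0..r} (\<lambda>s. m * s)"
  proof (rule integral_le)
    show "(\<lambda>s. m * s) integrable_on {0..r}" using linear_has_integral[of r m] r by auto
    show "(\<lambda>s. \<sigma> * flux x s) integrable_on {0..r}"
      using integrable_on_cmult_left[OF integrable_flux[OF Dc order_refl], of \<sigma> r] by simp
    fix s assume s: "s \<in> {0..r}"
    then have "m < \<sigma> * axial_mean x s" using d(2)[of s] r by auto
    then have "s * m \<le> s * (\<sigma> * axial_mean x s)" using s by (intro mult_left_mono) auto
    then show "m * s \<le> \<sigma> * flux x s" by (simp add: flux_def mult_ac)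
  qed
  also have "integral {0..r} (\<lambda>s. m * s) = m * r^2 / 2" using integral_unique[OF linear_has_integral[of r m]] r by simp
  finally have "m * r^2 / 2 \<le> \<sigma> * psi x r" .
  moreover have "(x, r) \<in> Q" using Dc_up[OF Dc, of r] r x eps by (auto simp: Q_def)
  then have "\<sigma> * psi x r \<le> C * r^2" using psi_bound[OF _ \<sigma>] by (simp add: C_def)
  ultimately have "m * r^2 \<le> (2 * C) * r^2" by simp
  then show False using m(1) r by simp
qed

text \<open>On the axis the circle of integration shrinks to a point, so the angular integral is
  \<open>2 * pi\<close> times the derivative itself and averaging loses nothing.\<close>

lemma axial_gradient_bound:
  assumes x: "\<bar>x\<bar> < \<epsilon>/2"
  shows "\<bar>G (vector [x, 0, 0]) $ 1\<bar> \<le> 9 * L"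
proof -
  have m: "merid x 0 \<theta> = vector [x, 0, 0]" for \<theta> by (simp add: merid_def)
  have "axial_dir \<theta> \<bullet> G (merid x 0 \<theta>) = G (vector [x, 0, 0]) $ 1" for \<theta>
    unfolding m inner_3[of "axial_dir \<theta>"] axial_dir_component by simp
  then have "axial_mean x 0 = integral (cbox 0 (2*pi)) (\<lambda>\<theta>. G (vector [x, 0, 0]) $ 1)"
    by (simp only: mean_def)
  also have "\<dots> = 2 * pi * G (vector [x, 0, 0]) $ 1" unfolding integral_const by simp
  finally have e: "axial_mean x 0 = 2 * pi * G (vector [x, 0, 0]) $ 1" .
  have "1 * axial_mean x 0 \<le> 18 * pi * L" by (rule axial_gradient_bound_signed[OF x]) simp
  moreover have "(-1) * axial_mean x 0 \<le> 18 * pi * L" by (rule axial_gradient_bound_signed[OF x]) simp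
  ultimately have "\<bar>axial_mean x 0\<bar> \<le> 18 * pi * L" by linarith
  moreover have "\<bar>2 * pi * G (vector [x, 0, 0]) $ 1\<bar> = (2 * pi) * \<bar>G (vector [x, 0, 0]) $ 1\<bar>"
    by (simp only: abs_mult abs_of_pos[OF pi_gt_zero] abs_numeral)
  moreover have "18 * pi * L = (2 * pi) * (9 * L)" by simp
  ultimately have "(2 * pi) * \<bar>G (vector [x, 0, 0]) $ 1\<bar> \<le> (2 * pi) * (9 * L)" unfolding e by (simp only:)
  then show ?thesis by (rule mult_left_le_imp_le) simp
qed

end

subsection \<open>The gradient on the segment\<close>

text \<open>The odd part with respect to the plane through \<open>p\<close> satisfies the linear
  bound in the half ball; its difference quotient recovers \<open>D $ i\<close>.\<close>

lemma interior_gradient_bound: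
  fixes u :: "real^3 \<Rightarrow> real"
  assumes cont: "continuous_on (cball p 1) u" and lap: "\<And>q. q \<in> ball p 1 \<Longrightarrow> has_lap u q 0"
    and M: "\<And>q. q \<in> cball p 1 \<Longrightarrow> \<bar>u q\<bar> \<le> M" "0 < M"
    and D: "(u has_derivative (\<lambda>h. h \<bullet> D)) (at p)"
  shows "\<bar>D $ i\<bar> \<le> 5 * M"
proof -
  let ?\<rho> = "reflect i (p $ i)"
  have signed: "\<sigma> * D $ i \<le> 5 * M" if \<sigma>: "\<bar>\<sigma>\<bar> = (1::real)" for \<sigma>
  proof -
    define v where "v q = \<sigma>/2 * u q + (- \<sigma>/2) * u (?\<rho> q)" for q
    have dist_\<rho>: "dist p (?\<rho> q) = dist p q" for q
    proof -
      have "(dist p (?\<rho> q))^2 = (dist p q)^2"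
        unfolding dist_norm norm3_sq using exhaust_3[of i]
        by (auto simp: reflect_def power2_eq_square algebra_simps)
      then show ?thesis by simp
    qed
    have "continuous_on UNIV ?\<rho>"
      by (rule continuous_on_vec3) (use exhaust_3[of i] in \<open>auto simp: reflect_def intro!: continuous_intros\<close>)
    then have c\<rho>: "continuous_on (cball p 1) (\<lambda>q. u (?\<rho> q))"
      by (intro continuous_on_compose2[OF cont]) (auto intro: continuous_on_subset simp: dist_\<rho>)
    have bound: "v (p + t *\<^sub>R axis i 1) \<le> 5 * M * t" if "0 \<le> t" "t \<le> 1" for t
    proof (rule odd_harmonic_linear_bound)
      show "continuous_on (cball p 1 \<inter> {x. p $ i \<le> x $ i}) v" unfolding v_def
        by (intro continuous_intros continuous_on_subset[OF cont] continuous_on_subset[OF c\<rho>]) auto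
      show "has_lap v x 0" if "x \<in> ball p 1" for x
      proof -
        have "has_lap (\<lambda>q. u (?\<rho> q)) x 0" using that by (intro has_lap_reflect lap) (simp add: dist_\<rho>)
        from has_lap_lincomb[OF lap[OF that] this, of "\<sigma>/2" "- \<sigma>/2"] show ?thesis by (simp add: v_def[abs_def])
      qed
      show "v x \<le> 0" if "x $ i = p $ i" for x
      proof -
        have "?\<rho> x = x" using that by (auto simp: reflect_def vec_eq_iff)
        then show ?thesis by (simp add: v_def)
      qed
      show "v x \<le> M" if "x \<in> cball p 1" for x
      proof -
        have "\<bar>u x\<bar> \<le> M" "\<bar>u (?\<rho> x)\<bar> \<le> M" using M(1)[OF that] M(1)[of "?\<rho> x"] that by (auto simp: dist_\<rho>)
        moreover have "\<sigma> = 1 \<or> \<sigma> = -1" using \<sigma> by (auto simp: abs_if split: if_splits)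
        ultimately show ?thesis by (auto simp: v_def abs_le_iff)
      qed
    qed (use M(2) that in auto)
    have lim: "((\<lambda>t. v (p + t *\<^sub>R axis i 1) / t) \<longlongrightarrow> \<sigma> * D $ i) (at_right 0)"
      unfolding v_def by (rule odd_part_limit[OF D])
    have "\<forall>\<^sub>F t in at_right (0::real). 0 < t \<and> t < 1"
      unfolding eventually_at_right_field by (intro exI[of _ 1]) auto
    then have "\<forall>\<^sub>F t in at_right 0. v (p + t *\<^sub>R axis i 1) / t \<le> 5 * M"
      by (rule eventually_mono) (use bound in \<open>auto simp: divide_le_eq\<close>)
    then show ?thesis by (rule tendsto_upperbound[OF lim]) simp
  qed
  show ?thesis using signed[of 1] signed[of "-1"] by (simp add: abs_le_iff)
qed

text \<open>On the spheres \<open>u\<close> is meaningful from one side only, so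
  \<open>grad u\<close> says nothing there. The field from \<open>C1_up_to_boundary\<close> takes
  its place and agrees with \<open>grad u\<close> in the open exterior.\<close>

lemma insulated_solution_neumann_gradient:
  assumes u: "insulated_solution \<epsilon> H u" and eps: "0 < \<epsilon>" "\<epsilon> < 1"
    and M: "\<And>p. p \<in> closure (\<Omega> \<epsilon>) \<Longrightarrow> norm p \<le> 12 \<Longrightarrow> \<bar>u p\<bar> \<le> M" "0 < M"
  obtains G where "neumann_gradient \<epsilon> (5 * M) G (\<lambda>i. grad (\<lambda>y. grad u y $ i))"
    "\<And>y. y \<in> \<Omega> \<epsilon> \<Longrightarrow> G y = grad u y"
proof -
  let ?S = "\<Omega> \<epsilon>"
  let ?X = "closure (\<Omega> \<epsilon>)"
  obtain G where G: "continuous_on ?X G" "\<And>x. x \<in> ?X \<Longrightarrow> (u has_derivative (\<lambda>h. h \<bullet> G x)) (at x within ?X)"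
    using u by (auto simp: insulated_solution_def C1_up_to_boundary_def)
  have harm: "harmonic_on ?S u" using u by (simp add: insulated_solution_def)
  have nh: "neumann_harmonic \<epsilon> u" by (rule insulated_solution_neumann_harmonic[OF u])
  have du: "(u has_derivative (\<lambda>h. h \<bullet> grad u y)) (at y)" if "y \<in> ?S" for y
    using harm that by (auto simp: harmonic_on_def C2_on_def intro: grad_has_derivative)
  have dg: "((\<lambda>y. grad u y $ i) has_derivative (\<lambda>h. h \<bullet> grad (\<lambda>y. grad u y $ i) y)) (at y)" if "y \<in> ?S" for y i
    using harm that by (auto simp: harmonic_on_def C2_on_def intro: grad_has_derivative)
  have cg: "continuous_on ?S (grad (\<lambda>y. grad u y $ i))" for i
    using harm by (auto simp: harmonic_on_def C2_on_def)
  have Gg: "G y = grad u y" if "y \<in> ?S" for y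
  proof -
    have y: "y \<in> ?X" using that closure_subset by blast
    have "at y within ?X = at y"
      by (rule at_within_nhd[of _ ?S]) (use that closure_subset in auto)
    then have "GDERIV u y :> G y" using G(2)[OF y] by (simp add: gderiv_def)
    from GDERIV_grad[OF this] show ?thesis by simp
  qed
  have "neumann_gradient \<epsilon> (5 * M) G (\<lambda>i. grad (\<lambda>y. grad u y $ i))"
  proof
    fix y i assume y: "y \<in> ?S"
    show "((\<lambda>y. G y $ i) has_derivative (\<lambda>h. h \<bullet> grad (\<lambda>y. grad u y $ i) y)) (at y)"
      by (rule has_derivative_transform_within_open[OF dg[OF y] open_exterior_domain y]) (simp add: Gg)
  next
    fix y assume "y \<in> ?S"
    then show "grad (\<lambda>y. grad u y $ 1) y $ 1 + grad (\<lambda>y. grad u y $ 2) y $ 2 + grad (\<lambda>y. grad u y $ 3) y $ 3 = 0"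
      using harm by (simp add: harmonic_on_def laplacian_def sum_3)
  next
    fix y i j assume "y \<in> ?S"
    then show "grad (\<lambda>y. grad u y $ i) y $ j = grad (\<lambda>y. grad u y $ j) y $ i"
      by (rule mixed_partials_symmetric[OF open_exterior_domain _ du dg cg])
  next
    fix c p assume c: "c \<in> {center1 \<epsilon>, center2 \<epsilon>}" and p: "dist c p = 1"
    have pX: "p \<in> ?X"
      using p c center_diff[of \<epsilon>] dist_triangle[of "center1 \<epsilon>" "center2 \<epsilon>" p] eps
      by (auto simp: closure_exterior_domain_iff dist_norm norm_minus_commute)
    define \<phi> where "\<phi> t = u (p + t *\<^sub>R (p - c))" for t
    have "\<forall>\<^sub>F t in at_right 0. p + t *\<^sub>R (p - c) \<in> ?S \<inter> UNIV"
      by (rule normal_ray_in[OF eps(1) c p pX]) auto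
    then obtain t0 where t0: "0 < t0" "\<And>t. 0 < t \<Longrightarrow> t < t0 \<Longrightarrow> p + t *\<^sub>R (p - c) \<in> ?S"
      unfolding eventually_at_right_field by auto
    \<comment> \<open>The derivative of \<open>u\<close> at \<open>p\<close> is one within the
      closure, so the chain rule is applied on a segment whose image stays in it.\<close>
    let ?T = "{0..t0/2}"
    have sub: "(\<lambda>t. p + t *\<^sub>R (p - c)) ` ?T \<subseteq> ?X"
      using t0(2) pX closure_subset[of ?S] by (force simp: less_le)
    have "((\<lambda>t. p + t *\<^sub>R (p - c)) has_derivative (\<lambda>h. h *\<^sub>R (p - c))) (at 0 within ?T)"
      by (auto intro!: derivative_eq_intros)
    moreover have "(u has_derivative (\<lambda>h. h \<bullet> G p)) (at (p + 0 *\<^sub>R (p - c)) within (\<lambda>t. p + t *\<^sub>R (p - c)) ` ?T)"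
      using has_derivative_subset[OF G(2)[OF pX] sub] by simp
    ultimately have "(\<phi> has_derivative (\<lambda>h. (h *\<^sub>R (p - c)) \<bullet> G p)) (at 0 within ?T)"
      unfolding \<phi>_def by (rule has_derivative_in_compose)
    then have "(\<phi> has_real_derivative (p - c) \<bullet> G p) (at 0 within ?T)"
      by (simp add: has_field_derivative_def mult_commute_abs)
    then have "((\<lambda>t. (\<phi> t - \<phi> 0) / (t - 0)) \<longlongrightarrow> (p - c) \<bullet> G p) (at 0 within ?T)"
      by (simp only: has_field_derivative_iff)
    moreover have "at 0 within ?T = at_right 0"
      using t0(1) by (intro at_within_Icc_at_right) simp
    ultimately have 1: "((\<lambda>t. (\<phi> t - \<phi> 0) / (t - 0)) \<longlongrightarrow> (p - c) \<bullet> G p) (at_right 0)" by simp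
    have "has_ray_deriv u p (p - c) 0" using nh c p by (auto simp: neumann_harmonic_def)
    then have "((\<lambda>t. (\<phi> t - \<phi> 0) / (t - 0)) \<longlongrightarrow> 0) (at 0 within {0..})"
      unfolding has_ray_deriv_def \<phi>_def by (simp only: has_field_derivative_iff)
    then have "((\<lambda>t. (\<phi> t - \<phi> 0) / (t - 0)) \<longlongrightarrow> 0) (at_right 0)"
      by (rule filterlim_mono) (auto intro: at_le)
    from tendsto_unique[OF _ 1 this] show "G p \<bullet> (p - c) = 0" by (simp add: inner_commute)
  next
    fix p :: "real^3" and i assume p: "4 \<le> norm p" "norm p \<le> 6"
    \<comment> \<open>For radius between 4 and 6 the unit ball around \<open>p\<close> lies between
      the radii 3 and 7, away from both balls.\<close>
    have far: "q \<in> ?S" "norm q \<le> 12" if "q \<in> cball p 1" for q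
    proof -
      have "norm (p - q) \<le> 1" using that by (simp add: dist_norm)
      then have "3 \<le> norm q" "norm q \<le> 7"
        using norm_triangle_ineq2[of p q] norm_triangle_ineq2[of q p] p by (auto simp: norm_minus_commute)
      then show "q \<in> ?S" "norm q \<le> 12" using eps by (auto intro: exterior_domain_norm)
    qed
    have pS: "p \<in> ?S" using far(1)[of p] by simp
    have "\<bar>grad u p $ i\<bar> \<le> 5 * M"
    proof (rule interior_gradient_bound[OF _ _ _ M(2) du[OF pS]])
      show "continuous_on (cball p 1) u"
      proof (rule continuous_on_subset)
        show "continuous_on ?X u" using nh by (simp add: neumann_harmonic_def)
        show "cball p 1 \<subseteq> ?X" using far(1) closure_subset[of ?S] by blast
      qed
      show "has_lap u q 0" if "q \<in> ball p 1" for q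
        using nh far(1)[of q] that by (auto simp: neumann_harmonic_def)
      show "\<bar>u q\<bar> \<le> M" if "q \<in> cball p 1" for q
        using M(1)[of q] far[OF that] closure_subset[of ?S] by blast
    qed
    then show "\<bar>G p $ i\<bar> \<le> 5 * M" by (simp add: Gg[OF pS])
  qed (use eps G cg in auto)
  then show thesis using Gg that by blast
qed

theorem theorem2p1:
  fixes H :: "real^3 \<Rightarrow> real"
  assumes "harmonic_on UNIV H"
  shows "\<exists>C::real. \<exists>\<epsilon>0>0. \<forall>\<epsilon> u. 0 < \<epsilon> \<and> \<epsilon> < \<epsilon>0 \<and> insulated_solution \<epsilon> H u \<longrightarrow>
           (\<forall>x::real. \<bar>x\<bar> < \<epsilon> / 2 \<longrightarrow>
              norm (grad u (vector [x, 0, 0])) \<le> C * (1 / \<epsilon> powr ((2 - sqrt 2) / 2)))"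
proof -
  have "H differentiable (at x)" for x using assms by (simp add: harmonic_on_def C2_on_def)
  then have cH: "continuous_on UNIV H"
    by (simp add: continuous_on_eq_continuous_at differentiable_imp_continuous_within)
  have lapH: "has_lap H p 0" for p by (rule harmonic_on_has_lap[OF assms]) auto
  have "bounded (H ` cball 0 12)"
    by (intro compact_imp_bounded compact_continuous_image continuous_on_subset[OF cH]) auto
  then obtain K0 where K0: "\<forall>p\<in>cball 0 12. \<bar>H p\<bar> \<le> K0" unfolding bounded_iff by auto
  \<comment> \<open>The maximum makes \<open>M\<close> positive, as the derivative estimates
    require.\<close>
  define K where "K = max K0 1"
  have K: "\<bar>H p\<bar> \<le> K" if "norm p \<le> 12" for p using K0 that by (auto simp: K_def le_max_iff_disj)
  define M where "M = 3 * K"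
  have M0: "0 < M" by (simp add: M_def K_def)
  \<comment> \<open>\<open>5445 = 45 + 2 * 2700\<close>, where \<open>45 = 9 * 5\<close> combines
    the axial bound \<open>9 * L\<close> with \<open>L = 5 * M\<close>.\<close>
  have main: "norm (grad u (vector [x, 0, 0])) \<le> (5445 * M) * (1 / \<epsilon> powr ((2 - sqrt 2) / 2))"
    if eps: "0 < \<epsilon>" "\<epsilon> < 1/8000" and u: "insulated_solution \<epsilon> H u" and x: "\<bar>x\<bar> < \<epsilon>/2" for \<epsilon> u x
  proof -
    let ?p = "vector [x, 0, 0] :: real^3"
    have eps1: "\<epsilon> < 1" "\<epsilon> \<le> 1/8000" using eps by auto
    have nh: "neumann_harmonic \<epsilon> u" by (rule insulated_solution_neumann_harmonic[OF u])
    have lim: "((\<lambda>x. u x - H x) \<longlongrightarrow> 0) at_infinity"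
    proof -
      have "(\<lambda>x. u x - H x) \<in> O[at_infinity](\<lambda>x. 1 / norm x ^ 2)" using u by (simp add: insulated_solution_def)
      moreover have "((\<lambda>x::real^3. 1 / norm x ^ 2) \<longlongrightarrow> 0) at_infinity"
        using tendsto_power[OF tendsto_inverse_0_at_top[OF filterlim_norm_at_top], of 2]
        by (simp add: power_inverse divide_inverse)
      moreover from tendsto_mult_right_zero[OF tendsto_norm_zero[OF this]]
      have "((\<lambda>x::real^3. c * norm (1 / norm x ^ 2)) \<longlongrightarrow> 0) at_infinity" for c :: real .
      ultimately show ?thesis by (elim landau_o.bigE) (rule Lim_null_comparison)
    qed
    have uM: "\<bar>u p\<bar> \<le> M" if "p \<in> closure (\<Omega> \<epsilon>)" "norm p \<le> 12" for p
      unfolding M_def by (rule neumann_harmonic_bound[OF nh eps(1) eps1(1) cH lapH K lim that])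
    obtain G where G: "neumann_gradient \<epsilon> (5 * M) G (\<lambda>i. grad (\<lambda>y. grad u y $ i))"
      "\<And>y. y \<in> \<Omega> \<epsilon> \<Longrightarrow> G y = grad u y"
      using insulated_solution_neumann_gradient[OF u eps(1) eps1(1) uM M0] by blast
    have pS: "?p \<in> \<Omega> \<epsilon>"
    proof -
      have "\<bar>x - (1 + \<epsilon>/2)\<bar> > 1" "\<bar>x + (1 + \<epsilon>/2)\<bar> > 1" using x by (auto simp: abs_if split: if_splits)
      then have "1 < (x - (1 + \<epsilon>/2))^2" "1 < (x + (1 + \<epsilon>/2))^2"
        using abs_le_square_iff[of "x - (1 + \<epsilon>/2)" 1] abs_le_square_iff[of "x + (1 + \<epsilon>/2)" 1] by auto
      then have "1^2 < (dist (center1 \<epsilon>) ?p)^2" "1^2 < (dist (center2 \<epsilon>) ?p)^2"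
        unfolding dist_center_sq by (simp_all add: vector_3)
      then show ?thesis unfolding exterior_domain_iff using power_less_imp_less_base[OF _ zero_le_dist] by blast
    qed
    have "u differentiable (at ?p)"
      using u pS by (auto simp: insulated_solution_def harmonic_on_def C2_on_def)
    then have D: "(u has_derivative (\<lambda>h. h \<bullet> grad u ?p)) (at ?p)" by (rule grad_has_derivative)
    define R where "R = \<epsilon> powr (-\<gamma>)"
    \<comment> \<open>This lets the bounded axial derivative be absorbed into the common
      rate.\<close>
    have "1 powr (-\<gamma>) \<le> R" unfolding R_def using eps eps1 neck_exponent by (intro powr_mono2') auto
    then have R1: "1 \<le> R" by simp
    have "\<bar>grad u ?p $ 1\<bar> \<le> 45 * M"
      using neumann_gradient.axial_gradient_bound[OF G(1) x] G(2)[OF pS] by simp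
    also have "\<dots> \<le> 45 * M * R" using R1 M0 by simp
    finally have 1: "\<bar>grad u ?p $ 1\<bar> \<le> 45 * M * R" .
    have 2: "\<bar>grad u ?p $ 2\<bar> \<le> 2700 * M * R" unfolding R_def
      by (rule transversal_derivative_bound[OF nh eps(1) eps1(2) uM M0 refl x D])
    have 3: "\<bar>grad u ?p $ 3\<bar> \<le> 2700 * M * R" unfolding R_def
      by (rule transversal_derivative_bound_3[OF nh eps(1) eps1(2) uM M0 refl x D])
    have "norm (grad u ?p) \<le> (\<Sum>i\<in>UNIV. \<bar>grad u ?p $ i\<bar>)" by (rule norm_le_l1_cart)
    also have "\<dots> \<le> 5445 * M * R" using 1 2 3 by (simp add: sum_3)
    also have "R = 1 / \<epsilon> powr ((2 - sqrt 2) / 2)"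
      by (simp only: R_def powr_minus_divide neck_exponent_def)
    finally show ?thesis by simp
  qed
  show ?thesis
    by (intro exI[of _ "5445 * M"] exI[of _ "1/8000"] conjI allI impI) (use main in auto)
qed

end
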